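(* Let $E\to M$ be a rank $n$ hermitian complex vector bundle over a smooth finite dimensional manifold such that $LFrE$ admits a reduction $j:L^0FrE\to LFrE$ of its structure group to $L^0U(n)$, and let $\omega$ be a connection 1-form on $FrE$. Then the equivariant 2-form $j^*\mathrm{Tr}(\tilde\Omega-u\tilde\omega(X))$ on $L^0FrE$ is basic.
   Context: For a manifold $Y$, $LY=C^\infty(S^1,Y)$ is the free loop space with the Fréchet topology, $S^1=\mathbb{R}/2\pi\mathbb{Z}$. $FrE\to M$ is the unitary frame bundle and $\tilde\pi:LFrE\to LM$ is a principal $LU(n)$-bundle with right action $(R_a\gamma)(\theta)=\gamma(\theta)a(\theta)$. $S^1$ acts on $LFrE$ by $(k_{\theta_0}\gamma)(\theta)=\gamma(\theta+\theta_0)$ with generating vector field $X$, $X_\gamma=\dot\gamma$. The connection $\omega$ with curvature $\Omega$ induces the connection $\tilde\omega(Y)(\theta)=\omega(Y(\theta))$ on $LFrE$, with curvature $\tilde\Omega(Y,Z)(\theta)=\Omega(Y(\theta),Z(\theta))$. $\mathrm{Tr}\,A=\frac{1}{2\pi}\int_{S^1}\mathrm{tr}\,A(\theta)\,d\theta$ for $A\in L\mathfrak{u}(n)$, extended to forms. $u$ is a formal variable of degree $2$ (the Cartan model is $(\Lambda^*_{S^1}(N)[u],d-u\,i_X)$). $L^0U(n)$ is the connected component of the identity in $LU(n)$. The reduced bundle $\hat\pi:L^0FrE\to LM$ is a principal $L^0U(n)$-bundle with embedding $j$ satisfying $\hat\pi=\tilde\pi\circ j$ and $j\circ R_a=R_a\circ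 j$ for $a\in L^0U(n)$, chosen so that $j(L^0FrE)$ contains the constant loops in $FrE$; it carries the $S^1$-action $\hat k_\theta=j^{-1}k_\theta j$. A form (with polynomial dependence on $u$) on $L^0FrE$ is basic if it is $L^0U(n)$-invariant and horizontal, i.e. its contraction with every vertical vector vanishes. *)

theory Defs
  imports
    "HOL-Analysis.Analysis"
    "HOL-Library.Function_Algebras"
    "HOL-Computational_Algebra.Polynomial"
begin

section \<open>Smooth maps between open subsets of finite-dimensional normed spaces\<close>

text \<open>The following are the usual \<open>C\<^sup>k\<close> maps when the first space is finite-dimensional and the
  set is open, which are the only circumstances in which they are used.\<close>

primrec Ck_on :: "nat \<Rightarrow> ('a::real_normed_vector \<Rightarrow> 'b::real_normed_vector) \<Rightarrow> 'a set \<Rightarrow> bool" where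
  "Ck_on 0 f S \<longleftrightarrow> continuous_on S f"
| "Ck_on (Suc k) f S \<longleftrightarrow>
     (\<forall>x\<in>S. f differentiable (at x)) \<and> (\<forall>v. Ck_on k (\<lambda>x. frechet_derivative f (at x) v) S)"

definition smooth_on :: "'a::real_normed_vector set \<Rightarrow> ('a \<Rightarrow> 'b::real_normed_vector) \<Rightarrow> bool" where
  "smooth_on S f \<longleftrightarrow> (\<forall>k. Ck_on k f S)"

text \<open>Smoothness on an arbitrary subset: local extendability to smooth maps on open sets.\<close>

definition smooth_on_subset ::
    "'a::real_normed_vector set \<Rightarrow> ('a \<Rightarrow> 'b::real_normed_vector) \<Rightarrow> bool" where
  "smooth_on_subset S f \<longleftrightarrow>
     (\<forall>x\<in>S. \<exists>W F. open W \<and> x \<in> W \<and> smooth_on W F \<and> (\<forall>y\<in>S \<inter> W. F y = f y))"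


section \<open>Finite-dimensional manifolds\<close>

text \<open>A chart is a pair (domain, coordinate map).  A manifold is given by an atlas \<open>A\<close>; its set of
  points is the union of the chart domains and its topology is the one induced by the charts.  The
  model space is a finite-dimensional real normed space, possibly of dimension \<open>0\<close>.\<close>

type_synonym ('x, 'e) chart = "'x set \<times> ('x \<Rightarrow> 'e)"

definition chart_inv :: "('x, 'e) chart \<Rightarrow> 'e \<Rightarrow> 'x" where
  "chart_inv \<kappa> = inv_into (fst \<kappa>) (snd \<kappa>)"

definition points :: "('x, 'e) chart set \<Rightarrow> 'x set" where
  "points A = (\<Union>\<kappa>\<in>A. fst \<kappa>)"

definition manifold_topology :: "('x, 'e::real_normed_vector) chart set \<Rightarrow> 'x topology" where
  "manifold_topology A =
     topology (\<lambda>U. U \<subseteq> points A \<and> (\<forall>\<kappa>\<in>A. open (snd \<kappa> ` (U \<inter> fst \<kappa>))))"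

definition smooth_manifold :: "('x, 'e::real_normed_vector) chart set \<Rightarrow> bool" where
  "smooth_manifold A \<longleftrightarrow>
     (\<exists>B::'e set. finite B \<and> span B = UNIV) \<and>
     (\<forall>\<kappa>\<in>A. inj_on (snd \<kappa>) (fst \<kappa>) \<and> open (snd \<kappa> ` fst \<kappa>)) \<and>
     (\<forall>\<kappa>\<in>A. \<forall>\<kappa>'\<in>A. open (snd \<kappa> ` (fst \<kappa> \<inter> fst \<kappa>')) \<and>
        smooth_on (snd \<kappa> ` (fst \<kappa> \<inter> fst \<kappa>')) (snd \<kappa>' \<circ> chart_inv \<kappa>)) \<and>
     Hausdorff_space (manifold_topology A) \<and> second_countable (manifold_topology A)"

text \<open>Smooth maps from an open subset of a normed space into a manifold, and from an open subset of a
  manifold into a normed space.\<close>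

definition smooth_into ::
    "('x, 'e::real_normed_vector) chart set \<Rightarrow> 'z::real_normed_vector set \<Rightarrow> ('z \<Rightarrow> 'x) \<Rightarrow> bool" where
  "smooth_into A S f \<longleftrightarrow> f ` S \<subseteq> points A \<and>
     (\<forall>\<kappa>\<in>A. open (S \<inter> f -` fst \<kappa>) \<and> smooth_on (S \<inter> f -` fst \<kappa>) (snd \<kappa> \<circ> f))"

definition smooth_from ::
    "('x, 'e::real_normed_vector) chart set \<Rightarrow> 'x set \<Rightarrow> ('x \<Rightarrow> 'z::real_normed_vector) \<Rightarrow> bool" where
  "smooth_from A W f \<longleftrightarrow> (\<forall>\<kappa>\<in>A. smooth_on (snd \<kappa> ` (fst \<kappa> \<inter> W)) (f \<circ> chart_inv \<kappa>))"

text \<open>A tangent vector at \<open>p\<close> is the family of its coordinate vectors in the charts around \<open>p\<close>,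
  transforming by the derivatives of the chart transitions (and \<open>0\<close> for all other arguments, so
  that equality and the vector space operations are the pointwise ones).\<close>

type_synonym ('x, 'e) tvec = "('x, 'e) chart \<Rightarrow> 'e"

definition coord_vec ::
    "('x, 'e::real_normed_vector) chart set \<Rightarrow> ('x, 'e) chart \<Rightarrow> 'x \<Rightarrow> 'e \<Rightarrow> ('x, 'e) tvec" where
  "coord_vec A \<kappa> p e = (\<lambda>\<kappa>'. if \<kappa>' \<in> A \<and> p \<in> fst \<kappa>'
     then frechet_derivative (snd \<kappa>' \<circ> chart_inv \<kappa>) (at (snd \<kappa> p)) e else 0)"

definition tangent_space ::
    "('x, 'e::real_normed_vector) chart set \<Rightarrow> 'x \<Rightarrow> ('x, 'e) tvec set" where
  "tangent_space A p = {v.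
     (\<forall>\<kappa>. \<not> (\<kappa> \<in> A \<and> p \<in> fst \<kappa>) \<longrightarrow> v \<kappa> = 0) \<and>
     (\<forall>\<kappa>\<in>A. p \<in> fst \<kappa> \<longrightarrow> v = coord_vec A \<kappa> p (v \<kappa>))}"

definition chart_at :: "('x, 'e) chart set \<Rightarrow> 'x \<Rightarrow> ('x, 'e) chart" where
  "chart_at A p = (SOME \<kappa>. \<kappa> \<in> A \<and> p \<in> fst \<kappa>)"

definition velocity ::
    "('x, 'e::real_normed_vector) chart set \<Rightarrow> (real \<Rightarrow> 'x) \<Rightarrow> real \<Rightarrow> ('x, 'e) tvec" where
  "velocity A c t = (\<lambda>\<kappa>. if \<kappa> \<in> A \<and> c t \<in> fst \<kappa>
     then vector_derivative (snd \<kappa> \<circ> c) (at t) else 0)"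

definition tangent_map ::
    "('x, 'e::real_normed_vector) chart set \<Rightarrow> ('y, 'f::real_normed_vector) chart set \<Rightarrow>
     ('x \<Rightarrow> 'y) \<Rightarrow> 'x \<Rightarrow> ('x, 'e) tvec \<Rightarrow> ('y, 'f) tvec" where
  "tangent_map A B f p v = (\<lambda>\<kappa>'. if \<kappa>' \<in> B \<and> f p \<in> fst \<kappa>'
     then frechet_derivative (snd \<kappa>' \<circ> f \<circ> chart_inv (chart_at A p)) (at (snd (chart_at A p) p))
            (v (chart_at A p))
     else 0)"

definition smooth_one_form ::
    "('x, 'e::real_normed_vector) chart set \<Rightarrow> ('x \<Rightarrow> ('x, 'e) tvec \<Rightarrow> 'z::real_normed_vector) \<Rightarrow> bool" where
  "smooth_one_form A \<omega> \<longleftrightarrow>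
     (\<forall>\<kappa>\<in>A. \<forall>p\<in>fst \<kappa>. linear (\<lambda>e. \<omega> p (coord_vec A \<kappa> p e))) \<and>
     (\<forall>\<kappa>\<in>A. \<forall>e. smooth_from A (fst \<kappa>) (\<lambda>p. \<omega> p (coord_vec A \<kappa> p e)))"

text \<open>Exterior derivative of a one-form, in coordinates:
  \<open>d\<omega>(v, w) = \<partial>\<^sub>v (\<omega>(w)) - \<partial>\<^sub>w (\<omega>(v))\<close> for \<open>v, w\<close> extended as constant coordinate fields.\<close>

definition ext_deriv ::
    "('x, 'e::real_normed_vector) chart set \<Rightarrow> ('x \<Rightarrow> ('x, 'e) tvec \<Rightarrow> 'z::real_normed_vector) \<Rightarrow>
     'x \<Rightarrow> ('x, 'e) tvec \<Rightarrow> ('x, 'e) tvec \<Rightarrow> 'z" where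
  "ext_deriv A \<omega> p v w =
     (let \<kappa> = chart_at A p;
          D = (\<lambda>a b. frechet_derivative
                 (\<lambda>x. \<omega> (chart_inv \<kappa> x) (coord_vec A \<kappa> (chart_inv \<kappa> x) b)) (at (snd \<kappa> p)) a)
      in D (v \<kappa>) (w \<kappa>) - D (w \<kappa>) (v \<kappa>))"


section \<open>The unitary group\<close>

type_synonym 'n mat = "complex ^ 'n ^ 'n"

definition conj_transpose :: "('n::finite) mat \<Rightarrow> 'n mat" where
  "conj_transpose A = (\<chi> i j. cnj (A $ j $ i))"

definition unitary_group :: "('n::finite) mat set" where
  "unitary_group = {g. conj_transpose g ** g = mat 1}"

definition unitary_lie_algebra :: "('n::finite) mat set" where
  "unitary_lie_algebra = {A. conj_transpose A = - A}"


section \<open>Hermitian vector bundles and their unitary frame bundles\<close>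

text \<open>The fibres are complex subspaces of one ambient complex vector space that carries no further
  structure.  This is no restriction: one may take the direct sum of all fibres.\<close>

record ('m, 'v, 'n) vbundle =
  Fibre :: "'m \<Rightarrow> 'v set"
  Scale :: "complex \<Rightarrow> 'v \<Rightarrow> 'v"
  Metric :: "'m \<Rightarrow> 'v \<Rightarrow> 'v \<Rightarrow> complex"
  Triv :: "('m set \<times> ('m \<Rightarrow> 'v \<Rightarrow> complex ^ 'n)) set"

definition hermitian_vector_bundle ::
    "('m, 'e::real_normed_vector) chart set \<Rightarrow> ('m, 'v::ab_group_add, 'n::finite) vbundle \<Rightarrow> bool" where
  "hermitian_vector_bundle A E \<longleftrightarrow>
     vector_space (Scale E) \<and>
     (\<forall>x\<in>points A. module.subspace (Scale E) (Fibre E x)) \<and>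
     points A = (\<Union>T\<in>Triv E. fst T) \<and>
     (\<forall>(U, \<tau>)\<in>Triv E. openin (manifold_topology A) U \<and>
        (\<forall>x\<in>U. bij_betw (\<tau> x) (Fibre E x) UNIV \<and>
           (\<forall>v\<in>Fibre E x. \<forall>w\<in>Fibre E x. \<tau> x (v + w) = \<tau> x v + \<tau> x w) \<and>
           (\<forall>z. \<forall>v\<in>Fibre E x. \<tau> x (Scale E z v) = z *s \<tau> x v)) \<and>
        (\<forall>(U', \<tau>')\<in>Triv E. \<forall>z.
           smooth_from A (U \<inter> U') (\<lambda>x. \<tau>' x (inv_into (Fibre E x) (\<tau> x) z))) \<and>
        (\<forall>z w. smooth_from A U (\<lambda>x. Metric E x
           (inv_into (Fibre E x) (\<tau> x) z) (inv_into (Fibre E x) (\<tau> x) w)))) \<and>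
     (\<forall>x\<in>points A. \<forall>v\<in>Fibre E x.
        (\<forall>w\<in>Fibre E x. \<forall>v'\<in>Fibre E x.
           Metric E x (v + v') w = Metric E x v w + Metric E x v' w) \<and>
        (\<forall>z. \<forall>w\<in>Fibre E x. Metric E x (Scale E z v) w = z * Metric E x v w) \<and>
        (\<forall>w\<in>Fibre E x. Metric E x w v = cnj (Metric E x v w)) \<and>
        (v \<noteq> 0 \<longrightarrow> Re (Metric E x v v) > 0))"

type_synonym ('m, 'v, 'n) frame = "'m \<times> ('n \<Rightarrow> 'v)"

definition unitary_frames ::
    "'m set \<Rightarrow> ('m, 'v, 'n::finite) vbundle \<Rightarrow> ('m, 'v, 'n) frame set" where
  "unitary_frames M E = {(x, f). x \<in> M \<and> (\<forall>i. f i \<in> Fibre E x) \<and>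
     (\<forall>i j. Metric E x (f i) (f j) = (if i = j then 1 else 0))}"

definition frame_act ::
    "('m, 'v::ab_group_add, 'n::finite) vbundle \<Rightarrow> ('m, 'v, 'n) frame \<Rightarrow> 'n mat \<Rightarrow>
     ('m, 'v, 'n) frame" where
  "frame_act E p g = (fst p, \<lambda>j. \<Sum>i\<in>UNIV. Scale E (g $ i $ j) (snd p i))"

definition frame_coords ::
    "('m \<Rightarrow> 'e) \<Rightarrow> ('m \<Rightarrow> 'v \<Rightarrow> complex ^ 'n) \<Rightarrow> ('m, 'v, 'n) frame \<Rightarrow> 'e \<times> ('n::finite) mat" where
  "frame_coords \<phi> \<tau> p = (\<phi> (fst p), \<chi> i j. \<tau> (fst p) (snd p j) $ i)"

text \<open>\<open>AP\<close> is an atlas of the smooth structure of \<open>FrE\<close>, i.e. of \<open>FrE\<close> as a submanifold of the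
  \<open>n\<close>-fold Whitney sum of \<open>E\<close>: every pair of a chart of \<open>M\<close> and a local trivialization of \<open>E\<close>
  identifies an open piece of \<open>FrE\<close> diffeomorphically with a subset of
  (model space of \<open>M\<close>) \<open>\<times>\<close> (\<open>n \<times> n\<close> matrices).  This determines the smooth structure uniquely.\<close>

definition frame_bundle_atlas ::
    "('m, 'e::real_normed_vector) chart set \<Rightarrow> ('m, 'v::ab_group_add, 'n::finite) vbundle \<Rightarrow>
     (('m, 'v, 'n) frame, 'p::real_normed_vector) chart set \<Rightarrow> bool" where
  "frame_bundle_atlas A E AP \<longleftrightarrow>
     smooth_manifold AP \<and> points AP = unitary_frames (points A) E \<and>
     (\<forall>(D, \<phi>)\<in>A. \<forall>(U, \<tau>)\<in>Triv E.
        let N = {p \<in> points AP. fst p \<in> D \<inter> U}; \<Psi> = frame_coords \<phi> \<tau> in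
        openin (manifold_topology AP) N \<and> smooth_from AP N \<Psi> \<and>
        (\<forall>(D', \<psi>)\<in>AP. openin (top_of_set (\<Psi> ` N)) (\<Psi> ` (N \<inter> D')) \<and>
           smooth_on_subset (\<Psi> ` (N \<inter> D')) (\<psi> \<circ> inv_into N \<Psi>)))"


section \<open>Connections and curvature\<close>

text \<open>In the third condition \<open>g\<close> is any curve in \<open>U(n)\<close> with \<open>g(0) = 1\<close> and \<open>g'(0) = B\<close>, so that
  the velocity of \<open>p g(t)\<close> at \<open>0\<close> is the fundamental vector of \<open>B \<in> u(n)\<close> at \<open>p\<close>.\<close>

definition connection_form ::
    "('m, 'v::ab_group_add, 'n::finite) vbundle \<Rightarrow>
     (('m, 'v, 'n) frame, 'p::real_normed_vector) chart set \<Rightarrow>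
     (('m, 'v, 'n) frame \<Rightarrow> (('m, 'v, 'n) frame, 'p) tvec \<Rightarrow> 'n mat) \<Rightarrow> bool" where
  "connection_form E AP \<omega> \<longleftrightarrow>
     smooth_one_form AP \<omega> \<and>
     (\<forall>p\<in>points AP. \<forall>v\<in>tangent_space AP p. \<omega> p v \<in> unitary_lie_algebra) \<and>
     (\<forall>p\<in>points AP. \<forall>g. smooth_on UNIV g \<and> range g \<subseteq> unitary_group \<and> g 0 = mat 1 \<longrightarrow>
        \<omega> p (velocity AP (\<lambda>t::real. frame_act E p (g t)) 0) = vector_derivative g (at 0)) \<and>
     (\<forall>p\<in>points AP. \<forall>v\<in>tangent_space AP p. \<forall>g\<in>unitary_group.
        \<omega> (frame_act E p g) (tangent_map AP AP (\<lambda>q. frame_act E q g) p v)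
          = matrix_inv g ** \<omega> p v ** g)"

text \<open>The structure equation \<open>\<Omega> = d\<omega> + \<onehalf>[\<omega> \<and> \<omega>]\<close>.\<close>

definition curvature ::
    "('x, 'p::real_normed_vector) chart set \<Rightarrow> ('x \<Rightarrow> ('x, 'p) tvec \<Rightarrow> ('n::finite) mat) \<Rightarrow>
     'x \<Rightarrow> ('x, 'p) tvec \<Rightarrow> ('x, 'p) tvec \<Rightarrow> 'n mat" where
  "curvature A \<omega> p v w = ext_deriv A \<omega> p v w + (\<omega> p v ** \<omega> p w - \<omega> p w ** \<omega> p v)"


section \<open>Free loop spaces\<close>

text \<open>Loops are smooth \<open>2\<pi>\<close>-periodic maps on the real line.  The Frechet manifold \<open>LY\<close> enters
  through its topology (the \<open>C\<^sup>\<infinity>\<close> topology), through its smooth curves (by the exponential law these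
  are the curves \<open>c\<close> for which \<open>(s, \<theta>) \<mapsto> c s \<theta>\<close> is smooth) and through the tangent spaces
  (vector fields along loops).  A map between Frechet manifolds is smooth iff it
  maps smooth curves to smooth curves, and this serves as definition of smoothness below.\<close>

definition loops :: "('y, 'e::real_normed_vector) chart set \<Rightarrow> (real \<Rightarrow> 'y) set" where
  "loops A = {\<gamma>. smooth_into A UNIV \<gamma> \<and> (\<forall>\<theta>. \<gamma> (\<theta> + 2 * pi) = \<gamma> \<theta>)}"

definition nth_derivative :: "nat \<Rightarrow> (real \<Rightarrow> 'e::real_normed_vector) \<Rightarrow> real \<Rightarrow> 'e" where
  "nth_derivative i = (\<lambda>f t. vector_derivative f (at t)) ^^ i"

definition loop_topology :: "('y, 'e::real_normed_vector) chart set \<Rightarrow> (real \<Rightarrow> 'y) topology" where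
  "loop_topology A = topology_generated_by
     {{\<eta> \<in> loops A. \<eta> ` {a..b} \<subseteq> D \<and> (\<forall>i\<le>k. \<forall>t\<in>{a..b}.
          dist (nth_derivative i (\<phi> \<circ> \<eta>) t) (nth_derivative i (\<phi> \<circ> \<gamma>) t) < \<epsilon>)}
      | \<gamma> D \<phi> a b k \<epsilon>. \<gamma> \<in> loops A \<and> (D, \<phi>) \<in> A \<and> a \<le> b \<and> \<gamma> ` {a..b} \<subseteq> D \<and> \<epsilon> > 0}"

definition loop_curves :: "('y, 'e::real_normed_vector) chart set \<Rightarrow> (real \<Rightarrow> real \<Rightarrow> 'y) set" where
  "loop_curves A = {c. (\<forall>s. c s \<in> loops A) \<and> smooth_into A UNIV (\<lambda>(s, \<theta>). c s \<theta>)}"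

type_synonym ('y, 'e) loop_tvec = "real \<Rightarrow> ('y, 'e) tvec"

definition loop_velocity ::
    "('y, 'e::real_normed_vector) chart set \<Rightarrow> (real \<Rightarrow> real \<Rightarrow> 'y) \<Rightarrow> ('y, 'e) loop_tvec" where
  "loop_velocity A c = (\<lambda>\<theta>. velocity A (\<lambda>s. c s \<theta>) 0)"

definition rotate_loop :: "real \<Rightarrow> (real \<Rightarrow> 'y) \<Rightarrow> real \<Rightarrow> 'y" where
  "rotate_loop \<theta>\<^sub>0 \<gamma> = (\<lambda>\<theta>. \<gamma> (\<theta> + \<theta>\<^sub>0))"

definition rotation_field ::
    "('y, 'e::real_normed_vector) chart set \<Rightarrow> (real \<Rightarrow> 'y) \<Rightarrow> ('y, 'e) loop_tvec" where
  "rotation_field A \<gamma> = loop_velocity A (\<lambda>t. rotate_loop t \<gamma>)"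

definition flat_atlas :: "('e, 'e) chart set" where
  "flat_atlas = {(UNIV, id)}"

definition loop_group :: "(real \<Rightarrow> ('n::finite) mat) set" where
  "loop_group = {a \<in> loops flat_atlas. \<forall>\<theta>. a \<theta> \<in> unitary_group}"

definition loop_group_topology :: "(real \<Rightarrow> ('n::finite) mat) topology" where
  "loop_group_topology = subtopology (loop_topology flat_atlas) loop_group"

definition loop_group0 :: "(real \<Rightarrow> ('n::finite) mat) set" where
  "loop_group0 = connected_component_of_set loop_group_topology (\<lambda>_. mat 1)"


section \<open>Principal bundles over \<open>LM\<close> with group \<open>L\<^sup>0U(n)\<close>\<close>

text \<open>A bundle chart \<open>(V, g)\<close> trivializes the bundle over the open set \<open>V\<close> by
  \<open>q \<mapsto> (proj q, g q) \<in> V \<times> L\<^sup>0U(n)\<close>.  The topology and the smooth structure of the total space are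
  the ones for which the bundle charts are diffeomorphisms onto open sets \<open>V \<times> L\<^sup>0U(n)\<close>.\<close>

record ('q, 'm, 'n) loop_bundle =
  Total :: "'q set"
  Proj :: "'q \<Rightarrow> real \<Rightarrow> 'm"
  Act :: "'q \<Rightarrow> (real \<Rightarrow> 'n mat) \<Rightarrow> 'q"
  BCharts :: "((real \<Rightarrow> 'm) set \<times> ('q \<Rightarrow> real \<Rightarrow> 'n mat)) set"

definition over :: "('q, 'm, 'n::finite) loop_bundle \<Rightarrow> (real \<Rightarrow> 'm) set \<Rightarrow> 'q set" where
  "over B V = {q \<in> Total B. Proj B q \<in> V}"

text \<open>The last condition says that the chart transition, which by equivariance is left multiplication
  by \<open>\<gamma> \<mapsto> g' (\<sigma> \<gamma>)\<close> with \<open>\<sigma>\<close> the section given by \<open>g (\<sigma> \<gamma>) = 1\<close>, is smooth.\<close>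

definition principal_loop_bundle ::
    "('m, 'e::real_normed_vector) chart set \<Rightarrow> ('q, 'm, 'n::finite) loop_bundle \<Rightarrow> bool" where
  "principal_loop_bundle A B \<longleftrightarrow>
     Proj B ` Total B = loops A \<and>
     (\<forall>q\<in>Total B. Act B q (\<lambda>_. mat 1) = q \<and>
        (\<forall>a\<in>loop_group0. Act B q a \<in> Total B \<and> Proj B (Act B q a) = Proj B q \<and>
           (\<forall>b\<in>loop_group0. Act B (Act B q a) b = Act B q (\<lambda>\<theta>. a \<theta> ** b \<theta>)))) \<and>
     loops A = (\<Union>T\<in>BCharts B. fst T) \<and>
     (\<forall>(V, g)\<in>BCharts B. openin (loop_topology A) V \<and>
        bij_betw (\<lambda>q. (Proj B q, g q)) (over B V) (V \<times> loop_group0) \<and>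
        (\<forall>q\<in>over B V. \<forall>a\<in>loop_group0. g (Act B q a) = (\<lambda>\<theta>. g q \<theta> ** a \<theta>)) \<and>
        (\<forall>(V', g')\<in>BCharts B. \<forall>c\<in>loop_curves A.
           smooth_on ({s. c s \<in> V \<inter> V'} \<times> UNIV)
             (\<lambda>(s, \<theta>). g' (inv_into (over B V) (\<lambda>q. (Proj B q, g q)) (c s, \<lambda>_. mat 1)) \<theta>)))"

definition bundle_topology ::
    "('m, 'e::real_normed_vector) chart set \<Rightarrow> ('q, 'm, 'n::finite) loop_bundle \<Rightarrow> 'q topology" where
  "bundle_topology A B = topology (\<lambda>W. W \<subseteq> Total B \<and> (\<forall>(V, g)\<in>BCharts B.
     openin (prod_topology (loop_topology A) (subtopology loop_group_topology loop_group0))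
       ((\<lambda>q. (Proj B q, g q)) ` (W \<inter> over B V))))"

definition bundle_curves ::
    "('m, 'e::real_normed_vector) chart set \<Rightarrow> ('q, 'm, 'n::finite) loop_bundle \<Rightarrow> (real \<Rightarrow> 'q) set" where
  "bundle_curves A B = {c. range c \<subseteq> Total B \<and> Proj B \<circ> c \<in> loop_curves A \<and>
     (\<forall>(V, g)\<in>BCharts B. smooth_on ({s. c s \<in> over B V} \<times> UNIV) (\<lambda>(s, \<theta>). g (c s) \<theta>))}"

text \<open>Tangent vectors of the total space at \<open>q\<close> are equivalence classes of smooth curves through
  \<open>q\<close>; curves are equivalent if they differentiate all locally defined smooth functions alike.\<close>

definition smooth_function_on ::
    "('m, 'e::real_normed_vector) chart set \<Rightarrow> ('q, 'm, 'n::finite) loop_bundle \<Rightarrow>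
     'q set \<Rightarrow> ('q \<Rightarrow> real) \<Rightarrow> bool" where
  "smooth_function_on A B W f \<longleftrightarrow>
     openin (bundle_topology A B) W \<and> (\<forall>c\<in>bundle_curves A B. smooth_on {s. c s \<in> W} (f \<circ> c))"

definition curve_class ::
    "('m, 'e::real_normed_vector) chart set \<Rightarrow> ('q, 'm, 'n::finite) loop_bundle \<Rightarrow>
     (real \<Rightarrow> 'q) \<Rightarrow> (real \<Rightarrow> 'q) set" where
  "curve_class A B c = {c' \<in> bundle_curves A B. c' 0 = c 0 \<and>
     (\<forall>W f. c 0 \<in> W \<and> smooth_function_on A B W f \<longrightarrow>
        vector_derivative (f \<circ> c') (at 0) = vector_derivative (f \<circ> c) (at 0))}"

definition bundle_tangent ::
    "('m, 'e::real_normed_vector) chart set \<Rightarrow> ('q, 'm, 'n::finite) loop_bundle \<Rightarrow>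
     'q \<Rightarrow> (real \<Rightarrow> 'q) set set" where
  "bundle_tangent A B q = curve_class A B ` {c \<in> bundle_curves A B. c 0 = q}"

text \<open>Differentials of a smooth map from the total space to a loop space, and of a smooth map from
  the total space to itself.\<close>

definition differential_to_loops ::
    "('y, 'e::real_normed_vector) chart set \<Rightarrow> ('q \<Rightarrow> real \<Rightarrow> 'y) \<Rightarrow> (real \<Rightarrow> 'q) set \<Rightarrow>
     ('y, 'e) loop_tvec" where
  "differential_to_loops A F v = loop_velocity A (F \<circ> (SOME c. c \<in> v))"

definition bundle_differential ::
    "('m, 'e::real_normed_vector) chart set \<Rightarrow> ('q, 'm, 'n::finite) loop_bundle \<Rightarrow>
     ('q \<Rightarrow> 'q) \<Rightarrow> (real \<Rightarrow> 'q) set \<Rightarrow> (real \<Rightarrow> 'q) set" where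
  "bundle_differential A B F v = curve_class A B (F \<circ> (SOME c. c \<in> v))"

definition vertical_vectors ::
    "('m, 'e::real_normed_vector) chart set \<Rightarrow> ('q, 'm, 'n::finite) loop_bundle \<Rightarrow>
     'q \<Rightarrow> (real \<Rightarrow> 'q) set set" where
  "vertical_vectors A B q =
     {v \<in> bundle_tangent A B q. differential_to_loops A (Proj B) v = (\<lambda>\<theta> \<kappa>. 0)}"

definition smooth_embedding ::
    "('m, 'e::real_normed_vector) chart set \<Rightarrow> ('q, 'm, 'n::finite) loop_bundle \<Rightarrow>
     ('y, 'p::real_normed_vector) chart set \<Rightarrow> ('q \<Rightarrow> real \<Rightarrow> 'y) \<Rightarrow> bool" where
  "smooth_embedding A B AP j \<longleftrightarrow>
     (\<forall>c\<in>bundle_curves A B. j \<circ> c \<in> loop_curves AP) \<and>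
     (\<forall>q\<in>Total B. inj_on (differential_to_loops AP j) (bundle_tangent A B q)) \<and>
     embedding_map (bundle_topology A B) (loop_topology AP) j"

text \<open>Reductions of \<open>LFrE \<rightarrow> LM\<close> to \<open>L\<^sup>0U(n)\<close>, normalized by containing the constant loops.\<close>

definition loop_frame_reduction ::
    "('m, 'e::real_normed_vector) chart set \<Rightarrow> ('m, 'v::ab_group_add, 'n::finite) vbundle \<Rightarrow>
     (('m, 'v, 'n) frame, 'p::real_normed_vector) chart set \<Rightarrow>
     ('q, 'm, 'n) loop_bundle \<Rightarrow> ('q \<Rightarrow> real \<Rightarrow> ('m, 'v, 'n) frame) \<Rightarrow> bool" where
  "loop_frame_reduction A E AP B j \<longleftrightarrow>
     principal_loop_bundle A B \<and> smooth_embedding A B AP j \<and>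
     (\<forall>q\<in>Total B. Proj B q = (\<lambda>\<theta>. fst (j q \<theta>))) \<and>
     (\<forall>q\<in>Total B. \<forall>a\<in>loop_group0. j (Act B q a) = (\<lambda>\<theta>. frame_act E (j q \<theta>) (a \<theta>))) \<and>
     (\<forall>p\<in>points AP. (\<lambda>_. p) \<in> j ` Total B)"


section \<open>Equivariant forms\<close>

text \<open>A \<open>'z\<close>-valued form of arbitrary degree assigns a value to every point and every list of tangent
  vectors there; its component of degree \<open>k\<close> is the restriction to lists of length \<open>k\<close>.  An equivariant
  form is a polynomial in \<open>u\<close> whose coefficients are forms.\<close>

type_synonym ('x, 't, 'z) form = "'x \<Rightarrow> 't list \<Rightarrow> 'z"

definition zero_form :: "('x \<Rightarrow> 'z) \<Rightarrow> ('x, 't, 'z::zero) form" where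
  "zero_form f = (\<lambda>x ts. case ts of [] \<Rightarrow> f x | _ \<Rightarrow> 0)"

definition two_form :: "('x \<Rightarrow> 't \<Rightarrow> 't \<Rightarrow> 'z) \<Rightarrow> ('x, 't, 'z::zero) form" where
  "two_form f = (\<lambda>x ts. case ts of [v, w] \<Rightarrow> f x v w | _ \<Rightarrow> 0)"

definition loop_connection ::
    "('y \<Rightarrow> ('y, 'p) tvec \<Rightarrow> 'n mat) \<Rightarrow> (real \<Rightarrow> 'y) \<Rightarrow> ('y, 'p) loop_tvec \<Rightarrow>
     real \<Rightarrow> ('n::finite) mat" where
  "loop_connection \<omega> \<gamma> Y = (\<lambda>\<theta>. \<omega> (\<gamma> \<theta>) (Y \<theta>))"

definition loop_curvature ::
    "('y \<Rightarrow> ('y, 'p) tvec \<Rightarrow> ('y, 'p) tvec \<Rightarrow> 'n mat) \<Rightarrow> (real \<Rightarrow> 'y) \<Rightarrow>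
     ('y, 'p) loop_tvec \<Rightarrow> ('y, 'p) loop_tvec \<Rightarrow> real \<Rightarrow> ('n::finite) mat" where
  "loop_curvature \<Omega> \<gamma> Y Z = (\<lambda>\<theta>. \<Omega> (\<gamma> \<theta>) (Y \<theta>) (Z \<theta>))"

definition loop_trace :: "(real \<Rightarrow> ('n::finite) mat) \<Rightarrow> complex" where
  "loop_trace A = 1 / (2 * of_real pi) * integral {0..2 * pi} (\<lambda>\<theta>. trace (A \<theta>))"

text \<open>\<open>\<Omega>\<^sup>~ - u \<omega>\<^sup>~(X)\<close> as a polynomial in \<open>u\<close> with coefficients the loop-algebra-valued forms on the
  loop space.\<close>

definition equivariant_curvature ::
    "('y, 'p::real_normed_vector) chart set \<Rightarrow> ('y \<Rightarrow> ('y, 'p) tvec \<Rightarrow> ('n::finite) mat) \<Rightarrow>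
     (real \<Rightarrow> 'y, ('y, 'p) loop_tvec, real \<Rightarrow> 'n mat) form poly" where
  "equivariant_curvature AP \<omega> =
     [: two_form (loop_curvature (curvature AP \<omega>)),
        - zero_form (\<lambda>\<gamma>. loop_connection \<omega> \<gamma> (rotation_field AP \<gamma>)) :]"

definition eq_trace ::
    "('x, 't, real \<Rightarrow> ('n::finite) mat) form poly \<Rightarrow> ('x, 't, complex) form poly" where
  "eq_trace = map_poly (\<lambda>\<alpha> x ts. loop_trace (\<alpha> x ts))"

definition eq_pullback ::
    "('q \<Rightarrow> 'x) \<Rightarrow> ('s \<Rightarrow> 't) \<Rightarrow> ('x, 't, complex) form poly \<Rightarrow> ('q, 's, complex) form poly" where
  "eq_pullback F dF = map_poly (\<lambda>\<alpha> q vs. \<alpha> (F q) (map dF vs))"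

definition basic ::
    "('m, 'e::real_normed_vector) chart set \<Rightarrow> ('q, 'm, 'n::finite) loop_bundle \<Rightarrow>
     ('q, (real \<Rightarrow> 'q) set, complex) form poly \<Rightarrow> bool" where
  "basic A B \<alpha> \<longleftrightarrow> (\<forall>k. \<forall>q\<in>Total B.
     (\<forall>a\<in>loop_group0. \<forall>vs\<in>lists (bundle_tangent A B q).
        poly.coeff \<alpha> k (Act B q a) (map (bundle_differential A B (\<lambda>q. Act B q a)) vs)
          = poly.coeff \<alpha> k q vs) \<and>
     (\<forall>v\<in>vertical_vectors A B q. \<forall>vs\<in>lists (bundle_tangent A B q).
        poly.coeff \<alpha> k q (v # vs) = 0))"

end

theory Submission
  imports Defs
begin

text \<open>Both coefficients are studied pointwise in \<open>\<theta>\<close>, along smooth families of frames: there the exterior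
  derivative of \<open>\<omega>\<close> is a difference of partial derivatives.  Translation by \<open>a(\<theta>)\<close> conjugates the
  curvature, which leaves its trace unchanged, and the curvature vanishes on vertical vectors.
  The term \<open>\<omega>\<^sup>~(X)\<close> is not merely conjugated: translation by \<open>a\<close> also adds
  \<open>a\<^sup>* a'\<close>, the integral of whose trace is \<open>2\<pi>\<i>\<close> times the winding number of \<open>det a\<close>.  This integral is continuous
  on \<open>LU(n)\<close> with values in a discrete set, so it vanishes on the identity component.\<close>

section \<open>Calculus of smooth maps\<close>

text \<open>\<open>ext_deriv\<close> and \<open>tangent_map\<close> are computed in a chart picked
  by choice, and their definitions alone do not show that the outcome is independent of it. The way
  round is to realise tangent vectors as partial velocities of smooth families: along a family both
  notions become partial derivatives in which no chosen chart occurs. A second choice sits in the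
  tangent vectors of the total space, which are classes of curves differentiated through an
  unspecified member; the coordinates of \<open>j\<close> at each parameter supply enough smooth
  functions to remove it. The smooth structure of FrE is accessible through frame coordinates, whose
  image is not open among all matrices, so smoothness is transported by local extensions to open
  sets. For horizontality, vertical vectors must be recognised as fundamental vectors of elements of
  u(n); this comes from differentiating the orthonormality relation of the frames. The coefficient
  of \<open>u\<close> is a form of degree 0, so its contractions vanish for free and only its
  invariance is in question.\<close>

text \<open>On the compact l1 unit sphere of coefficients the norm attains its minimum, which is
  positive by independence; homogeneity extends the bound to all coefficients.\<close>

lemma independent_coeffs_bound:
  fixes B :: "'a::real_normed_vector set"
  assumes fin: "finite B" and ind: "independent B"
  shows "\<exists>e>0. \<forall>u. (\<Sum>b\<in>B. \<bar>u b\<bar>) * e \<le> norm (\<Sum>b\<in>B. u b *\<^sub>R b)"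
proof (cases "B = {}")
  case True
  then show ?thesis by (auto intro: exI[of _ 1])
next
  case False
  let ?f = "\<lambda>u :: 'a \<Rightarrow> real. norm (\<Sum>b\<in>B. u b *\<^sub>R b)"
  \<comment> \<open>The coefficient families range over the whole type, where the function topology
    is the product topology and the box is compact by Tychonoff; only the entries in
    \<open>B\<close> enter the norm.\<close>
  let ?K = "PiE UNIV (\<lambda>_ :: 'a. {-1..1 :: real}) \<inter> (\<lambda>u. \<Sum>b\<in>B. \<bar>u b\<bar>) -` {1}"
  have coord: "continuous_on UNIV (\<lambda>u :: 'a \<Rightarrow> real. u b)" for b by (rule continuous_on_product_coordinates)
  have "compactin (product_topology (\<lambda>_ :: 'a. euclidean) UNIV) (PiE UNIV (\<lambda>_. {-1..1 :: real}))"
    by (simp add: compactin_PiE)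
  then have "compact (PiE UNIV (\<lambda>_ :: 'a. {-1..1 :: real}))" by (simp add: euclidean_product_topology)
  moreover have "closed ((\<lambda>u :: 'a \<Rightarrow> real. \<Sum>b\<in>B. \<bar>u b\<bar>) -` {1})"
    by (intro closed_vimage closed_singleton continuous_on_sum continuous_on_rabs coord)
  ultimately have K: "compact ?K" by (rule compact_Int_closed)
  obtain b0 where b0: "b0 \<in> B" using False by blast
  have "(\<lambda>b. if b = b0 then 1 else 0) \<in> ?K" using b0 fin by (auto simp: if_distrib cong: if_cong)
  then have ne: "?K \<noteq> {}" by blast
  have "continuous_on ?K ?f"
    by (intro continuous_on_norm continuous_on_sum continuous_on_scaleR continuous_on_const
        continuous_on_subset[OF coord]) auto
  from continuous_attains_inf[OF K ne this] obtain v where v: "v \<in> ?K" "\<forall>u\<in>?K. ?f v \<le> ?f u" by blast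
  have pos: "?f v > 0"
  proof (rule ccontr)
    assume "\<not> ?f v > 0"
    then have "(\<Sum>b\<in>B. v b *\<^sub>R b) = 0" by simp
    then have "v b = 0" if "b \<in> B" for b using independentD[OF ind fin subset_refl _ that] by blast
    then show False using v(1) by simp
  qed
  have "(\<Sum>b\<in>B. \<bar>u b\<bar>) * ?f v \<le> ?f u" for u
  proof (cases "(\<Sum>b\<in>B. \<bar>u b\<bar>) = 0")
    case False
    define r where "r = (\<Sum>b\<in>B. \<bar>u b\<bar>)"
    have "r \<ge> 0" unfolding r_def by (rule sum_nonneg) simp
    moreover have "r \<noteq> 0" using False unfolding r_def .
    ultimately have r: "r > 0" by simp
    \<comment> \<open>Resetting the entries outside \<open>B\<close> to 0 puts the rescaled family
      into the box and leaves the sum unchanged.\<close>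
    let ?u = "\<lambda>b. if b \<in> B then u b / r else 0"
    have "\<bar>u b\<bar> \<le> r" if "b \<in> B" for b unfolding r_def by (rule member_le_sum) (use that fin in auto)
    then have "\<bar>?u b\<bar> \<le> 1" for b using r by simp
    then have box: "?u \<in> PiE UNIV (\<lambda>_. {-1..1})" by (auto simp: abs_le_iff)
    have "(\<Sum>b\<in>B. \<bar>?u b\<bar>) = 1"
      using r by (simp add: r_def sum_divide_distrib[symmetric])
    then have "?u \<in> ?K" by (intro IntI box vimageI) auto
    with v(2) have "?f v \<le> ?f ?u" by (rule bspec)
    also have "(\<Sum>b\<in>B. ?u b *\<^sub>R b) = (1 / r) *\<^sub>R (\<Sum>b\<in>B. u b *\<^sub>R b)" by (simp add: scaleR_sum_right)
    finally show ?thesis using r by (simp add: r_def[symmetric] field_simps)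
  qed simp
  then show ?thesis using pos by blast
qed

text \<open>The model spaces are finite-dimensional but not of class \<open>euclidean_space\<close>; bounded coordinate
  functionals take the place of the inner product.\<close>

definition coordinates :: "'a::real_normed_vector set \<Rightarrow> ('a \<Rightarrow> 'a \<Rightarrow> real) \<Rightarrow> bool" where
  "coordinates B co \<longleftrightarrow> finite B \<and> (\<forall>b\<in>B. bounded_linear (co b)) \<and>
     (\<forall>w. w = (\<Sum>b\<in>B. co b w *\<^sub>R b))"

text \<open>A basis is extracted from the spanning set; its coefficient functionals are bounded by
  the reciprocal of the constant in \<open>independent_coeffs_bound\<close>.\<close>

lemma coordinates_exist:
  fixes B :: "'a::real_normed_vector set"
  assumes "finite B" "span B = UNIV"
  shows "\<exists>(C :: 'a set) co. coordinates C co"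
proof -
  obtain C where C: "C \<subseteq> B" "independent C" "B \<subseteq> span C"
    using maximal_independent_subset by blast
  have fin: "finite C" using finite_subset[OF C(1) assms(1)] .
  have sp: "span C = UNIV" using span_minimal[OF C(3) subspace_span] assms(2) by blast
  let ?co = "\<lambda>b w. representation C w b"
  obtain e where e: "e > 0" "\<And>u. (\<Sum>b\<in>C. \<bar>u b\<bar>) * e \<le> norm (\<Sum>b\<in>C. u b *\<^sub>R b)"
    using independent_coeffs_bound[OF fin C(2)] by blast
  have rep: "(\<Sum>b\<in>C. ?co b w *\<^sub>R b) = w" for w
    using real_vector.sum_representation_eq[OF C(2) _ fin, of w] sp by auto
  have "bounded_linear (?co b)" if "b \<in> C" for b
  proof (rule bounded_linear_intro[where K = "1 / e"])
    fix w
    have "\<bar>?co b w\<bar> * e \<le> (\<Sum>b\<in>C. \<bar>?co b w\<bar>) * e"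
      using e(1) that fin by (intro mult_right_mono member_le_sum) auto
    then have "\<bar>?co b w\<bar> * e \<le> norm w" using e(2)[of "\<lambda>b. ?co b w"] rep by simp
    then show "norm (?co b w) \<le> norm w * (1 / e)" using e(1) by (simp add: field_simps)
  qed (use C(2) sp in \<open>simp_all add: real_vector.representation_add real_vector.representation_scale\<close>)
  then have "coordinates C ?co" unfolding coordinates_def using fin rep by simp
  then show ?thesis by blast
qed

lemma coordinates_Basis: "coordinates (Basis :: 'a::euclidean_space set) (\<lambda>b w. w \<bullet> b)"
  unfolding coordinates_def by (simp add: euclidean_representation bounded_linear_inner_left)

lemma span_Times_UNIV:
  fixes B :: "'a::real_vector set" and C :: "'b::real_vector set"
  assumes "span B = UNIV" "span C = UNIV"
  shows "span (B \<times> {0} \<union> {0} \<times> C) = UNIV"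
proof -
  let ?S = "B \<times> {0} \<union> {0} \<times> C"
  have "linear (\<lambda>x :: 'a. (x, 0 :: 'b))" "linear (\<lambda>y :: 'b. (0 :: 'a, y))" by (auto intro!: linearI)
  note im = linear_span_image[OF this(1), of B] linear_span_image[OF this(2), of C]
  have "(x, 0) \<in> span ?S" "(0, y) \<in> span ?S" for x y
    using im assms span_mono[of "(\<lambda>x. (x, 0)) ` B" ?S] span_mono[of "(\<lambda>y. (0, y)) ` C" ?S] by auto
  from span_add[OF this] show ?thesis by auto
qed

lemma linear_coordinates:
  assumes "coordinates B co" "linear f"
  shows "f w = (\<Sum>b\<in>B. co b w *\<^sub>R f b)"
proof -
  have "w = (\<Sum>b\<in>B. co b w *\<^sub>R b)" using assms unfolding coordinates_def by blast
  then have "f w = f (\<Sum>b\<in>B. co b w *\<^sub>R b)" by simp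
  also have "\<dots> = (\<Sum>b\<in>B. co b w *\<^sub>R f b)"
    using assms(2) by (simp add: linear_sum linear_cmul)
  finally show ?thesis .
qed

section \<open>Calculus of \<open>Ck_on\<close> and \<open>smooth_on\<close>\<close>

abbreviation fderiv :: "('a::real_normed_vector \<Rightarrow> 'b::real_normed_vector) \<Rightarrow> 'a \<Rightarrow> 'a \<Rightarrow> 'b" where
  "fderiv f x \<equiv> frechet_derivative f (at x)"

lemma frechet_derivative_eqI:
  "(f has_derivative f') (at x) \<Longrightarrow> fderiv f x = f'"
  using frechet_derivative_at by metis

lemma Ck_on_has_derivative:
  "Ck_on (Suc k) f S \<Longrightarrow> x \<in> S \<Longrightarrow> (f has_derivative fderiv f x) (at x)"
  using frechet_derivative_works by auto

lemma Ck_on_Suc: "Ck_on (Suc k) f S \<Longrightarrow> Ck_on k f S"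
proof (induction k arbitrary: f)
  case 0
  then show ?case
    by (auto intro!: continuous_at_imp_continuous_on differentiable_imp_continuous_within)
next
  case (Suc k)
  then show ?case by auto
qed

lemma Ck_on_subset: "Ck_on k f S \<Longrightarrow> T \<subseteq> S \<Longrightarrow> Ck_on k f T"
  by (induction k arbitrary: f) (auto intro: continuous_on_subset)

text \<open>Derivatives are taken in full neighbourhoods, so agreement on \<open>S\<close> passes to
  them because \<open>S\<close> is open.\<close>

lemma Ck_on_cong:
  assumes "open S" "Ck_on k f S" "\<And>x. x \<in> S \<Longrightarrow> f x = g x"
  shows "Ck_on k g S"
  using assms(2,3)
proof (induction k arbitrary: f g)
  case 0
  then show ?case using continuous_on_cong by fastforce
next
  case (Suc k)
  have D: "(g has_derivative fderiv f x) (at x)" if "x \<in> S" for x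
    using has_derivative_transform_within_open[OF Ck_on_has_derivative[OF Suc.prems(1) that] assms(1) that]
      Suc.prems(2) by blast
  then have "fderiv g x = fderiv f x" if "x \<in> S" for x
    using that frechet_derivative_eqI by blast
  moreover have "Ck_on k (\<lambda>x. fderiv f x v) S" for v
    using Suc.prems(1) by simp
  ultimately have "Ck_on k (\<lambda>x. fderiv g x v) S" for v
    using Suc.IH[of "\<lambda>x. fderiv f x v" "\<lambda>x. fderiv g x v"]
    by simp
  then show ?case using D unfolding Ck_on.simps differentiable_def by blast
qed

lemma Ck_on_SucI:
  assumes "\<And>x. x \<in> S \<Longrightarrow> (f has_derivative f' x) (at x)" "\<And>v. Ck_on k (\<lambda>x. f' x v) S" "open S"
  shows "Ck_on (Suc k) f S"
proof -
  have "Ck_on k (\<lambda>x. fderiv f x v) S" for v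
    by (rule Ck_on_cong[OF assms(3,2)]) (simp add: frechet_derivative_eqI[OF assms(1)])
  moreover have "f differentiable (at x)" if "x \<in> S" for x
    using assms(1)[OF that] unfolding differentiable_def by blast
  ultimately show ?thesis by simp
qed

text \<open>The derivatives in \<open>Ck_on\<close> are taken in full neighbourhoods, whatever
  \<open>S\<close> is; only the continuity of the last one refers to \<open>S\<close>. Locality thus
  reduces to locality of continuity.\<close>

lemma Ck_on_local:
  assumes "\<And>x. x \<in> S \<Longrightarrow> \<exists>T. open T \<and> x \<in> T \<and> Ck_on k f (S \<inter> T)"
  shows "Ck_on k f S"
  using assms
proof (induction k arbitrary: f)
  case 0
  have "continuous (at x within S) f" if x: "x \<in> S" for x
  proof -
    obtain T where T: "open T" "x \<in> T" "continuous_on (S \<inter> T) f" using 0[OF x] by auto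
    then have "continuous (at x within S \<inter> T) f"
      using x by (simp add: continuous_on_eq_continuous_within)
    moreover have "at x within S \<inter> T = at x within S"
      by (rule at_within_nhd[of x T]) (use T in auto)
    ultimately show ?thesis by metis
  qed
  then show ?case by (simp add: continuous_on_eq_continuous_within)
next
  case (Suc k)
  have "Ck_on k (\<lambda>x. fderiv f x v) S" for v
    by (rule Suc.IH) (use Suc.prems in fastforce)
  moreover have "f differentiable (at x)" if "x \<in> S" for x
    using Suc.prems[OF that] that by auto
  ultimately show ?case by simp
qed

lemma Ck_on_const: "Ck_on k (\<lambda>x. c) S"
  by (induction k arbitrary: c) auto

lemma Ck_on_bounded_linear_comp:
  assumes "bounded_linear L" "Ck_on k f S" "open S"
  shows "Ck_on k (\<lambda>x. L (f x)) S"
  using assms(2)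
proof (induction k arbitrary: f)
  case 0
  then show ?case using assms(1) by (simp add: bounded_linear.continuous_on)
next
  case (Suc k)
  have D: "((\<lambda>x. L (f x)) has_derivative (\<lambda>v. L (fderiv f x v))) (at x)"
    if "x \<in> S" for x
    using bounded_linear.has_derivative[OF assms(1) Ck_on_has_derivative[OF Suc.prems that]] .
  have E: "Ck_on k (\<lambda>x. L (fderiv f x v)) S" for v
    using Suc by simp
  show ?case by (rule Ck_on_SucI[OF D E assms(3)])
qed

lemma Ck_on_add:
  assumes "Ck_on k f S" "Ck_on k g S" "open S"
  shows "Ck_on k (\<lambda>x. f x + g x) S"
  using assms(1,2)
proof (induction k arbitrary: f g)
  case 0
  then show ?case by (simp add: continuous_on_add)
next
  case (Suc k)
  have D: "((\<lambda>x. f x + g x) has_derivative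
      (\<lambda>v. fderiv f x v + fderiv g x v)) (at x)" if "x \<in> S" for x
    using has_derivative_add Ck_on_has_derivative Suc.prems that by blast
  have E: "Ck_on k (\<lambda>x. fderiv f x v + fderiv g x v) S" for v
    using Suc by simp
  show ?case by (rule Ck_on_SucI[OF D E assms(3)])
qed

lemma Ck_on_sum:
  assumes "finite I" "\<And>i. i \<in> I \<Longrightarrow> Ck_on k (f i) S" "open S"
  shows "Ck_on k (\<lambda>x. \<Sum>i\<in>I. f i x) S"
  using assms(1,2)
  by (induction I rule: finite_induct) (auto intro: Ck_on_add Ck_on_const assms(3))

lemma Ck_on_bilinear:
  assumes "bounded_bilinear h" "Ck_on k f S" "Ck_on k g S" "open S"
  shows "Ck_on k (\<lambda>x. h (f x) (g x)) S"
  using assms(2,3)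
proof (induction k arbitrary: f g)
  case 0
  then show ?case using assms(1) by (simp add: bounded_bilinear.continuous_on)
next
  case (Suc k)
  have D: "((\<lambda>x. h (f x) (g x)) has_derivative
      (\<lambda>v. h (f x) (fderiv g x v) + h (fderiv f x v) (g x))) (at x)"
    if "x \<in> S" for x
    by (rule bounded_bilinear.FDERIV[OF assms(1) Ck_on_has_derivative[OF Suc.prems(1) that]
          Ck_on_has_derivative[OF Suc.prems(2) that]])
  have E: "Ck_on k (\<lambda>x. h (f x) (fderiv g x v) + h (fderiv f x v) (g x)) S" for v
    using Suc.prems by (intro Ck_on_add Suc.IH assms(4)) (auto intro: Ck_on_Suc)
  show ?case by (rule Ck_on_SucI[OF D E assms(4)])
qed

text \<open>The induction hypothesis covers derivatives of \<open>f\<close> in fixed directions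
  only, whereas the chain rule produces the moving direction \<open>fderiv g x v\<close>. Expanding
  that direction in coordinates of the middle space turns the derivative into a finite sum of
  products to which the hypothesis applies; this is where finite dimension enters.\<close>

lemma Ck_on_compose:
  fixes g :: "'a::real_normed_vector \<Rightarrow> 'b::real_normed_vector"
  assumes co: "coordinates (B :: 'b set) co"
    and "Ck_on k f T" "Ck_on k g S" "g ` S \<subseteq> T" "open S"
  shows "Ck_on k (\<lambda>x. f (g x)) S"
  using assms(2,3)
proof (induction k arbitrary: f)
  case 0
  then show ?case using assms(4) continuous_on_compose2 by fastforce
next
  case (Suc k)
  have D: "((\<lambda>x. f (g x)) has_derivative
      (\<lambda>v. fderiv f (g x) (fderiv g x v))) (at x)" if "x \<in> S" for x
  proof -
    have "g x \<in> T" using that assms(4) by blast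
    from diff_chain_at[OF Ck_on_has_derivative[OF Suc.prems(2) that] Ck_on_has_derivative[OF Suc.prems(1) this]]
    show ?thesis unfolding o_def .
  qed
  have bl: "bounded_linear (co b)" if "b \<in> B" for b using co that unfolding coordinates_def by blast
  have "Ck_on k (\<lambda>x. \<Sum>b\<in>B. co b (fderiv g x v) *\<^sub>R fderiv f (g x) b) S" for v
  proof (intro Ck_on_sum Ck_on_bilinear[OF bounded_bilinear_scaleR] assms(5))
    show "finite B" using co coordinates_def by blast
    show "Ck_on k (\<lambda>x. co b (fderiv g x v)) S" if "b \<in> B" for b
    proof -
      have "Ck_on k (\<lambda>x. fderiv g x v) S" using Suc.prems(2) by simp
      then show ?thesis by (rule Ck_on_bounded_linear_comp[OF bl[OF that] _ assms(5)])
    qed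
    show "Ck_on k (\<lambda>x. fderiv f (g x) b) S" for b
    proof -
      have "Ck_on k (\<lambda>y. fderiv f y b) T" using Suc.prems(1) by simp
      from Suc.IH[OF this Ck_on_Suc[OF Suc.prems(2)]] show ?thesis .
    qed
  qed
  then have E: "Ck_on k (\<lambda>x. fderiv f (g x) (fderiv g x v)) S" for v
  proof (rule Ck_on_cong[OF assms(5)])
    fix x assume x: "x \<in> S"
    have "linear (fderiv f (g x))"
      using Suc.prems(1) x assms(4) linear_frechet_derivative by auto
    from linear_coordinates[OF co this, symmetric] show "(\<Sum>b\<in>B. co b (fderiv g x v) *\<^sub>R fderiv f (g x) b)
        = fderiv f (g x) (fderiv g x v)" .
  qed
  show ?case by (rule Ck_on_SucI[OF D E assms(5)])
qed

lemma smooth_on_subset: "smooth_on S f \<Longrightarrow> T \<subseteq> S \<Longrightarrow> smooth_on T f"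
  unfolding smooth_on_def using Ck_on_subset by blast

lemma smooth_on_cong: "open S \<Longrightarrow> smooth_on S f \<Longrightarrow> (\<And>x. x \<in> S \<Longrightarrow> f x = g x) \<Longrightarrow> smooth_on S g"
  unfolding smooth_on_def using Ck_on_cong by blast

lemma smooth_on_local:
  "(\<And>x. x \<in> S \<Longrightarrow> \<exists>T. open T \<and> x \<in> T \<and> smooth_on (S \<inter> T) f) \<Longrightarrow> smooth_on S f"
  unfolding smooth_on_def using Ck_on_local by meson

lemma smooth_on_const: "smooth_on S (\<lambda>x. c)"
  unfolding smooth_on_def using Ck_on_const by blast

lemma smooth_on_bounded_linear_comp:
  "bounded_linear L \<Longrightarrow> smooth_on S f \<Longrightarrow> open S \<Longrightarrow> smooth_on S (\<lambda>x. L (f x))"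
  unfolding smooth_on_def using Ck_on_bounded_linear_comp by blast

lemma smooth_on_add: "smooth_on S f \<Longrightarrow> smooth_on S g \<Longrightarrow> open S \<Longrightarrow> smooth_on S (\<lambda>x. f x + g x)"
  unfolding smooth_on_def using Ck_on_add by blast

lemma smooth_on_sum:
  "finite I \<Longrightarrow> (\<And>i. i \<in> I \<Longrightarrow> smooth_on S (f i)) \<Longrightarrow> open S \<Longrightarrow> smooth_on S (\<lambda>x. \<Sum>i\<in>I. f i x)"
  unfolding smooth_on_def using Ck_on_sum by blast

lemma smooth_on_bilinear:
  "bounded_bilinear h \<Longrightarrow> smooth_on S f \<Longrightarrow> smooth_on S g \<Longrightarrow> open S \<Longrightarrow> smooth_on S (\<lambda>x. h (f x) (g x))"
  unfolding smooth_on_def using Ck_on_bilinear by blast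

lemma smooth_on_compose:
  fixes g :: "'a::real_normed_vector \<Rightarrow> 'b::real_normed_vector"
  assumes "coordinates (B :: 'b set) co" "smooth_on T f" "smooth_on S g" "g ` S \<subseteq> T" "open S"
  shows "smooth_on S (\<lambda>x. f (g x))"
  using assms unfolding smooth_on_def by (blast intro: Ck_on_compose)

lemma smooth_on_deriv: "smooth_on S f \<Longrightarrow> smooth_on S (\<lambda>x. fderiv f x v)"
  unfolding smooth_on_def by (metis Ck_on.simps(2))

lemma smooth_on_differentiable: "smooth_on S f \<Longrightarrow> x \<in> S \<Longrightarrow> f differentiable (at x)"
  unfolding smooth_on_def by (metis Ck_on.simps(2))

lemma smooth_on_has_derivative:
  "smooth_on S f \<Longrightarrow> x \<in> S \<Longrightarrow> (f has_derivative fderiv f x) (at x)"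
  using smooth_on_differentiable frechet_derivative_works by blast

lemma smooth_on_continuous: "smooth_on S f \<Longrightarrow> continuous_on S f"
  unfolding smooth_on_def by (metis Ck_on.simps(1))

lemma smooth_on_bounded_linear:
  assumes "bounded_linear L" shows "smooth_on S L"
proof -
  have d: "(L has_derivative L) (at x)" for x
    using assms by (rule bounded_linear_imp_has_derivative)
  have "Ck_on k L S" for k
  proof (cases k)
    case 0
    then show ?thesis using assms by (simp add: linear_continuous_on)
  next
    case (Suc l)
    then show ?thesis using d by (auto simp: frechet_derivative_eqI[OF d] Ck_on_const intro: differentiableI)
  qed
  then show ?thesis by (simp add: smooth_on_def)
qed

lemma smooth_on_affine:
  assumes "bounded_linear L"
  shows "smooth_on UNIV (\<lambda>x. c + L x)"
  by (intro smooth_on_add smooth_on_const smooth_on_bounded_linear assms) auto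

lemma smooth_on_Pair:
  assumes "smooth_on S f" "smooth_on S g" "open S"
  shows "smooth_on S (\<lambda>x. (f x, g x))"
proof -
  have "smooth_on S (\<lambda>x. (f x, 0) + (0, g x))"
    by (intro smooth_on_add smooth_on_bounded_linear_comp[where L = "\<lambda>y. (y, 0)"]
        smooth_on_bounded_linear_comp[where L = "\<lambda>y. (0, y)"] assms
        bounded_linear_Pair bounded_linear_ident bounded_linear_zero)
  then show ?thesis by simp
qed

section \<open>Symmetry of second derivatives\<close>

lemma has_real_derivative_along_line:
  assumes "(f has_derivative F) (at (z + s *\<^sub>R d))"
  shows "((\<lambda>s. f (z + s *\<^sub>R d) :: real) has_real_derivative F d) (at s)"
proof -
  have "((\<lambda>s. z + s *\<^sub>R d) has_derivative (\<lambda>r. r *\<^sub>R d)) (at s)"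
    by (auto intro!: derivative_eq_intros)
  from diff_chain_at[OF this assms]
  have "((\<lambda>s. f (z + s *\<^sub>R d)) has_derivative (\<lambda>r. F (r *\<^sub>R d))) (at s)" by (simp add: o_def)
  moreover have "(\<lambda>r. F (r *\<^sub>R d)) = (*) (F d)"
    using linear_cmul[OF has_derivative_linear[OF assms]] by (simp add: fun_eq_iff)
  ultimately show ?thesis unfolding has_field_derivative_def by simp
qed

text \<open>Schwarz's theorem, by evaluating the second difference of \<open>f\<close> along \<open>d\<close> and \<open>e\<close> with
  the mean value theorem in both orders.\<close>

lemma second_difference:
  fixes f :: "'a::real_normed_vector \<Rightarrow> real"
  assumes "Ck_on 2 f S" "\<And>s t. 0 \<le> s \<Longrightarrow> s \<le> h \<Longrightarrow> 0 \<le> t \<Longrightarrow> t \<le> h \<Longrightarrow> z + s *\<^sub>R d + t *\<^sub>R e \<in> S" "h > 0"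
  shows "\<exists>s t. 0 < s \<and> s < h \<and> 0 < t \<and> t < h \<and>
    f (z + h *\<^sub>R d + h *\<^sub>R e) - f (z + h *\<^sub>R d) - f (z + h *\<^sub>R e) + f z
      = h * h * fderiv (\<lambda>z. fderiv f z d) (z + s *\<^sub>R d + t *\<^sub>R e) e"
proof -
  have C: "Ck_on (Suc (Suc 0)) f S" using assms(1) by (simp add: numeral_2_eq_2)
  let ?g = "\<lambda>z. fderiv f z d"
  have Cg: "Ck_on (Suc 0) ?g S" using C by simp
  have D1: "((\<lambda>s. f (z + s *\<^sub>R d + t *\<^sub>R e)) has_real_derivative ?g (z + s *\<^sub>R d + t *\<^sub>R e)) (at s)"
    if "0 \<le> s" "s \<le> h" "0 \<le> t" "t \<le> h" for s t
    using has_real_derivative_along_line[of f _ "z + t *\<^sub>R e" s d] Ck_on_has_derivative[OF C assms(2)[OF that]]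
    by (simp add: ac_simps)
  have D2: "((\<lambda>t. ?g (z + s *\<^sub>R d + t *\<^sub>R e)) has_real_derivative
      fderiv ?g (z + s *\<^sub>R d + t *\<^sub>R e) e) (at t)"
    if "0 \<le> s" "s \<le> h" "0 \<le> t" "t \<le> h" for s t
    by (rule has_real_derivative_along_line[OF Ck_on_has_derivative[OF Cg assms(2)[OF that]]])
  \<comment> \<open>The first difference of \<open>f\<close> in direction \<open>e\<close>, as a
    function of the position along \<open>d\<close>. Its mean value point \<open>s\<close> is then
    held fixed while the second mean value is taken in \<open>t\<close>. The summand
    \<open>0 *\<^sub>R e\<close> keeps the shape that \<open>D1\<close> and \<open>D2\<close>
    expect.\<close>
  let ?\<phi> = "\<lambda>s. f (z + s *\<^sub>R d + h *\<^sub>R e) - f (z + s *\<^sub>R d + 0 *\<^sub>R e)"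
  have "\<exists>s. 0 < s \<and> s < h \<and> ?\<phi> h - ?\<phi> 0 = (h - 0) * (?g (z + s *\<^sub>R d + h *\<^sub>R e) - ?g (z + s *\<^sub>R d + 0 *\<^sub>R e))"
    by (rule MVT2[OF assms(3)]) (intro DERIV_diff D1, use assms(3) in auto)
  then obtain s where s: "0 < s" "s < h"
    "?\<phi> h - ?\<phi> 0 = h * (?g (z + s *\<^sub>R d + h *\<^sub>R e) - ?g (z + s *\<^sub>R d + 0 *\<^sub>R e))" by auto
  have "\<exists>t. 0 < t \<and> t < h \<and> ?g (z + s *\<^sub>R d + h *\<^sub>R e) - ?g (z + s *\<^sub>R d + 0 *\<^sub>R e)
      = (h - 0) * fderiv ?g (z + s *\<^sub>R d + t *\<^sub>R e) e"
    by (rule MVT2[OF assms(3)]) (intro D2, use s in auto)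
  then obtain t where t: "0 < t" "t < h" "?g (z + s *\<^sub>R d + h *\<^sub>R e) - ?g (z + s *\<^sub>R d + 0 *\<^sub>R e)
      = h * fderiv ?g (z + s *\<^sub>R d + t *\<^sub>R e) e" by auto
  have "f (z + h *\<^sub>R d + h *\<^sub>R e) - f (z + h *\<^sub>R d) - f (z + h *\<^sub>R e) + f z = ?\<phi> h - ?\<phi> 0"
    by simp
  also have "\<dots> = h * h * fderiv ?g (z + s *\<^sub>R d + t *\<^sub>R e) e"
    by (simp only: s(3) t(3) mult.assoc)
  finally show ?thesis using s(1,2) t(1,2) by blast
qed

lemma second_derivative_symmetric_real:
  fixes f :: "'a::real_normed_vector \<Rightarrow> real"
  assumes "Ck_on 2 f S" "open S" "z \<in> S"
  shows "fderiv (\<lambda>z. fderiv f z d) z e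
       = fderiv (\<lambda>z. fderiv f z e) z d"
    (is "?A z = ?B z")
proof (rule ccontr)
  assume ne: "?A z \<noteq> ?B z"
  have cA: "continuous_on S ?A" and cB: "continuous_on S ?B"
    using assms(1) by (auto simp: numeral_2_eq_2)
  \<comment> \<open>Half the gap: a value of \<open>?A\<close> within this distance of
    \<open>?A z\<close> cannot equal a value of \<open>?B\<close> within this distance of
    \<open>?B z\<close>.\<close>
  define \<epsilon> where "\<epsilon> = \<bar>?A z - ?B z\<bar> / 2"
  have \<epsilon>: "\<epsilon> > 0" using ne by (simp add: \<epsilon>_def)
  have "isCont ?A z" "isCont ?B z" using cA cB assms continuous_on_eq_continuous_at by blast+
  then obtain \<delta>1 \<delta>2 where \<delta>1: "\<delta>1 > 0" "\<And>y. dist y z < \<delta>1 \<Longrightarrow> dist (?A y) (?A z) < \<epsilon>"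
    and \<delta>2: "\<delta>2 > 0" "\<And>y. dist y z < \<delta>2 \<Longrightarrow> dist (?B y) (?B z) < \<epsilon>"
    unfolding continuous_at_eps_delta using \<epsilon> by metis
  obtain \<delta>3 where \<delta>3: "\<delta>3 > 0" "\<And>y. dist y z < \<delta>3 \<Longrightarrow> y \<in> S"
    using assms(2,3) open_dist by metis
  define \<delta> where "\<delta> = min \<delta>1 (min \<delta>2 \<delta>3)"
  have \<delta>: "\<delta> > 0" using \<delta>1 \<delta>2 \<delta>3 by (simp add: \<delta>_def)
  \<comment> \<open>Small enough for the whole parallelogram with sides \<open>h *\<^sub>R d\<close>
    and \<open>h *\<^sub>R e\<close> to stay in the ball of radius \<delta>; the summand 1 covers
    \<open>d = e = 0\<close>.\<close>
  define h where "h = \<delta> / (norm d + norm e + 1)"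
  have pos: "norm d + norm e + 1 > 0" by (simp add: add_nonneg_pos)
  then have h: "h > 0" using \<delta> by (simp add: h_def)
  have near: "dist (z + s *\<^sub>R d + t *\<^sub>R e) z < \<delta>" if "0 \<le> s" "s \<le> h" "0 \<le> t" "t \<le> h" for s t
  proof -
    have "dist (z + s *\<^sub>R d + t *\<^sub>R e) z = norm (s *\<^sub>R d + t *\<^sub>R e)" by (simp add: dist_norm)
    also have "\<dots> \<le> s * norm d + t * norm e"
      using norm_triangle_ineq[of "s *\<^sub>R d" "t *\<^sub>R e"] that by simp
    also have "\<dots> \<le> h * norm d + h * norm e" using that by (intro add_mono mult_right_mono) auto
    also have "\<dots> < h * (norm d + norm e + 1)" using h by (simp add: algebra_simps)
    also have "\<dots> = \<delta>" using pos by (simp add: h_def)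
    finally show ?thesis .
  qed
  have near': "dist (z + s *\<^sub>R e + t *\<^sub>R d) z < \<delta>" if "0 \<le> s" "s \<le> h" "0 \<le> t" "t \<le> h" for s t
    using near[of t s] that by (simp add: add.commute add.left_commute)
  obtain s t where st: "0 < s" "s < h" "0 < t" "t < h"
    "f (z + h *\<^sub>R d + h *\<^sub>R e) - f (z + h *\<^sub>R d) - f (z + h *\<^sub>R e) + f z = h * h * ?A (z + s *\<^sub>R d + t *\<^sub>R e)"
    using second_difference[OF assms(1), of h z d e] near \<delta>3 h unfolding \<delta>_def by auto
  obtain s' t' where st': "0 < s'" "s' < h" "0 < t'" "t' < h"
    "f (z + h *\<^sub>R e + h *\<^sub>R d) - f (z + h *\<^sub>R e) - f (z + h *\<^sub>R d) + f z = h * h * ?B (z + s' *\<^sub>R e + t' *\<^sub>R d)"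
    using second_difference[OF assms(1), of h z e d] near' \<delta>3 h unfolding \<delta>_def by auto
  have "f (z + h *\<^sub>R e + h *\<^sub>R d) = f (z + h *\<^sub>R d + h *\<^sub>R e)" by (simp add: ac_simps)
  then have "h * h * ?A (z + s *\<^sub>R d + t *\<^sub>R e) = h * h * ?B (z + s' *\<^sub>R e + t' *\<^sub>R d)"
    using st(5) st'(5) by linarith
  then have eq: "?A (z + s *\<^sub>R d + t *\<^sub>R e) = ?B (z + s' *\<^sub>R e + t' *\<^sub>R d)" using h by simp
  have "dist (?A (z + s *\<^sub>R d + t *\<^sub>R e)) (?A z) < \<epsilon>"
    using \<delta>1(2) near[of s t] st by (simp add: \<delta>_def)
  moreover have "dist (?B (z + s' *\<^sub>R e + t' *\<^sub>R d)) (?B z) < \<epsilon>"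
    using \<delta>2(2) near'[of s' t'] st' by (simp add: \<delta>_def)
  ultimately have "\<bar>?A z - ?B z\<bar> < 2 * \<epsilon>" using eq by (simp add: dist_real_def)
  then show False by (simp add: \<epsilon>_def)
qed

text \<open>The coordinate functionals commute with differentiation and separate points, which
  reduces the claim to real-valued maps.\<close>

lemma second_derivative_symmetric:
  fixes f :: "'a::real_normed_vector \<Rightarrow> 'b::real_normed_vector"
  assumes co: "coordinates (B :: 'b set) co" and "smooth_on S f" "open S" "z \<in> S"
  shows "fderiv (\<lambda>z. fderiv f z d) z e
       = fderiv (\<lambda>z. fderiv f z e) z d"
    (is "?A d e = ?A e d")
proof -
  have co_D: "fderiv (\<lambda>z. fderiv (\<lambda>x. co b (f x)) z d) z e = co b (?A d e)"
    if b: "b \<in> B" for b d e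
  proof -
    have bl: "bounded_linear (co b)" using co b coordinates_def by blast
    have 1: "fderiv (\<lambda>x. co b (f x)) x = (\<lambda>v. co b (fderiv f x v))"
      if "x \<in> S" for x
      by (rule frechet_derivative_eqI[OF bounded_linear.has_derivative[OF bl
            smooth_on_has_derivative[OF assms(2) that]]])
    have "((\<lambda>x. co b (fderiv f x d)) has_derivative
        (\<lambda>e. co b (?A d e))) (at z)"
      using bounded_linear.has_derivative[OF bl smooth_on_has_derivative[OF smooth_on_deriv[OF assms(2)] assms(4)]] .
    then have "((\<lambda>x. fderiv (\<lambda>x. co b (f x)) x d) has_derivative
        (\<lambda>e. co b (?A d e))) (at z)"
      by (rule has_derivative_transform_within_open[OF _ assms(3,4)]) (simp add: 1)
    then show ?thesis using frechet_derivative_eqI by metis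
  qed
  have "co b (?A d e) = co b (?A e d)" if b: "b \<in> B" for b
  proof -
    have bl: "bounded_linear (co b)" using co b coordinates_def by blast
    have "Ck_on 2 (\<lambda>x. co b (f x)) S"
      using smooth_on_bounded_linear_comp[OF bl assms(2,3)] smooth_on_def by blast
    from second_derivative_symmetric_real[OF this assms(3,4)] show ?thesis
      by (simp add: co_D[OF b])
  qed
  then have "(\<Sum>b\<in>B. co b (?A d e) *\<^sub>R b) = (\<Sum>b\<in>B. co b (?A e d) *\<^sub>R b)" by simp
  then show ?thesis using co unfolding coordinates_def by metis
qed

section \<open>Manifolds, curves and forms in charts\<close>

lemma smooth_manifold_coordinates:
  fixes A :: "('x, 'e::real_normed_vector) chart set"
  assumes "smooth_manifold A"
  obtains B :: "'e set" and co where "coordinates B co"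
  using assms coordinates_exist unfolding smooth_manifold_def by blast

lemma chart_inj: "smooth_manifold A \<Longrightarrow> \<kappa> \<in> A \<Longrightarrow> inj_on (snd \<kappa>) (fst \<kappa>)"
  unfolding smooth_manifold_def by blast

lemma chart_inv_left: "smooth_manifold A \<Longrightarrow> \<kappa> \<in> A \<Longrightarrow> x \<in> fst \<kappa> \<Longrightarrow> chart_inv \<kappa> (snd \<kappa> x) = x"
  unfolding chart_inv_def using chart_inj inv_into_f_f by metis

lemma open_chart_image: "smooth_manifold A \<Longrightarrow> \<kappa> \<in> A \<Longrightarrow> open (snd \<kappa> ` fst \<kappa>)"
  unfolding smooth_manifold_def by blast

lemma open_chart_overlap:
  "smooth_manifold A \<Longrightarrow> \<kappa> \<in> A \<Longrightarrow> \<kappa>' \<in> A \<Longrightarrow> open (snd \<kappa> ` (fst \<kappa> \<inter> fst \<kappa>'))"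
  unfolding smooth_manifold_def by blast

lemma smooth_transition:
  "smooth_manifold A \<Longrightarrow> \<kappa> \<in> A \<Longrightarrow> \<kappa>' \<in> A \<Longrightarrow>
     smooth_on (snd \<kappa> ` (fst \<kappa> \<inter> fst \<kappa>')) (\<lambda>x. snd \<kappa>' (chart_inv \<kappa> x))"
  unfolding smooth_manifold_def o_def by blast

text \<open>The abstraction \<open>topology\<close> carries information only once its argument is
  known to be a topology. Closure under intersection uses that charts are injective.\<close>

lemma istopology_manifold:
  assumes "smooth_manifold A"
  shows "istopology (\<lambda>U. U \<subseteq> points A \<and> (\<forall>\<kappa>\<in>A. open (snd \<kappa> ` (U \<inter> fst \<kappa>))))"
proof -
  have "open (snd \<kappa> ` (S \<inter> T \<inter> fst \<kappa>))"
    if "\<kappa> \<in> A" "open (snd \<kappa> ` (S \<inter> fst \<kappa>))" "open (snd \<kappa> ` (T \<inter> fst \<kappa>))" for S T \<kappa>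
  proof -
    have "snd \<kappa> ` (S \<inter> T \<inter> fst \<kappa>) = snd \<kappa> ` (S \<inter> fst \<kappa>) \<inter> snd \<kappa> ` (T \<inter> fst \<kappa>)"
      using chart_inj[OF assms that(1)] by (auto simp: inj_on_def)
    then show ?thesis using that open_Int by metis
  qed
  moreover have "open (snd \<kappa> ` (\<Union>K \<inter> fst \<kappa>))"
    if "\<forall>U\<in>K. U \<subseteq> points A \<and> (\<forall>\<kappa>\<in>A. open (snd \<kappa> ` (U \<inter> fst \<kappa>)))" "\<kappa> \<in> A" for K \<kappa>
  proof -
    have "snd \<kappa> ` (\<Union>K \<inter> fst \<kappa>) = (\<Union>U\<in>K. snd \<kappa> ` (U \<inter> fst \<kappa>))" by auto
    then show ?thesis using that by auto
  qed
  ultimately show ?thesis unfolding istopology_def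
    by (intro conjI allI impI ballI) (simp_all add: Sup_le_iff le_infI1)
qed

lemma openin_manifold_topology:
  assumes "smooth_manifold A"
  shows "openin (manifold_topology A) U \<longleftrightarrow>
    U \<subseteq> points A \<and> (\<forall>\<kappa>\<in>A. open (snd \<kappa> ` (U \<inter> fst \<kappa>)))"
  unfolding manifold_topology_def using topology_inverse'[OF istopology_manifold[OF assms]] by simp

lemma chart_at_props:
  assumes "p \<in> points A"
  shows "chart_at A p \<in> A" "p \<in> fst (chart_at A p)"
proof -
  have "\<exists>\<kappa>. \<kappa> \<in> A \<and> p \<in> fst \<kappa>" using assms unfolding points_def by blast
  from someI_ex[OF this] show "chart_at A p \<in> A" "p \<in> fst (chart_at A p)"
    unfolding chart_at_def by auto
qed

lemma pointsE:
  assumes "p \<in> points A" obtains \<kappa> where "\<kappa> \<in> A" "p \<in> fst \<kappa>"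
  using assms unfolding points_def by blast

lemma smooth_into_points: "smooth_into A S c \<Longrightarrow> z \<in> S \<Longrightarrow> c z \<in> points A"
  unfolding smooth_into_def by blast

lemma smooth_into_open: "smooth_into A S c \<Longrightarrow> \<kappa> \<in> A \<Longrightarrow> open {z\<in>S. c z \<in> fst \<kappa>}"
  unfolding smooth_into_def vimage_def Int_def by simp

lemma smooth_into_chart: "smooth_into A S c \<Longrightarrow> \<kappa> \<in> A \<Longrightarrow> smooth_on {z\<in>S. c z \<in> fst \<kappa>} (\<lambda>z. snd \<kappa> (c z))"
  unfolding smooth_into_def vimage_def Int_def o_def by simp

text \<open>One chart near each point suffices although \<open>smooth_into\<close> demands all of
  them: in any other chart the coordinate expression is composed with a smooth transition.\<close>

lemma smooth_intoI:
  fixes A :: "('x, 'e::real_normed_vector) chart set"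
  assumes A: "smooth_manifold A"
    and local: "\<And>z. z \<in> S \<Longrightarrow> \<exists>T \<kappa>. open T \<and> z \<in> T \<and> T \<subseteq> S \<and> \<kappa> \<in> A \<and> c ` T \<subseteq> fst \<kappa> \<and> smooth_on T (\<lambda>z. snd \<kappa> (c z))"
  shows "smooth_into A S c"
proof -
  obtain B :: "'e set" and co where co: "coordinates B co" using smooth_manifold_coordinates[OF A] .
  have loc: "\<exists>T'. open T' \<and> z \<in> T' \<and> T' \<subseteq> {z\<in>S. c z \<in> fst \<kappa>'} \<and> smooth_on T' (\<lambda>z. snd \<kappa>' (c z))"
    if z: "z \<in> S" "c z \<in> fst \<kappa>'" and \<kappa>': "\<kappa>' \<in> A" for z \<kappa>'
  proof -
    obtain T \<kappa> where T: "open T" "z \<in> T" "T \<subseteq> S" "\<kappa> \<in> A" "c ` T \<subseteq> fst \<kappa>" "smooth_on T (\<lambda>z. snd \<kappa> (c z))"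
      using local[OF z(1)] by blast
    let ?O = "snd \<kappa> ` (fst \<kappa> \<inter> fst \<kappa>')"
    \<comment> \<open>The points of \<open>T\<close> sent into both charts: as
      \<open>\<kappa>\<close> is injective, coordinates in the image of the overlap force the point
      itself into the overlap.\<close>
    let ?T = "T \<inter> (\<lambda>z. snd \<kappa> (c z)) -` ?O"
    have op: "open ?T"
      using continuous_open_preimage[OF smooth_on_continuous[OF T(6)] T(1) open_chart_overlap[OF A T(4) \<kappa>']] .
    have mem: "c y \<in> fst \<kappa>'" if "y \<in> ?T" for y
    proof -
      have "c y \<in> fst \<kappa>" using that T(5) by blast
      moreover have "\<exists>x. x \<in> fst \<kappa> \<and> x \<in> fst \<kappa>' \<and> snd \<kappa> (c y) = snd \<kappa> x" using that by auto
      ultimately show ?thesis using inj_onD[OF chart_inj[OF A T(4)]] by blast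
    qed
    have "smooth_on ?T (\<lambda>z. snd \<kappa>' (chart_inv \<kappa> (snd \<kappa> (c z))))"
      by (rule smooth_on_compose[OF co smooth_transition[OF A T(4) \<kappa>'] smooth_on_subset[OF T(6)] _ op]) auto
    then have "smooth_on ?T (\<lambda>z. snd \<kappa>' (c z))"
    proof (rule smooth_on_cong[OF op])
      fix y assume "y \<in> ?T"
      then have "c y \<in> fst \<kappa>" using T(5) by blast
      then show "snd \<kappa>' (chart_inv \<kappa> (snd \<kappa> (c y))) = snd \<kappa>' (c y)"
        by (simp only: chart_inv_left[OF A T(4)])
    qed
    moreover have "z \<in> ?T" using T(2,5) z by blast
    ultimately show ?thesis using op mem T(3) by (intro exI[of _ ?T]) blast
  qed
  have "c ` S \<subseteq> points A" using local unfolding points_def by blast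
  moreover have "open {z\<in>S. c z \<in> fst \<kappa>'} \<and> smooth_on {z\<in>S. c z \<in> fst \<kappa>'} (\<lambda>z. snd \<kappa>' (c z))"
    if \<kappa>': "\<kappa>' \<in> A" for \<kappa>'
  proof
    show "open {z\<in>S. c z \<in> fst \<kappa>'}"
    proof (rule topological_space_class.openI)
      fix z assume "z \<in> {z\<in>S. c z \<in> fst \<kappa>'}"
      then have "z \<in> S" "c z \<in> fst \<kappa>'" by auto
      from loc[OF this \<kappa>'] show "\<exists>T. open T \<and> z \<in> T \<and> T \<subseteq> {z\<in>S. c z \<in> fst \<kappa>'}" by blast
    qed
    show "smooth_on {z\<in>S. c z \<in> fst \<kappa>'} (\<lambda>z. snd \<kappa>' (c z))"
    proof (rule smooth_on_local)
      fix z assume "z \<in> {z\<in>S. c z \<in> fst \<kappa>'}"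
      then have "z \<in> S" "c z \<in> fst \<kappa>'" by auto
      from loc[OF this \<kappa>'] obtain T where T: "open T" "z \<in> T" "smooth_on T (\<lambda>z. snd \<kappa>' (c z))" by blast
      have "smooth_on ({z\<in>S. c z \<in> fst \<kappa>'} \<inter> T) (\<lambda>z. snd \<kappa>' (c z))"
        by (rule smooth_on_subset[OF T(3)]) simp
      then show "\<exists>T. open T \<and> z \<in> T \<and> smooth_on ({z\<in>S. c z \<in> fst \<kappa>'} \<inter> T) (\<lambda>z. snd \<kappa>' (c z))"
        using T by blast
    qed
  qed
  ultimately show ?thesis
    unfolding smooth_into_def vimage_def Int_def o_def by simp
qed

lemma smooth_into_compose:
  fixes h :: "'w::real_normed_vector \<Rightarrow> 'z::real_normed_vector"
  assumes A: "smooth_manifold A" and c: "smooth_into A S c"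
    and co: "coordinates (B :: 'z set) co" and h: "smooth_on T h" "h ` T \<subseteq> S" "open T"
  shows "smooth_into A T (\<lambda>w. c (h w))"
proof (rule smooth_intoI[OF A])
  fix w assume w: "w \<in> T"
  then have "c (h w) \<in> points A" using h(2) smooth_into_points[OF c] by blast
  then obtain \<kappa> where \<kappa>: "\<kappa> \<in> A" "c (h w) \<in> fst \<kappa>" using pointsE by metis
  let ?S = "{z\<in>S. c z \<in> fst \<kappa>}"
  let ?T = "T \<inter> h -` ?S"
  have op: "open ?T"
    using continuous_open_preimage[OF smooth_on_continuous[OF h(1)] h(3) smooth_into_open[OF c \<kappa>(1)]] .
  have "smooth_on ?T (\<lambda>w. snd \<kappa> (c (h w)))"
    by (rule smooth_on_compose[OF co smooth_into_chart[OF c \<kappa>(1)] smooth_on_subset[OF h(1)] _ op]) auto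
  moreover have "w \<in> ?T" using w \<kappa>(2) h(2) by auto
  ultimately show "\<exists>T' \<kappa>. open T' \<and> w \<in> T' \<and> T' \<subseteq> T \<and> \<kappa> \<in> A \<and> (\<lambda>w. c (h w)) ` T' \<subseteq> fst \<kappa> \<and>
      smooth_on T' (\<lambda>w. snd \<kappa> (c (h w)))"
    using op \<kappa>(1) by (intro exI[of _ ?T] exI[of _ \<kappa>]) auto
qed

lemma smooth_into_chart_inv:
  assumes A: "smooth_manifold A" and \<kappa>: "\<kappa> \<in> A"
  shows "smooth_into A (snd \<kappa> ` fst \<kappa>) (chart_inv \<kappa>)"
proof (rule smooth_intoI[OF A])
  fix x assume x: "x \<in> snd \<kappa> ` fst \<kappa>"
  have "smooth_on (snd \<kappa> ` fst \<kappa>) (\<lambda>x. snd \<kappa> (chart_inv \<kappa> x))"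
    by (rule smooth_on_cong[OF open_chart_image[OF A \<kappa>] smooth_on_bounded_linear[OF bounded_linear_ident]])
      (auto simp: chart_inv_left[OF A \<kappa>])
  then show "\<exists>T \<kappa>'. open T \<and> x \<in> T \<and> T \<subseteq> snd \<kappa> ` fst \<kappa> \<and> \<kappa>' \<in> A \<and> chart_inv \<kappa> ` T \<subseteq> fst \<kappa>' \<and>
      smooth_on T (\<lambda>z. snd \<kappa>' (chart_inv \<kappa> z))"
    using open_chart_image[OF A \<kappa>] x \<kappa>
    by (intro exI[of _ "snd \<kappa> ` fst \<kappa>"] exI[of _ \<kappa>]) (auto simp: chart_inv_left[OF A \<kappa>])
qed

lemma smooth_into_openin:
  assumes A: "smooth_manifold A" and c: "smooth_into A S c" and W: "openin (manifold_topology A) W"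
  shows "open {z\<in>S. c z \<in> W}"
proof -
  have eq: "{z\<in>S. c z \<in> W} = (\<Union>\<kappa>\<in>A. {z\<in>S. c z \<in> fst \<kappa>} \<inter> (\<lambda>z. snd \<kappa> (c z)) -` (snd \<kappa> ` (W \<inter> fst \<kappa>)))"
  proof (intro set_eqI iffI)
    fix z assume z: "z \<in> {z\<in>S. c z \<in> W}"
    then obtain \<kappa> where "\<kappa> \<in> A" "c z \<in> fst \<kappa>"
      using smooth_into_points[OF c] pointsE by (metis mem_Collect_eq)
    then show "z \<in> (\<Union>\<kappa>\<in>A. {z\<in>S. c z \<in> fst \<kappa>} \<inter> (\<lambda>z. snd \<kappa> (c z)) -` (snd \<kappa> ` (W \<inter> fst \<kappa>)))"
      using z by blast
  next
    fix z assume "z \<in> (\<Union>\<kappa>\<in>A. {z\<in>S. c z \<in> fst \<kappa>} \<inter> (\<lambda>z. snd \<kappa> (c z)) -` (snd \<kappa> ` (W \<inter> fst \<kappa>)))"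
    then obtain \<kappa> x where "\<kappa> \<in> A" "z \<in> S" "c z \<in> fst \<kappa>" "x \<in> W" "x \<in> fst \<kappa>" "snd \<kappa> (c z) = snd \<kappa> x"
      by blast
    moreover then have "c z = x" using chart_inj[OF A] inj_onD by metis
    ultimately show "z \<in> {z\<in>S. c z \<in> W}" by simp
  qed
  show ?thesis unfolding eq
  proof (rule open_UN, intro ballI)
    fix \<kappa> assume \<kappa>: "\<kappa> \<in> A"
    have "open (snd \<kappa> ` (W \<inter> fst \<kappa>))" using W \<kappa> openin_manifold_topology[OF A] by blast
    then show "open ({z\<in>S. c z \<in> fst \<kappa>} \<inter> (\<lambda>z. snd \<kappa> (c z)) -` (snd \<kappa> ` (W \<inter> fst \<kappa>)))"
      by (rule continuous_open_preimage[OF smooth_on_continuous[OF smooth_into_chart[OF c \<kappa>]]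
            smooth_into_open[OF c \<kappa>]])
  qed
qed

lemma smooth_from_into:
  fixes A :: "('x, 'e::real_normed_vector) chart set"
  assumes A: "smooth_manifold A" and c: "smooth_into A S c"
    and W: "openin (manifold_topology A) W" and f: "smooth_from A W f"
  shows "smooth_on {z\<in>S. c z \<in> W} (\<lambda>z. f (c z))"
proof (rule smooth_on_local)
  obtain B :: "'e set" and co where co: "coordinates B co" using smooth_manifold_coordinates[OF A] .
  fix z assume z: "z \<in> {z\<in>S. c z \<in> W}"
  then obtain \<kappa> where \<kappa>: "\<kappa> \<in> A" "c z \<in> fst \<kappa>"
    using smooth_into_points[OF c] pointsE by (metis mem_Collect_eq)
  let ?T = "{z\<in>S. c z \<in> W} \<inter> {z\<in>S. c z \<in> fst \<kappa>}"
  have op: "open ?T" using smooth_into_open[OF c \<kappa>(1)] smooth_into_openin[OF A c W] by blast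
  have "smooth_on (snd \<kappa> ` (fst \<kappa> \<inter> W)) (\<lambda>x. f (chart_inv \<kappa> x))"
    using f \<kappa>(1) unfolding smooth_from_def o_def by blast
  then have "smooth_on ?T (\<lambda>z. f (chart_inv \<kappa> (snd \<kappa> (c z))))"
    by (rule smooth_on_compose[OF co _ smooth_on_subset[OF smooth_into_chart[OF c \<kappa>(1)]] _ op]) auto
  then have "smooth_on ?T (\<lambda>z. f (c z))"
    by (rule smooth_on_cong[OF op]) (auto simp: chart_inv_left[OF A \<kappa>(1)])
  then have "smooth_on ({z\<in>S. c z \<in> W} \<inter> ?T) (\<lambda>z. f (c z))" by (rule smooth_on_subset) auto
  then show "\<exists>T. open T \<and> z \<in> T \<and> smooth_on ({z\<in>S. c z \<in> W} \<inter> T) (\<lambda>z. f (c z))"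
    using op z \<kappa>(2) by (intro exI[of _ ?T]) auto
qed

subsection \<open>Velocities\<close>

text \<open>The derivative of the family \<open>c\<close> in direction \<open>e\<close>. For a real
  parameter and \<open>e = 1\<close> it is the velocity of a curve, for two parameters it gives the
  partial derivatives, so that one set of rules serves both.\<close>

definition partial_velocity ::
    "('x, 'e::real_normed_vector) chart set \<Rightarrow> ('z::real_normed_vector \<Rightarrow> 'x) \<Rightarrow> 'z \<Rightarrow> 'z \<Rightarrow> ('x, 'e) tvec" where
  "partial_velocity A c z e = velocity A (\<lambda>r. c (z + r *\<^sub>R e)) 0"

lemma partial_velocity_chart:
  assumes A: "smooth_manifold A" and c: "smooth_into A S c" and z: "z \<in> S" and \<kappa>: "\<kappa> \<in> A" "c z \<in> fst \<kappa>"
  shows "partial_velocity A c z e \<kappa> = fderiv (\<lambda>z. snd \<kappa> (c z)) z e"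
proof -
  let ?f = "\<lambda>z. snd \<kappa> (c z)"
  have D: "(?f has_derivative fderiv ?f z) (at z)"
    using smooth_on_has_derivative[OF smooth_into_chart[OF c \<kappa>(1)]] z \<kappa>(2) by blast
  have "((\<lambda>r. z + r *\<^sub>R e) has_derivative (\<lambda>r. r *\<^sub>R e)) (at 0)"
    by (auto intro!: derivative_eq_intros)
  from diff_chain_at[OF this] D
  have "((\<lambda>r. ?f (z + r *\<^sub>R e)) has_derivative (\<lambda>r. fderiv ?f z (r *\<^sub>R e))) (at 0)"
    unfolding o_def by simp
  moreover have "linear (fderiv ?f z)"
    using D has_derivative_linear by blast
  ultimately have "((\<lambda>r. ?f (z + r *\<^sub>R e)) has_vector_derivative fderiv ?f z e) (at 0)"
    unfolding has_vector_derivative_def by (simp add: linear_cmul)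
  then show ?thesis using \<kappa> unfolding partial_velocity_def velocity_def
    by (simp add: o_def vector_derivative_at)
qed

text \<open>By the chain rule through the transitions, the coordinate vector in one chart determines
  all others; in this form one-forms can be evaluated on velocities.\<close>

lemma partial_velocity_eq_coord_vec:
  assumes A: "smooth_manifold A" and c: "smooth_into A S c" and z: "z \<in> S" and \<kappa>: "\<kappa> \<in> A" "c z \<in> fst \<kappa>"
  shows "partial_velocity A c z e = coord_vec A \<kappa> (c z) (fderiv (\<lambda>z. snd \<kappa> (c z)) z e)"
proof
  fix \<kappa>'
  let ?f = "\<lambda>z. snd \<kappa> (c z)"
  show "partial_velocity A c z e \<kappa>' = coord_vec A \<kappa> (c z) (fderiv ?f z e) \<kappa>'"
  proof (cases "\<kappa>' \<in> A \<and> c z \<in> fst \<kappa>'")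
    case False
    then show ?thesis by (auto simp: partial_velocity_def velocity_def coord_vec_def)
  next
    case True
    then have \<kappa>': "\<kappa>' \<in> A" "c z \<in> fst \<kappa>'" by auto
    let ?g = "\<lambda>x. snd \<kappa>' (chart_inv \<kappa> x)"
    have "(?f has_derivative fderiv ?f z) (at z)"
      using smooth_on_has_derivative[OF smooth_into_chart[OF c \<kappa>(1)]] z \<kappa>(2) by blast
    moreover have "(?g has_derivative fderiv ?g (?f z)) (at (?f z))"
      using smooth_on_has_derivative[OF smooth_transition[OF A \<kappa>(1) \<kappa>'(1)]] \<kappa>(2) \<kappa>'(2) by blast
    ultimately have "((\<lambda>z. ?g (?f z)) has_derivative
        (\<lambda>e. fderiv ?g (?f z) (fderiv ?f z e))) (at z)"
      using diff_chain_at unfolding o_def by blast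
    then have "((\<lambda>z. snd \<kappa>' (c z)) has_derivative
        (\<lambda>e. fderiv ?g (?f z) (fderiv ?f z e))) (at z)"
      by (rule has_derivative_transform_within_open[OF _ smooth_into_open[OF c \<kappa>(1)]])
        (use z \<kappa> chart_inv_left[OF A \<kappa>(1)] in auto)
    from frechet_derivative_eqI[OF this] show ?thesis
      unfolding partial_velocity_chart[OF A c z \<kappa>'] coord_vec_def using \<kappa>' by (simp add: o_def)
  qed
qed

lemma partial_velocity_tangent:
  assumes A: "smooth_manifold A" and c: "smooth_into A S c" and z: "z \<in> S"
  shows "partial_velocity A c z e \<in> tangent_space A (c z)"
proof -
  have "partial_velocity A c z e \<kappa> = 0" if "\<not> (\<kappa> \<in> A \<and> c z \<in> fst \<kappa>)" for \<kappa>
    using that by (auto simp: partial_velocity_def velocity_def)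
  moreover have "partial_velocity A c z e = coord_vec A \<kappa> (c z) (partial_velocity A c z e \<kappa>)"
    if "\<kappa> \<in> A" "c z \<in> fst \<kappa>" for \<kappa>
    using partial_velocity_eq_coord_vec[OF A c z that, of e] partial_velocity_chart[OF A c z that, of e] by simp
  ultimately show ?thesis unfolding tangent_space_def by blast
qed

lemma partial_velocity_curve:
  "velocity A (\<lambda>s. c (z + s)) 0 = partial_velocity A c (z::real) 1"
  by (simp add: partial_velocity_def)

subsection \<open>One-forms\<close>

lemma one_form_linear:
  assumes "smooth_one_form A \<omega>" "\<kappa> \<in> A" "p \<in> fst \<kappa>"
  shows "linear (\<lambda>e. \<omega> p (coord_vec A \<kappa> p e))"
  using assms unfolding smooth_one_form_def by blast

lemma one_form_smooth:
  assumes "smooth_one_form A \<omega>" "\<kappa> \<in> A"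
  shows "smooth_on (snd \<kappa> ` fst \<kappa>) (\<lambda>x. \<omega> (chart_inv \<kappa> x) (coord_vec A \<kappa> (chart_inv \<kappa> x) e))"
proof -
  have "smooth_from A (fst \<kappa>) (\<lambda>p. \<omega> p (coord_vec A \<kappa> p e))"
    using assms unfolding smooth_one_form_def by blast
  then have "smooth_on (snd \<kappa> ` (fst \<kappa> \<inter> fst \<kappa>)) ((\<lambda>p. \<omega> p (coord_vec A \<kappa> p e)) \<circ> chart_inv \<kappa>)"
    using assms(2) unfolding smooth_from_def by blast
  then show ?thesis by (simp add: o_def)
qed

text \<open>A component of the pullback of \<omega> along \<open>c\<close>.\<close>

abbreviation form_along where
  "form_along A \<omega> c e \<equiv> \<lambda>z. \<omega> (c z) (partial_velocity A c z e)"

text \<open>Additivity in the direction later splits the velocity along a diagonal into two partial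
  velocities.\<close>

lemma one_form_partial_velocity_linear:
  assumes A: "smooth_manifold A" and \<omega>: "smooth_one_form A \<omega>" and c: "smooth_into A S c" and z: "z \<in> S"
  shows "linear (\<lambda>e. \<omega> (c z) (partial_velocity A c z e))"
proof -
  obtain \<kappa> where \<kappa>: "\<kappa> \<in> A" "c z \<in> fst \<kappa>"
    using smooth_into_points[OF c z] pointsE by metis
  have "(\<lambda>z. snd \<kappa> (c z)) differentiable at z"
    using smooth_on_differentiable[OF smooth_into_chart[OF c \<kappa>(1)]] z \<kappa>(2) by blast
  from linear_compose[OF linear_frechet_derivative[OF this] one_form_linear[OF \<omega> \<kappa>]]
  show ?thesis unfolding partial_velocity_eq_coord_vec[OF A c z \<kappa>] o_def .
qed

section \<open>The pullback of a one-form computed in one chart\<close>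

context
  fixes A :: "('x, 'e::real_normed_vector) chart set" and \<omega> :: "'x \<Rightarrow> ('x, 'e) tvec \<Rightarrow> 'w::real_normed_vector"
    and S :: "'z::real_normed_vector set" and c \<kappa> and B :: "'e set" and co
  assumes A: "smooth_manifold A" and \<omega>: "smooth_one_form A \<omega>" and c: "smooth_into A S c" and \<kappa>: "\<kappa> \<in> A"
    and co: "coordinates B co"
begin

private abbreviation "U \<equiv> {z\<in>S. c z \<in> fst \<kappa>}"
private abbreviation "C \<equiv> \<lambda>z. snd \<kappa> (c z)"
private abbreviation "\<eta> \<equiv> \<lambda>x e. \<omega> (chart_inv \<kappa> x) (coord_vec A \<kappa> (chart_inv \<kappa> x) e)"

private lemma openU: "open U" using smooth_into_open[OF c \<kappa>] .
private lemma smC: "smooth_on U C" using smooth_into_chart[OF c \<kappa>] .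
private lemma finB: "finite B" using co coordinates_def by blast
private lemma blco: "b \<in> B \<Longrightarrow> bounded_linear (co b)" using co coordinates_def by blast

private lemma linear_eta: "x \<in> snd \<kappa> ` fst \<kappa> \<Longrightarrow> linear (\<eta> x)"
  using one_form_linear[OF \<omega> \<kappa>] chart_inv_left[OF A \<kappa>] by auto

text \<open>Smoothness of \<omega> is given on constant coordinate vectors, but along
  \<open>c\<close> the vector moves. The coordinate expansion separates the moving coefficients from
  the values of \<omega> on fixed vectors.\<close>

private lemma form_in_chart:
  assumes "z \<in> U"
  shows "\<omega> (c z) (partial_velocity A c z e)
    = (\<Sum>b\<in>B. co b (fderiv C z e) *\<^sub>R \<eta> (C z) b)"
proof -
  have z: "z \<in> S" "c z \<in> fst \<kappa>" using assms by auto
  have "\<omega> (c z) (partial_velocity A c z e) = \<eta> (C z) (fderiv C z e)"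
    unfolding partial_velocity_eq_coord_vec[OF A c z(1) \<kappa> z(2)] chart_inv_left[OF A \<kappa> z(2)] ..
  also have "\<dots> = (\<Sum>b\<in>B. co b (fderiv C z e) *\<^sub>R \<eta> (C z) b)"
    by (rule linear_coordinates[OF co linear_eta]) (use z in blast)
  finally show ?thesis .
qed

lemma one_form_along_smooth_chart:
  "smooth_on U (form_along A \<omega> c e)"
proof -
  have "smooth_on U (\<lambda>z. \<Sum>b\<in>B. co b (fderiv C z e) *\<^sub>R \<eta> (C z) b)"
  proof (intro smooth_on_sum finB openU smooth_on_bilinear[OF bounded_bilinear_scaleR])
    fix b assume b: "b \<in> B"
    show "smooth_on U (\<lambda>z. co b (fderiv C z e))"
      by (rule smooth_on_bounded_linear_comp[OF blco[OF b] smooth_on_deriv[OF smC] openU])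
    show "smooth_on U (\<lambda>z. \<eta> (C z) b)"
      by (rule smooth_on_compose[OF co one_form_smooth[OF \<omega> \<kappa>] smC _ openU]) blast
  qed
  then show ?thesis by (rule smooth_on_cong[OF openU]) (simp add: form_in_chart)
qed

private lemma deriv_eta:
  assumes x: "x \<in> snd \<kappa> ` fst \<kappa>"
  shows "fderiv (\<lambda>x. \<eta> x w) x a
    = (\<Sum>b\<in>B. co b w *\<^sub>R fderiv (\<lambda>x. \<eta> x b) x a)"
proof -
  have "((\<lambda>x. \<Sum>b\<in>B. co b w *\<^sub>R \<eta> x b) has_derivative
      (\<lambda>a. \<Sum>b\<in>B. co b w *\<^sub>R fderiv (\<lambda>x. \<eta> x b) x a)) (at x)"
    by (intro has_derivative_sum has_derivative_scaleR_right smooth_on_has_derivative[OF one_form_smooth[OF \<omega> \<kappa>] x])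
  then have "((\<lambda>x. \<eta> x w) has_derivative
      (\<lambda>a. \<Sum>b\<in>B. co b w *\<^sub>R fderiv (\<lambda>x. \<eta> x b) x a)) (at x)"
  proof (rule has_derivative_transform_within_open[OF _ open_chart_image[OF A \<kappa>] x])
    fix y assume "y \<in> snd \<kappa> ` fst \<kappa>"
    from linear_coordinates[OF co linear_eta[OF this], of w, symmetric]
    show "(\<Sum>b\<in>B. co b w *\<^sub>R \<eta> y b) = \<eta> y w" .
  qed
  from frechet_derivative_eqI[OF this] show ?thesis by simp
qed

text \<open>The product rule splits the derivative into a term with the vector frozen in
  coordinates, which is exactly a term of \<open>ext_deriv\<close>, and a term with the second
  derivative of \<open>c\<close>, which is symmetric in \<open>d\<close> and
  \<open>e\<close>.\<close>

lemma deriv_one_form_along: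
  assumes z: "z \<in> U"
  shows "fderiv (form_along A \<omega> c e) z d
    = fderiv (\<lambda>x. \<omega> (chart_inv \<kappa> x) (coord_vec A \<kappa> (chart_inv \<kappa> x) (partial_velocity A c z e \<kappa>)))
        (snd \<kappa> (c z)) (partial_velocity A c z d \<kappa>)
      + \<omega> (c z) (coord_vec A \<kappa> (c z)
          (fderiv (\<lambda>z. fderiv (\<lambda>z. snd \<kappa> (c z)) z e) z d))"
proof -
  have zS: "z \<in> S" "c z \<in> fst \<kappa>" using z by auto
  have x: "C z \<in> snd \<kappa> ` fst \<kappa>" using zS by blast
  let ?D = "fderiv C z"
  let ?DD = "fderiv (\<lambda>z. fderiv C z e) z"
  have d\<eta>: "((\<lambda>z. \<eta> (C z) b) has_derivative (\<lambda>d. fderiv (\<lambda>x. \<eta> x b) (C z) (?D d))) (at z)" for b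
    using diff_chain_at[OF smooth_on_has_derivative[OF smC z] smooth_on_has_derivative[OF one_form_smooth[OF \<omega> \<kappa>] x]]
    unfolding o_def .
  have dco: "((\<lambda>z. co b (fderiv C z e)) has_derivative (\<lambda>d. co b (?DD d))) (at z)" if "b \<in> B" for b
    by (rule bounded_linear.has_derivative[OF blco[OF that] smooth_on_has_derivative[OF smooth_on_deriv[OF smC] z]])
  have "((\<lambda>z. \<Sum>b\<in>B. co b (fderiv C z e) *\<^sub>R \<eta> (C z) b) has_derivative
     (\<lambda>d. \<Sum>b\<in>B. co b (?D e) *\<^sub>R fderiv (\<lambda>x. \<eta> x b) (C z) (?D d) + co b (?DD d) *\<^sub>R \<eta> (C z) b)) (at z)"
    by (intro has_derivative_sum has_derivative_scaleR dco d\<eta>)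
  then have "((form_along A \<omega> c e) has_derivative
     (\<lambda>d. \<Sum>b\<in>B. co b (?D e) *\<^sub>R fderiv (\<lambda>x. \<eta> x b) (C z) (?D d) + co b (?DD d) *\<^sub>R \<eta> (C z) b)) (at z)"
    by (rule has_derivative_transform_within_open[OF _ openU z]) (simp add: form_in_chart)
  from frechet_derivative_eqI[OF this]
  have "fderiv (form_along A \<omega> c e) z d
     = (\<Sum>b\<in>B. co b (?D e) *\<^sub>R fderiv (\<lambda>x. \<eta> x b) (C z) (?D d)) + (\<Sum>b\<in>B. co b (?DD d) *\<^sub>R \<eta> (C z) b)"
    by (simp add: sum.distrib)
  also have "\<dots> = fderiv (\<lambda>x. \<eta> x (?D e)) (C z) (?D d) + \<eta> (C z) (?DD d)"
    unfolding deriv_eta[OF x, symmetric] linear_coordinates[OF co linear_eta[OF x], symmetric] ..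
  finally show ?thesis
    unfolding partial_velocity_chart[OF A c zS(1) \<kappa> zS(2)] chart_inv_left[OF A \<kappa> zS(2)] .
qed

end

lemma one_form_along_smooth:
  fixes A :: "('x, 'e::real_normed_vector) chart set"
  assumes A: "smooth_manifold A" and \<omega>: "smooth_one_form A \<omega>" and c: "smooth_into A S c"
  shows "smooth_on S (form_along A \<omega> c e)"
proof (rule smooth_on_local)
  obtain B :: "'e set" and co where co: "coordinates B co" using smooth_manifold_coordinates[OF A] .
  fix z assume z: "z \<in> S"
  obtain \<kappa> where \<kappa>: "\<kappa> \<in> A" "c z \<in> fst \<kappa>" using smooth_into_points[OF c z] pointsE by metis
  have "smooth_on (S \<inter> {z\<in>S. c z \<in> fst \<kappa>}) (form_along A \<omega> c e)"
    by (rule smooth_on_subset[OF one_form_along_smooth_chart[OF A \<omega> c \<kappa>(1) co]]) auto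
  then show "\<exists>T. open T \<and> z \<in> T \<and> smooth_on (S \<inter> T) (form_along A \<omega> c e)"
    using smooth_into_open[OF c \<kappa>(1)] z \<kappa>(2) by (intro exI[of _ "{z\<in>S. c z \<in> fst \<kappa>}"]) auto
qed

text \<open>The second derivatives of \<open>c\<close> cancel by symmetry, so the exterior derivative commutes with pullback along \<open>c\<close>.\<close>

lemma ext_deriv_pullback:
  fixes A :: "('x, 'e::real_normed_vector) chart set"
  assumes A: "smooth_manifold A" and \<omega>: "smooth_one_form A \<omega>" and c: "smooth_into A S c" and z: "z \<in> S"
  shows "ext_deriv A \<omega> (c z) (partial_velocity A c z d) (partial_velocity A c z e)
    = fderiv (form_along A \<omega> c e) z d
    - fderiv (form_along A \<omega> c d) z e"
proof -
  obtain B :: "'e set" and co where co: "coordinates B co" using smooth_manifold_coordinates[OF A] .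
  \<comment> \<open>The computation uses the very chart chosen by \<open>ext_deriv\<close>; since
    the result mentions no chart, the choice has disappeared.\<close>
  note \<kappa> = chart_at_props[OF smooth_into_points[OF c z]]
  have zU: "z \<in> {y\<in>S. c y \<in> fst (chart_at A (c z))}" using z \<kappa> by simp
  note D = deriv_one_form_along[OF A \<omega> c \<kappa>(1) co zU]
  have sym: "fderiv (\<lambda>y. fderiv (\<lambda>y. snd (chart_at A (c z)) (c y)) y e) z d
      = fderiv (\<lambda>y. fderiv (\<lambda>y. snd (chart_at A (c z)) (c y)) y d) z e"
    by (rule second_derivative_symmetric[OF co smooth_into_chart[OF c \<kappa>(1)] smooth_into_open[OF c \<kappa>(1)] zU])
  show ?thesis unfolding D sym ext_deriv_def Let_def by simp
qed

section \<open>Complex matrices and the unitary group\<close>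

lemma bounded_bilinear_matrix_mult: "bounded_bilinear ((**) :: ('n::finite) mat \<Rightarrow> 'n mat \<Rightarrow> 'n mat)"
proof -
  have "bilinear ((**) :: 'n mat \<Rightarrow> 'n mat \<Rightarrow> 'n mat)"
    unfolding bilinear_def
    by (auto intro!: linearI simp: vec_eq_iff
        matrix_matrix_mult_def scaleR_sum_right sum.distrib algebra_simps)
  then show ?thesis by (simp add: bilinear_conv_bounded_bilinear)
qed

lemma bounded_linear_conj_transpose: "bounded_linear (conj_transpose :: ('n::finite) mat \<Rightarrow> 'n mat)"
  by (rule linear_conv_bounded_linear[THEN iffD1])
    (auto intro!: linearI simp: conj_transpose_def vec_eq_iff)

lemma bounded_linear_trace: "bounded_linear (trace :: ('n::finite) mat \<Rightarrow> complex)"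
  by (rule linear_conv_bounded_linear[THEN iffD1])
    (auto intro!: linearI simp: trace_def sum.distrib scaleR_sum_right)

lemma conj_transpose_mult: "conj_transpose (A ** B) = conj_transpose B ** conj_transpose A"
  for A B :: "('n::finite) mat"
  by (simp add: conj_transpose_def vec_eq_iff matrix_matrix_mult_def mult.commute)

lemma conj_transpose_conj_transpose: "conj_transpose (conj_transpose A) = A"
  by (simp add: conj_transpose_def vec_eq_iff)

lemma conj_transpose_mat_1: "conj_transpose (mat 1) = mat 1"
  by (simp add: conj_transpose_def vec_eq_iff mat_def)

lemma matrix_right_inverse_unique:
  fixes A :: "('n::finite) mat"
  assumes "A ** X = mat 1" "A ** Y = mat 1"
  shows "X = Y"
proof -
  have "X ** A = mat 1" using assms(1) matrix_left_right_inverse by blast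
  then have "X ** (A ** Y) = Y" by (simp add: matrix_mul_assoc)
  then show ?thesis using assms(2) by simp
qed

lemma unitary_left: "g \<in> unitary_group \<Longrightarrow> conj_transpose g ** g = mat 1"
  by (simp add: unitary_group_def)

lemma unitary_right: "g \<in> unitary_group \<Longrightarrow> g ** conj_transpose g = mat 1"
  using unitary_left matrix_left_right_inverse by blast

lemma matrix_inv_unitary:
  assumes "g \<in> unitary_group" shows "matrix_inv g = conj_transpose g"
proof -
  have "\<exists>A'. g ** A' = mat 1 \<and> A' ** g = mat 1" using unitary_left[OF assms] unitary_right[OF assms] by blast
  then have "g ** matrix_inv g = mat 1" unfolding matrix_inv_def by (rule someI2_ex) blast
  then show ?thesis using unitary_right[OF assms] matrix_right_inverse_unique by blast
qed

lemma unitary_mult: "g \<in> unitary_group \<Longrightarrow> h \<in> unitary_group \<Longrightarrow> g ** h \<in> unitary_group"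
  unfolding unitary_group_def mem_Collect_eq conj_transpose_mult
  by (metis matrix_mul_assoc matrix_mul_lid)

lemma unitary_conj_transpose: "g \<in> unitary_group \<Longrightarrow> conj_transpose g \<in> unitary_group"
  using unitary_right unfolding unitary_group_def by (simp add: conj_transpose_conj_transpose)

lemma trace_conj_unitary:
  assumes "g \<in> unitary_group" shows "trace (conj_transpose g ** A ** g) = trace A"
  using trace_mul_sym[of "conj_transpose g ** A" g] unitary_right[OF assms]
  by (simp add: matrix_mul_assoc)


section \<open>The unitary frame bundle\<close>

locale frame_bundle =
  fixes AM :: "('m, 'e::real_normed_vector) chart set"
    and E :: "('m, 'v::ab_group_add, 'n::finite) vbundle"
    and AP :: "(('m, 'v, 'n) frame, 'p::real_normed_vector) chart set"
  assumes AM: "smooth_manifold AM"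
    and hermitian: "hermitian_vector_bundle AM E"
    and atlas: "frame_bundle_atlas AM E AP"
begin

lemma AP: "smooth_manifold AP"
  using atlas unfolding frame_bundle_atlas_def by blast

lemma points_AP: "points AP = unitary_frames (points AM) E"
  using atlas unfolding frame_bundle_atlas_def by blast

lemma frame_base: "p \<in> points AP \<Longrightarrow> fst p \<in> points AM"
  unfolding points_AP unitary_frames_def by auto

lemma frame_Fibre: "p \<in> points AP \<Longrightarrow> snd p i \<in> Fibre E (fst p)"
  unfolding points_AP unitary_frames_def by auto

lemma frame_orthonormal:
  "p \<in> points AP \<Longrightarrow> Metric E (fst p) (snd p i) (snd p j) = (if i = j then 1 else 0)"
  unfolding points_AP unitary_frames_def by auto

lemmas bundle_axioms =
  hermitian[unfolded hermitian_vector_bundle_def, THEN conjunct1]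
  hermitian[unfolded hermitian_vector_bundle_def, THEN conjunct2, THEN conjunct1]
  hermitian[unfolded hermitian_vector_bundle_def, THEN conjunct2, THEN conjunct2, THEN conjunct1]
  hermitian[unfolded hermitian_vector_bundle_def, THEN conjunct2, THEN conjunct2, THEN conjunct2, THEN conjunct1]
  hermitian[unfolded hermitian_vector_bundle_def, THEN conjunct2, THEN conjunct2, THEN conjunct2, THEN conjunct2]

sublocale V: vector_space "Scale E"
  by (rule bundle_axioms(1))

lemma subspace_Fibre: "x \<in> points AM \<Longrightarrow> module.subspace (Scale E) (Fibre E x)"
  using bundle_axioms(2) by blast

lemma Fibre_sum:
  assumes "x \<in> points AM" "\<And>i. i \<in> I \<Longrightarrow> v i \<in> Fibre E x"
  shows "(\<Sum>i\<in>I. Scale E (a i) (v i)) \<in> Fibre E x"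
proof -
  show ?thesis using subspace_Fibre[OF assms(1)] assms(2) by (intro V.subspace_sum V.subspace_scale) auto
qed

lemma Metric_add: "x \<in> points AM \<Longrightarrow> v \<in> Fibre E x \<Longrightarrow> v' \<in> Fibre E x \<Longrightarrow> w \<in> Fibre E x \<Longrightarrow>
    Metric E x (v + v') w = Metric E x v w + Metric E x v' w"
  and Metric_Scale: "x \<in> points AM \<Longrightarrow> v \<in> Fibre E x \<Longrightarrow> w \<in> Fibre E x \<Longrightarrow>
    Metric E x (Scale E z v) w = z * Metric E x v w"
  and Metric_sym: "x \<in> points AM \<Longrightarrow> v \<in> Fibre E x \<Longrightarrow> w \<in> Fibre E x \<Longrightarrow>
    Metric E x w v = cnj (Metric E x v w)"
  using bundle_axioms(5) by blast+

lemma Metric_sum_left: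
  assumes x: "x \<in> points AM" and "finite I" "\<And>i. i \<in> I \<Longrightarrow> v i \<in> Fibre E x" and w: "w \<in> Fibre E x"
  shows "Metric E x (\<Sum>i\<in>I. Scale E (a i) (v i)) w = (\<Sum>i\<in>I. a i * Metric E x (v i) w)"
  using assms(2,3)
proof (induction I rule: finite_induct)
  case empty
  have "Metric E x (0 + 0) w = Metric E x 0 w + Metric E x 0 w"
    using Fibre_sum[OF x, of "{}"] by (intro Metric_add x w) auto
  then show ?case by simp
next
  case (insert i I)
  have 1: "Scale E (a i) (v i) \<in> Fibre E x"
    using V.subspace_scale[OF subspace_Fibre[OF x]] insert.prems by blast
  have 2: "(\<Sum>i\<in>I. Scale E (a i) (v i)) \<in> Fibre E x" using insert.prems by (intro Fibre_sum x) auto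
  show ?case using insert by (simp add: Metric_add[OF x 1 2 w] Metric_Scale[OF x _ w])
qed

lemma Metric_sum_right:
  assumes x: "x \<in> points AM" and "finite I" "\<And>i. i \<in> I \<Longrightarrow> v i \<in> Fibre E x" and w: "w \<in> Fibre E x"
  shows "Metric E x w (\<Sum>i\<in>I. Scale E (a i) (v i)) = (\<Sum>i\<in>I. cnj (a i) * Metric E x w (v i))"
proof -
  have "Metric E x w (\<Sum>i\<in>I. Scale E (a i) (v i)) = cnj (Metric E x (\<Sum>i\<in>I. Scale E (a i) (v i)) w)"
    by (rule Metric_sym[OF x Fibre_sum[OF x] w]) (rule assms(3))
  also have "\<dots> = cnj (\<Sum>i\<in>I. a i * Metric E x (v i) w)"
    by (intro arg_cong[where f = cnj] Metric_sum_left x assms(2,3) w)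
  also have "\<dots> = (\<Sum>i\<in>I. cnj (a i) * cnj (Metric E x (v i) w))" by simp
  also have "\<dots> = (\<Sum>i\<in>I. cnj (a i) * Metric E x w (v i))"
    using Metric_sym[OF x _ w] assms(3) by (intro sum.cong) auto
  finally show ?thesis .
qed

lemma fst_frame_act [simp]: "fst (frame_act E p g) = fst p"
  by (simp add: frame_act_def)

lemma frame_act_points:
  assumes p: "p \<in> points AP" and g: "g \<in> unitary_group"
  shows "frame_act E p g \<in> points AP"
proof -
  let ?x = "fst p"
  let ?f = "\<lambda>j. \<Sum>i\<in>UNIV. Scale E (g $ i $ j) (snd p i)"
  have x: "?x \<in> points AM" using frame_base[OF p] .
  have f: "?f j \<in> Fibre E ?x" for j by (intro Fibre_sum x frame_Fibre p)
  have "Metric E ?x (?f j) (?f k) = (if j = k then 1 else 0)" for j k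
  proof -
    have "Metric E ?x (?f j) (?f k) = (\<Sum>i\<in>UNIV. g $ i $ j * Metric E ?x (snd p i) (?f k))"
      by (intro Metric_sum_left x f frame_Fibre[OF p]) auto
    also have "\<dots> = (\<Sum>i\<in>UNIV. g $ i $ j * (\<Sum>l\<in>UNIV. cnj (g $ l $ k) * Metric E ?x (snd p i) (snd p l)))"
      by (intro sum.cong refl arg_cong2[where f = "(*)"] Metric_sum_right x frame_Fibre[OF p]) auto
    also have "\<dots> = (\<Sum>i\<in>UNIV. g $ i $ j * cnj (g $ i $ k))"
      by (simp add: frame_orthonormal[OF p] if_distrib cong: if_cong)
    also have "\<dots> = (conj_transpose g ** g) $ k $ j"
      by (simp add: conj_transpose_def matrix_matrix_mult_def mult.commute)
    also have "\<dots> = (if j = k then 1 else 0)" using unitary_left[OF g] by (simp add: mat_def)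
    finally show ?thesis .
  qed
  then show ?thesis using x f unfolding points_AP unitary_frames_def frame_act_def by simp
qed

lemma frame_act_assoc: "frame_act E (frame_act E p g) h = frame_act E p (g ** h)"
proof -
  have "(\<Sum>i\<in>UNIV. Scale E (h $ i $ j) (\<Sum>k\<in>UNIV. Scale E (g $ k $ i) (snd p k)))
    = (\<Sum>k\<in>UNIV. Scale E ((g ** h) $ k $ j) (snd p k))" for j
  proof -
    have "(\<Sum>i\<in>UNIV. Scale E (h $ i $ j) (\<Sum>k\<in>UNIV. Scale E (g $ k $ i) (snd p k)))
      = (\<Sum>i\<in>UNIV. \<Sum>k\<in>UNIV. Scale E (g $ k $ i * h $ i $ j) (snd p k))"
      by (simp only: V.scale_sum_right V.scale_scale mult.commute)
    also have "\<dots> = (\<Sum>k\<in>UNIV. \<Sum>i\<in>UNIV. Scale E (g $ k $ i * h $ i $ j) (snd p k))"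
      by (rule sum.swap)
    also have "\<dots> = (\<Sum>k\<in>UNIV. Scale E ((g ** h) $ k $ j) (snd p k))"
      by (simp add: V.scale_sum_left matrix_matrix_mult_def)
    finally show ?thesis .
  qed
  then show ?thesis by (simp add: frame_act_def)
qed

lemma frame_act_one: "frame_act E p (mat 1) = p"
proof -
  have "(\<Sum>i\<in>UNIV. Scale E (mat 1 $ i $ j) (snd p i)) = snd p j" for j
  proof -
    have "(\<Sum>i\<in>UNIV. Scale E (mat 1 $ i $ j) (snd p i)) = (\<Sum>i\<in>UNIV. if i = j then snd p i else 0)"
      by (intro sum.cong) (auto simp: mat_def)
    then show ?thesis by simp
  qed
  then show ?thesis by (simp add: frame_act_def)
qed

subsection \<open>Local trivializations\<close>

text \<open>The piece \<open>N\<close> of FrE in \<open>frame_bundle_atlas\<close>, on which frame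
  coordinates are defined.\<close>

definition frames_over :: "'m set \<Rightarrow> 'm set \<Rightarrow> ('m, 'v, 'n) frame set" where
  "frames_over D U = {p \<in> points AP. fst p \<in> D \<inter> U}"

lemma local_trivialization:
  assumes "p \<in> points AP"
  obtains D \<phi> U \<tau> where "(D, \<phi>) \<in> AM" "(U, \<tau>) \<in> Triv E" "p \<in> frames_over D U"
proof -
  have x: "fst p \<in> points AM" using frame_base[OF assms] .
  obtain \<kappa> where \<kappa>: "\<kappa> \<in> AM" "fst p \<in> fst \<kappa>" using pointsE[OF x] .
  obtain T where T: "T \<in> Triv E" "fst p \<in> fst T" using x unfolding bundle_axioms(3) by blast
  have "p \<in> frames_over (fst \<kappa>) (fst T)" using \<kappa>(2) T(2) assms unfolding frames_over_def by simp
  then show ?thesis using that[of "fst \<kappa>" "snd \<kappa>" "fst T" "snd T"] \<kappa>(1) T(1) by simp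
qed

lemma frames_over_points: "p \<in> frames_over D U \<Longrightarrow> p \<in> points AP"
  by (simp add: frames_over_def)

lemma trivialization_domain: "(U, \<tau>) \<in> Triv E \<Longrightarrow> openin (manifold_topology AM) U"
  using bundle_axioms(4) by blast

lemma trivialization_points: "(U, \<tau>) \<in> Triv E \<Longrightarrow> U \<subseteq> points AM"
  using trivialization_domain openin_manifold_topology[OF AM] by blast

context
  fixes D \<phi> U \<tau> assumes ch: "(D, \<phi>) \<in> AM" and tr: "(U, \<tau>) \<in> Triv E"
begin

private abbreviation "N \<equiv> frames_over D U"
private abbreviation "\<Psi> \<equiv> frame_coords \<phi> \<tau>"

lemma trivialization_bij: "x \<in> U \<Longrightarrow> bij_betw (\<tau> x) (Fibre E x) UNIV"
  and trivialization_add: "x \<in> U \<Longrightarrow> v \<in> Fibre E x \<Longrightarrow> w \<in> Fibre E x \<Longrightarrow> \<tau> x (v + w) = \<tau> x v + \<tau> x w"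
  and trivialization_Scale: "x \<in> U \<Longrightarrow> v \<in> Fibre E x \<Longrightarrow> \<tau> x (Scale E z v) = z *s \<tau> x v"
  using bundle_axioms(4) tr by blast+

lemma trivialization_sum:
  assumes x: "x \<in> U" and "finite I" "\<And>i. i \<in> I \<Longrightarrow> v i \<in> Fibre E x"
  shows "\<tau> x (\<Sum>i\<in>I. Scale E (a i) (v i)) = (\<Sum>i\<in>I. a i *s \<tau> x (v i))"
proof -
  have xM: "x \<in> points AM" using x trivialization_points[OF tr] by blast
  show ?thesis using assms(2,3)
  proof (induction I rule: finite_induct)
    case empty
    have "\<tau> x (0 + 0) = \<tau> x 0 + \<tau> x 0"
      using Fibre_sum[OF xM, of "{}"] by (intro trivialization_add x) auto
    then show ?case by simp
  next
    case (insert i I)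
    have 1: "Scale E (a i) (v i) \<in> Fibre E x"
      using V.subspace_scale[OF subspace_Fibre[OF xM]] insert.prems by blast
    have 2: "(\<Sum>i\<in>I. Scale E (a i) (v i)) \<in> Fibre E x" using insert.prems by (intro Fibre_sum xM) auto
    show ?case using insert by (simp add: trivialization_add[OF x 1 2] trivialization_Scale[OF x])
  qed
qed

text \<open>In frame coordinates the action is right multiplication of the matrix part, hence
  visibly smooth.\<close>

lemma frame_coords_act:
  assumes "p \<in> N"
  shows "\<Psi> (frame_act E p g) = (fst (\<Psi> p), snd (\<Psi> p) ** g)"
proof -
  have x: "fst p \<in> U" using assms unfolding frames_over_def by blast
  have "\<tau> (fst p) (\<Sum>i\<in>UNIV. Scale E (g $ i $ j) (snd p i)) = (\<Sum>i\<in>UNIV. g $ i $ j *s \<tau> (fst p) (snd p i))" for j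
    by (intro trivialization_sum x frame_Fibre frames_over_points[OF assms]) auto
  then show ?thesis
    by (simp add: frame_coords_def frame_act_def vec_eq_iff matrix_matrix_mult_def mult.commute)
qed

lemma inj_frame_coords: "inj_on \<Psi> N"
proof (rule inj_onI)
  fix p q assume p: "p \<in> N" and q: "q \<in> N" and eq: "\<Psi> p = \<Psi> q"
  have "fst p \<in> D" "fst q \<in> D" "\<phi> (fst p) = \<phi> (fst q)"
    using p q eq unfolding frames_over_def frame_coords_def by auto
  then have x: "fst p = fst q" using chart_inj[OF AM ch] by (auto dest: inj_onD)
  have xU: "fst p \<in> U" using p unfolding frames_over_def by blast
  have "snd p i = snd q i" for i
  proof (rule inj_onD[OF bij_betw_imp_inj_on[OF trivialization_bij[OF xU]]])
    show "\<tau> (fst p) (snd p i) = \<tau> (fst p) (snd q i)"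
      using eq x by (simp add: frame_coords_def vec_eq_iff)
    show "snd p i \<in> Fibre E (fst p)" "snd q i \<in> Fibre E (fst p)"
      using frame_Fibre[OF frames_over_points[OF p]] frame_Fibre[OF frames_over_points[OF q]] x by auto
  qed
  then show "p = q" using x by (simp add: prod_eq_iff fun_eq_iff)
qed

lemma openin_frames_over: "openin (manifold_topology AP) N"
  and smooth_from_frame_coords: "smooth_from AP N \<Psi>"
  and frame_coords_chart: "(D', \<psi>) \<in> AP \<Longrightarrow> openin (top_of_set (\<Psi> ` N)) (\<Psi> ` (N \<inter> D')) \<and>
           smooth_on_subset (\<Psi> ` (N \<inter> D')) (\<psi> \<circ> inv_into N \<Psi>)"
proof -
  have "openin (manifold_topology AP) N \<and> smooth_from AP N \<Psi> \<and>
        (\<forall>(D', \<psi>)\<in>AP. openin (top_of_set (\<Psi> ` N)) (\<Psi> ` (N \<inter> D')) \<and>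
           smooth_on_subset (\<Psi> ` (N \<inter> D')) (\<psi> \<circ> inv_into N \<Psi>))"
    using atlas ch tr unfolding frame_bundle_atlas_def Let_def frames_over_def by blast
  then show "openin (manifold_topology AP) N" "smooth_from AP N \<Psi>"
    "(D', \<psi>) \<in> AP \<Longrightarrow> openin (top_of_set (\<Psi> ` N)) (\<Psi> ` (N \<inter> D')) \<and>
           smooth_on_subset (\<Psi> ` (N \<inter> D')) (\<psi> \<circ> inv_into N \<Psi>)" by blast+
qed

text \<open>The image of \<open>\<Psi>\<close> consists of matrices subject to an orthonormality
  relation and is not open, so the coordinate change to a chart of FrE is smooth only as the
  restriction of some \<open>F\<close>. Intersecting the domain of \<open>F\<close> with an open set
  from relative openness also makes \<open>W\<close> detect membership in the chart.\<close>

lemma frame_coords_extension: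
  assumes p: "p \<in> N" and \<kappa>: "\<kappa> \<in> AP" "p \<in> fst \<kappa>"
  obtains W F where "open W" "\<Psi> p \<in> W" "smooth_on W F"
    "\<forall>q\<in>N. \<Psi> q \<in> W \<longrightarrow> q \<in> fst \<kappa> \<and> F (\<Psi> q) = snd \<kappa> q"
proof -
  have fc: "openin (top_of_set (\<Psi> ` N)) (\<Psi> ` (N \<inter> fst \<kappa>))" "smooth_on_subset (\<Psi> ` (N \<inter> fst \<kappa>)) (snd \<kappa> \<circ> inv_into N \<Psi>)"
    using frame_coords_chart[of "fst \<kappa>" "snd \<kappa>"] \<kappa>(1) by auto
  obtain T where T: "open T" "\<Psi> ` (N \<inter> fst \<kappa>) = \<Psi> ` N \<inter> T"
    using fc(1) unfolding openin_open by blast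
  have "\<Psi> p \<in> \<Psi> ` (N \<inter> fst \<kappa>)" using p \<kappa>(2) by blast
  from fc(2)[unfolded smooth_on_subset_def, rule_format, OF this]
  obtain W F where W: "open W" "\<Psi> p \<in> W" "smooth_on W F"
    "\<forall>y\<in>\<Psi> ` (N \<inter> fst \<kappa>) \<inter> W. F y = (snd \<kappa> \<circ> inv_into N \<Psi>) y"
    by blast
  show ?thesis
  proof (rule that[of "W \<inter> T" F])
    show "open (W \<inter> T)" using W(1) T(1) by blast
    have "\<Psi> p \<in> \<Psi> ` (N \<inter> fst \<kappa>)" using p \<kappa>(2) by blast
    then show "\<Psi> p \<in> W \<inter> T" using W(2) unfolding T(2) by blast
    show "smooth_on (W \<inter> T) F" by (rule smooth_on_subset[OF W(3)]) simp
    show "\<forall>q\<in>N. \<Psi> q \<in> W \<inter> T \<longrightarrow> q \<in> fst \<kappa> \<and> F (\<Psi> q) = snd \<kappa> q"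
    proof (intro ballI impI)
      fix q assume q: "q \<in> N" "\<Psi> q \<in> W \<inter> T"
      then have m: "\<Psi> q \<in> \<Psi> ` (N \<inter> fst \<kappa>)" using T(2) by blast
      then obtain q' where "q' \<in> N" "q' \<in> fst \<kappa>" "\<Psi> q = \<Psi> q'" by blast
      then have "q \<in> fst \<kappa>" using inj_onD[OF inj_frame_coords, of q q'] q(1) by simp
      moreover have "F (\<Psi> q) = snd \<kappa> q"
        using bspec[OF W(4), of "\<Psi> q"] m q inv_into_f_f[OF inj_frame_coords q(1)] by simp
      ultimately show "q \<in> fst \<kappa> \<and> F (\<Psi> q) = snd \<kappa> q" by blast
    qed
  qed
qed

lemma smooth_frame_coords:
  assumes "smooth_into AP S p"
  shows "open {z\<in>S. p z \<in> N}" "smooth_on {z\<in>S. p z \<in> N} (\<lambda>z. \<Psi> (p z))"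
  using smooth_into_openin[OF AP assms openin_frames_over]
    smooth_from_into[OF AP assms openin_frames_over smooth_from_frame_coords] by auto

text \<open>The target of frame coordinates is a middle space in compositions, and its first factor
  is an arbitrary finite-dimensional normed space, so its coordinates come from a spanning set of
  the product.\<close>

lemma coordinates_frame:
  obtains B :: "('e \<times> 'n mat) set" and co where "coordinates B co"
proof -
  obtain B1 :: "'e set" where "finite B1" "span B1 = UNIV" using AM unfolding smooth_manifold_def by blast
  moreover have "finite (Basis :: 'n mat set)" "span (Basis :: 'n mat set) = UNIV" by auto
  ultimately show ?thesis
    using that coordinates_exist[OF _ span_Times_UNIV, of B1 "Basis :: 'n mat set"] by blast
qed

text \<open>Composing the smooth frame coordinates with the local extension \<open>F\<close> yields
  the coordinates in a chart of FrE.\<close>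

lemma smooth_into_frame_local:
  assumes "open S" "q ` S \<subseteq> N" "smooth_on S (\<lambda>z. \<Psi> (q z))"
  shows "smooth_into AP S q"
proof (rule smooth_intoI[OF AP])
  fix z assume z: "z \<in> S"
  obtain B :: "('e \<times> 'n mat) set" and co where co: "coordinates B co" using coordinates_frame .
  have qz: "q z \<in> N" using z assms(2) by blast
  obtain \<kappa> where \<kappa>: "\<kappa> \<in> AP" "q z \<in> fst \<kappa>" using pointsE[OF frames_over_points[OF qz]] .
  obtain W F where W: "open W" "\<Psi> (q z) \<in> W" "smooth_on W F"
    "\<forall>q\<in>N. \<Psi> q \<in> W \<longrightarrow> q \<in> fst \<kappa> \<and> F (\<Psi> q) = snd \<kappa> q"
    using frame_coords_extension[OF qz \<kappa>] .
  let ?T = "S \<inter> (\<lambda>z. \<Psi> (q z)) -` W"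
  have op: "open ?T" using continuous_open_preimage[OF smooth_on_continuous[OF assms(3)] assms(1) W(1)] .
  have "smooth_on ?T (\<lambda>z. F (\<Psi> (q z)))"
    by (rule smooth_on_compose[OF co W(3) smooth_on_subset[OF assms(3)] _ op]) auto
  then have "smooth_on ?T (\<lambda>z. snd \<kappa> (q z))"
    by (rule smooth_on_cong[OF op]) (use W(4) assms(2) in blast)
  moreover have "q ` ?T \<subseteq> fst \<kappa>" using W(4) assms(2) by blast
  ultimately show "\<exists>T \<kappa>. open T \<and> z \<in> T \<and> T \<subseteq> S \<and> \<kappa> \<in> AP \<and> q ` T \<subseteq> fst \<kappa> \<and> smooth_on T (\<lambda>z. snd \<kappa> (q z))"
    using op z W(2) \<kappa>(1) by (intro exI[of _ ?T] exI[of _ \<kappa>]) auto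
qed

text \<open>Frame coordinates determine tangent vectors: the chart coordinates of both families
  arise from their frame coordinates through the same extension \<open>F\<close>, so equal first
  derivatives stay equal.\<close>

lemma partial_velocity_frame_coords_eq:
  assumes p: "smooth_into AP S p" and q: "smooth_into AP S q" and z: "z \<in> S" "p z \<in> N" and eq: "p z = q z"
    and D: "fderiv (\<lambda>z. \<Psi> (p z)) z e = fderiv (\<lambda>z. \<Psi> (q z)) z e"
  shows "partial_velocity AP p z e = partial_velocity AP q z e"
proof -
  obtain \<kappa> where \<kappa>: "\<kappa> \<in> AP" "p z \<in> fst \<kappa>" using pointsE[OF frames_over_points[OF z(2)]] .
  obtain W F where W: "open W" "\<Psi> (p z) \<in> W" "smooth_on W F"
    "\<forall>q\<in>N. \<Psi> q \<in> W \<longrightarrow> q \<in> fst \<kappa> \<and> F (\<Psi> q) = snd \<kappa> q"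
    using frame_coords_extension[OF z(2) \<kappa>] .
  have key: "fderiv (\<lambda>z. snd \<kappa> (r z)) z e
      = fderiv F (\<Psi> (p z)) (fderiv (\<lambda>z. \<Psi> (r z)) z e)"
    if r: "smooth_into AP S r" "r z = p z" for r
  proof -
    let ?T = "{z\<in>S. r z \<in> N} \<inter> (\<lambda>z. \<Psi> (r z)) -` W"
    have op: "open ?T"
      using continuous_open_preimage[OF smooth_on_continuous[OF smooth_frame_coords(2)[OF r(1)]]
          smooth_frame_coords(1)[OF r(1)] W(1)] .
    have zT: "z \<in> ?T" using z r(2) W(2) by simp
    have "((\<lambda>z. \<Psi> (r z)) has_derivative fderiv (\<lambda>z. \<Psi> (r z)) z) (at z)"
      using smooth_on_has_derivative[OF smooth_frame_coords(2)[OF r(1)]] zT by blast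
    moreover have "(F has_derivative fderiv F (\<Psi> (r z))) (at (\<Psi> (r z)))"
      using smooth_on_has_derivative[OF W(3)] W(2) r(2) by simp
    ultimately have "((\<lambda>z. F (\<Psi> (r z))) has_derivative
        (\<lambda>e. fderiv F (\<Psi> (r z)) (fderiv (\<lambda>z. \<Psi> (r z)) z e))) (at z)"
      using diff_chain_at unfolding o_def by blast
    then have "((\<lambda>z. snd \<kappa> (r z)) has_derivative
        (\<lambda>e. fderiv F (\<Psi> (r z)) (fderiv (\<lambda>z. \<Psi> (r z)) z e))) (at z)"
      by (rule has_derivative_transform_within_open[OF _ op zT]) (use W(4) in blast)
    from frechet_derivative_eqI[OF this] show ?thesis using r(2) by simp
  qed
  have \<kappa>q: "q z \<in> fst \<kappa>" using \<kappa> eq by simp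
  have "fderiv (\<lambda>z. snd \<kappa> (p z)) z e = fderiv (\<lambda>z. snd \<kappa> (q z)) z e"
    using key[OF p] key[OF q] eq D by simp
  then show ?thesis
    using partial_velocity_eq_coord_vec[OF AP p z(1) \<kappa>, of e] partial_velocity_eq_coord_vec[OF AP q z(1) \<kappa>(1) \<kappa>q, of e] eq
    by simp
qed

end

text \<open>Locally the frame coordinates of the translated family are the old base part and the
  product of the old matrix part with \<open>a\<close>, which is bilinear.\<close>

lemma smooth_into_act:
  fixes p :: "'z::real_normed_vector \<Rightarrow> ('m, 'v, 'n) frame"
  assumes p: "smooth_into AP S p" and a: "smooth_on S a" "a ` S \<subseteq> unitary_group" and S: "open S"
  shows "smooth_into AP S (\<lambda>z. frame_act E (p z) (a z))"
proof (rule smooth_intoI[OF AP])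
  fix z assume z: "z \<in> S"
  obtain D \<phi> U \<tau> where ch: "(D, \<phi>) \<in> AM" and tr: "(U, \<tau>) \<in> Triv E" and pz: "p z \<in> frames_over D U"
    using local_trivialization[OF smooth_into_points[OF p z]] .
  let ?N = "frames_over D U" and ?\<Psi> = "frame_coords \<phi> \<tau>"
  let ?q = "\<lambda>z. frame_act E (p z) (a z)"
  let ?T = "{z\<in>S. p z \<in> ?N}"
  note op = smooth_frame_coords(1)[OF ch tr p] and sm = smooth_frame_coords(2)[OF ch tr p]
  have qN: "?q ` ?T \<subseteq> ?N"
  proof (rule image_subsetI)
    fix y assume y: "y \<in> ?T"
    then have "a y \<in> unitary_group" "p y \<in> points AP" using a(2) frames_over_points by blast+
    then show "?q y \<in> ?N" using y frame_act_points unfolding frames_over_def by simp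
  qed
  have "smooth_on ?T (\<lambda>z. snd (?\<Psi> (p z)) ** a z)"
    by (intro smooth_on_bilinear[OF bounded_bilinear_matrix_mult] op
        smooth_on_bounded_linear_comp[OF bounded_linear_snd sm] smooth_on_subset[OF a(1)]) auto
  then have "smooth_on ?T (\<lambda>z. (fst (?\<Psi> (p z)), snd (?\<Psi> (p z)) ** a z))"
    by (intro smooth_on_Pair op smooth_on_bounded_linear_comp[OF bounded_linear_fst sm])
  then have "smooth_on ?T (\<lambda>z. ?\<Psi> (?q z))"
    by (rule smooth_on_cong[OF op]) (simp add: frame_coords_act[OF ch tr])
  from smooth_into_frame_local[OF ch tr op qN this] have si: "smooth_into AP ?T ?q" .
  have zT: "z \<in> ?T" using z pz by simp
  obtain \<kappa> where \<kappa>: "\<kappa> \<in> AP" "?q z \<in> fst \<kappa>" using pointsE[OF smooth_into_points[OF si zT]] .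
  show "\<exists>T \<kappa>. open T \<and> z \<in> T \<and> T \<subseteq> S \<and> \<kappa> \<in> AP \<and> ?q ` T \<subseteq> fst \<kappa> \<and> smooth_on T (\<lambda>z. snd \<kappa> (?q z))"
    using smooth_into_open[OF si \<kappa>(1)] smooth_into_chart[OF si \<kappa>(1)] zT \<kappa>
    by (intro exI[of _ "{y\<in>?T. ?q y \<in> fst \<kappa>}"] exI[of _ \<kappa>]) auto
qed

end

section \<open>Derivatives of matrix-valued curves\<close>

lemma has_derivative_has_vector_derivative:
  fixes f :: "real \<Rightarrow> 'k::real_normed_vector"
  assumes "(f has_derivative F) (at x)"
  shows "(f has_vector_derivative F 1) (at x)"
proof -
  have "F r = r *\<^sub>R F 1" for r
  proof -
    have "F (r *\<^sub>R 1) = r *\<^sub>R F 1" by (rule linear_cmul[OF has_derivative_linear[OF assms]])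
    then show ?thesis by (simp only: real_scaleR_def mult_1_right)
  qed
  then have "F = (\<lambda>r. r *\<^sub>R F 1)" by (rule ext)
  from has_derivative_eq_rhs[OF assms this] show ?thesis unfolding has_vector_derivative_def .
qed

text \<open>A matrix is the sum of its entries times elementary matrices, and each summand depends
  linearly on one entry.\<close>

lemma has_vector_derivative_matrix:
  assumes "\<And>i j. ((\<lambda>s. h i j s) has_vector_derivative h' i j) F"
  shows "((\<lambda>s. (\<chi> i j. h i j s) :: ('k::finite) mat) has_vector_derivative (\<chi> i j. h' i j)) F"
proof -
  have eq: "(\<chi> i j. h i j) = (\<Sum>i\<in>UNIV. \<Sum>j\<in>UNIV. axis i (axis j (h i j)))" for h :: "'k \<Rightarrow> 'k \<Rightarrow> complex"
  proof -
    have ax: "axis i (axis j z) $ a $ b = (if a = i then if b = j then z else 0 else 0)" for i j a b :: 'k and z :: complex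
      by (simp add: axis_def)
    have "(\<Sum>i\<in>UNIV. \<Sum>j\<in>UNIV. if a = i then if b = j then h i j else 0 else 0) = h a b" for a b
    proof -
      have "(\<Sum>i\<in>UNIV. \<Sum>j\<in>UNIV. if a = i then if b = j then h i j else 0 else 0)
        = (\<Sum>i\<in>UNIV. if a = i then \<Sum>j\<in>UNIV. if b = j then h i j else 0 else 0)"
        by (rule sum.cong) auto
      then show ?thesis by simp
    qed
    then show ?thesis by (intro iffD2[OF vec_eq_iff] allI) (simp add: ax)
  qed
  have bl: "bounded_linear (\<lambda>z :: complex. axis i (axis j z) :: 'k mat)" for i j
    by (rule linear_conv_bounded_linear[THEN iffD1], rule linearI)
      (simp_all add: vec_eq_iff axis_def)
  show ?thesis unfolding eq
    by (intro has_vector_derivative_sum bounded_linear.has_vector_derivative[OF bl] assms)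
qed

subsection \<open>Curves with prescribed velocity in the unitary group\<close>

text \<open>The inner product here is the real one, the real part of the Hermitian product, and the
  conjugate transpose is the adjoint for it as well.\<close>

lemma inner_matrix_vector_adjoint: "(A *v x) \<bullet> y = x \<bullet> (conj_transpose A *v y)"
  for A :: "('n::finite) mat"
proof -
  have "(A *v x) \<bullet> y = (\<Sum>i\<in>UNIV. \<Sum>j\<in>UNIV. (A $ i $ j * x $ j) \<bullet> (y $ i))"
    by (simp add: inner_vec_def matrix_vector_mult_def inner_sum_left)
  also have "\<dots> = (\<Sum>i\<in>UNIV. \<Sum>j\<in>UNIV. (x $ j) \<bullet> (cnj (A $ i $ j) * y $ i))"
    by (intro sum.cong refl) (simp add: inner_complex_def algebra_simps)
  also have "\<dots> = (\<Sum>j\<in>UNIV. \<Sum>i\<in>UNIV. (x $ j) \<bullet> (cnj (A $ i $ j) * y $ i))"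
    by (rule sum.swap)
  also have "\<dots> = x \<bullet> (conj_transpose A *v y)"
    by (simp add: inner_vec_def matrix_vector_mult_def inner_sum_right conj_transpose_def)
  finally show ?thesis .
qed

text \<open>For skew-Hermitian \<open>A\<close> the vectors \<open>x\<close> and
  \<open>A *v x\<close> are orthogonal in the real inner product, so Pythagoras applies. This makes
  \<open>1 - A\<close> injective and bounds its inverse by 1.\<close>

lemma norm_one_minus_skew:
  fixes A :: "('n::finite) mat"
  assumes "conj_transpose A = - A"
  shows "norm x \<le> norm ((mat 1 - A) *v x)"
proof -
  have "(- A) *v x = - (A *v x)" by (simp add: vec_eq_iff matrix_vector_mult_def sum_negf)
  then have "(A *v x) \<bullet> x = - (x \<bullet> (A *v x))"
    using inner_matrix_vector_adjoint[of A x x] assms by simp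
  then have "x \<bullet> (A *v x) = 0" by (simp add: inner_commute)
  moreover have "(mat 1 - A) *v x = x - A *v x" by (simp add: matrix_vector_mult_diff_rdistrib)
  ultimately have "(norm ((mat 1 - A) *v x))\<^sup>2 = (norm x)\<^sup>2 + (norm (A *v x))\<^sup>2"
    by (simp add: power2_norm_eq_inner inner_diff_left inner_diff_right inner_commute)
  then have "(norm x)\<^sup>2 \<le> (norm ((mat 1 - A) *v x))\<^sup>2" by simp
  then show ?thesis by (rule power2_le_imp_le) simp
qed

text \<open>The norm on matrices is the Euclidean norm of the entries, not the operator norm. A
  contraction has entries of modulus at most 1, which gives a crude bound sufficient for
  uniformity.\<close>

lemma norm_matrix_le_entries:
  fixes K :: "('n::finite) mat"
  assumes "\<And>x. norm (K *v x) \<le> norm x"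
  shows "norm K \<le> real CARD('n) * real CARD('n)"
proof -
  have entry: "norm (K $ i $ j) \<le> 1" for i j
  proof -
    have "K $ i $ j = (K *v axis j 1) $ i"
      by (simp add: matrix_vector_mult_def axis_def if_distrib cong: if_cong)
    also have "norm \<dots> \<le> norm (K *v axis j 1)" by (rule Finite_Cartesian_Product.norm_nth_le)
    also have "\<dots> \<le> 1" using assms[of "axis j 1"] by (simp add: norm_eq_1 inner_axis_axis)
    finally show ?thesis .
  qed
  have row: "norm (K $ i) \<le> real CARD('n)" for i
  proof -
    have "norm (K $ i) \<le> (\<Sum>j\<in>UNIV. norm (K $ i $ j))" unfolding norm_vec_def by (rule L2_set_le_sum) simp
    also have "\<dots> \<le> (\<Sum>j\<in>(UNIV :: 'n set). 1)" by (intro sum_mono entry)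
    finally show ?thesis by simp
  qed
  have "norm K \<le> (\<Sum>i\<in>UNIV. norm (K $ i))" unfolding norm_vec_def[of K] by (rule L2_set_le_sum) simp
  also have "\<dots> \<le> (\<Sum>i\<in>(UNIV :: 'n set). real CARD('n))" by (intro sum_mono row)
  finally show ?thesis by simp
qed

lemma matrix_scaleR_left: "(s *\<^sub>R A) ** B = s *\<^sub>R (A ** B)"
  and matrix_scaleR_right: "A ** (s *\<^sub>R B) = s *\<^sub>R (A ** B)" for A B :: "('n::finite) mat"
  by (rule bounded_bilinear.scaleR_left[OF bounded_bilinear_matrix_mult],
      rule bounded_bilinear.scaleR_right[OF bounded_bilinear_matrix_mult])

lemma matrix_diff_left: "(A - A') ** B = A ** B - A' ** B"
  and matrix_diff_right: "B ** (A - A') = B ** A - B ** A'"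
  and matrix_add_left: "(A + A') ** B = A ** B + A' ** B"
  and matrix_add_right: "B ** (A + A') = B ** A + B ** A'"
  and matrix_minus_left: "(- A) ** B = - (A ** B)" for A A' B :: "('n::finite) mat"
  by (rule bounded_bilinear.diff_left[OF bounded_bilinear_matrix_mult],
      rule bounded_bilinear.diff_right[OF bounded_bilinear_matrix_mult],
      rule bounded_bilinear.add_left[OF bounded_bilinear_matrix_mult],
      rule bounded_bilinear.add_right[OF bounded_bilinear_matrix_mult],
      rule bounded_bilinear.minus_left[OF bounded_bilinear_matrix_mult])

text \<open>The algebra behind the resolvent identity for the inverses in the Cayley
  transform.\<close>

lemma matrix_diff_sandwich: "K ** (X ** L) - (K ** Y) ** L = K ** (X - Y) ** L" for K X Y L :: "('n::finite) mat"
  unfolding matrix_diff_left matrix_diff_right matrix_mul_assoc ..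

text \<open>The curve is the Cayley transform \<open>s \<mapsto> (1 + s A) (1 - s A)\<^sup>-\<^sup>1\<close> with \<open>A = B / 2\<close>.\<close>

lemma unitary_curve_exists:
  fixes B :: "('n::finite) mat"
  assumes B: "B \<in> unitary_lie_algebra"
  obtains g :: "real \<Rightarrow> 'n mat" where "smooth_on UNIV g" "range g \<subseteq> unitary_group" "g 0 = mat 1"
    "(g has_vector_derivative B) (at 0)"
proof -
  \<comment> \<open>Numerator and inverse denominator of the Cayley transform each contribute
    \<open>A\<close> to the derivative at 0, hence the factor one half.\<close>
  define A where "A = (1/2) *\<^sub>R B"
  have "conj_transpose B = - B" using B by (simp add: unitary_lie_algebra_def)
  then have "conj_transpose A = - A"
    by (simp add: A_def linear_cmul[OF bounded_linear.linear[OF bounded_linear_conj_transpose]])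
  then have skew: "conj_transpose (s *\<^sub>R A) = - (s *\<^sub>R A)" for s :: real
    by (simp add: linear_cmul[OF bounded_linear.linear[OF bounded_linear_conj_transpose]])
  have "\<exists>K. K ** (mat 1 - s *\<^sub>R A) = mat 1" for s :: real
    unfolding matrix_left_invertible_ker
  proof (intro allI impI)
    fix x assume "(mat 1 - s *\<^sub>R A) *v x = 0"
    then have "norm x \<le> 0" using norm_one_minus_skew[OF skew, of x s] by simp
    then show "x = 0" by simp
  qed
  note ex = this
  \<comment> \<open>The inverse of \<open>1 - s A\<close>, which exists for every real
    \<open>s\<close> because \<open>s A\<close> is skew-Hermitian.\<close>
  define K where "K = (\<lambda>s. SOME K. K ** (mat 1 - s *\<^sub>R A) = mat 1)"
  have K1: "K s ** (mat 1 - s *\<^sub>R A) = mat 1" for s unfolding K_def by (rule someI_ex[OF ex])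
  have K2: "(mat 1 - s *\<^sub>R A) ** K s = mat 1" for s by (rule matrix_left_right_inverse[THEN iffD1, OF K1])
  have Kle: "norm (K s *v x) \<le> norm x" for s x
    using norm_one_minus_skew[OF skew, of "K s *v x" s] K2[of s] by (simp add: matrix_vector_mul_assoc)
  define N where "N = real CARD('n) * real CARD('n)"
  have KN: "norm (K s) \<le> N" for s unfolding N_def by (rule norm_matrix_le_entries[OF Kle])
  have N: "N \<ge> 0" by (simp add: N_def)
  have "\<exists>L>0. \<forall>(X :: 'n mat) (Y :: 'n mat). norm (X ** Y) \<le> norm X * norm Y * L"
    by (rule bounded_bilinear.pos_bounded[OF bounded_bilinear_matrix_mult])
  then obtain L where L0: "L > 0" and L1: "\<forall>(X :: 'n mat) (Y :: 'n mat). norm (X ** Y) \<le> norm X * norm Y * L" by blast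
  note L = L0 L1[rule_format]
  \<comment> \<open>The resolvent identity. With the uniform bound on \<open>K\<close> it yields
    continuity, and then the derivative \<open>K A K\<close>.\<close>
  have Kdiff: "K t - K s = (t - s) *\<^sub>R (K t ** A ** K s)" for s t
  proof -
    have "K t - K s = K t ** ((mat 1 - s *\<^sub>R A) ** K s) - (K t ** (mat 1 - t *\<^sub>R A)) ** K s"
      by (simp only: K1 K2 matrix_mul_lid matrix_mul_rid)
    also have "\<dots> = K t ** ((mat 1 - s *\<^sub>R A) - (mat 1 - t *\<^sub>R A)) ** K s"
      by (rule matrix_diff_sandwich)
    also have "(mat 1 - s *\<^sub>R A) - (mat 1 - t *\<^sub>R A) = (t - s) *\<^sub>R A" by (simp add: scaleR_diff_left)
    finally show ?thesis by (simp only: matrix_scaleR_left matrix_scaleR_right)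
  qed
  have lip: "norm (K t ** A ** K s) \<le> N * norm A * L * N * L" for s t
  proof -
    have "norm (K t ** A ** K s) \<le> norm (K t ** A) * norm (K s) * L" by (rule L)
    also have "\<dots> \<le> (norm (K t) * norm A * L) * N * L"
      using L N KN by (intro mult_right_mono mult_mono L(2)) auto
    also have "\<dots> \<le> (N * norm A * L) * N * L"
      using L N KN by (intro mult_right_mono) auto
    finally show ?thesis .
  qed
  let ?c = "N * norm A * L * N * L"
  have c: "?c \<ge> 0" using L N by auto
  have contK: "continuous_on UNIV K"
  proof (rule continuous_at_imp_continuous_on, intro ballI)
    fix s
    have "((\<lambda>t. K t - K s) \<longlongrightarrow> 0) (at s)"
    proof (rule Lim_null_comparison)
      show "\<forall>\<^sub>F t in at s. norm (K t - K s) \<le> \<bar>t - s\<bar> * ?c"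
        unfolding Kdiff norm_scaleR by (intro always_eventually allI mult_left_mono lip) auto
      show "((\<lambda>t. \<bar>t - s\<bar> * ?c) \<longlongrightarrow> 0) (at s)" by (auto intro!: tendsto_eq_intros)
    qed
    then show "isCont K s" unfolding isCont_def by (simp add: LIM_zero_iff)
  qed
  have DK: "(K has_vector_derivative (K s ** A ** K s)) (at s)" for s
  proof -
    have "((\<lambda>t. K t ** A ** K s) \<longlongrightarrow> K s ** A ** K s) (at s)"
      by (intro bounded_bilinear.tendsto[OF bounded_bilinear_matrix_mult] tendsto_const)
        (use contK in \<open>simp add: continuous_on_eq_continuous_at isCont_def\<close>)
    then have "((\<lambda>t. norm (K t ** A ** K s - K s ** A ** K s)) \<longlongrightarrow> 0) (at s)"
      by (intro tendsto_norm_zero) (simp add: LIM_zero_iff)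
    moreover have "\<forall>\<^sub>F t in at s. norm (K t ** A ** K s - K s ** A ** K s)
        = norm (K t - K s - (t - s) *\<^sub>R (K s ** A ** K s)) / norm (t - s)"
      unfolding eventually_at_filter
      by (rule always_eventually) (simp add: Kdiff[of _ s] flip: scaleR_diff_right)
    ultimately have "((\<lambda>t. norm (K t - K s - (t - s) *\<^sub>R (K s ** A ** K s)) / norm (t - s)) \<longlongrightarrow> 0) (at s)"
      by (rule Lim_transform_eventually)
    then show ?thesis
      by (simp add: has_vector_derivative_def has_derivative_iff_norm bounded_linear_scaleR_left)
  qed
  \<comment> \<open>The derivative of \<open>K\<close> is a polynomial in \<open>K\<close>, so each
    order of differentiability gives the next.\<close>
  have "Ck_on k K UNIV" for k
  proof (induction k)
    case 0
    then show ?case using contK by simp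
  next
    case (Suc k)
    show ?case
    proof (rule Ck_on_SucI)
      show "(K has_derivative (\<lambda>v. v *\<^sub>R (K x ** A ** K x))) (at x)" for x
        using DK[of x] by (simp add: has_vector_derivative_def)
      show "Ck_on k (\<lambda>x. v *\<^sub>R (K x ** A ** K x)) UNIV" for v
        by (intro Ck_on_bilinear[OF bounded_bilinear_scaleR] Ck_on_const
            Ck_on_bilinear[OF bounded_bilinear_matrix_mult] Suc open_UNIV)
    qed simp
  qed
  then have smK: "smooth_on UNIV K" by (simp add: smooth_on_def)
  let ?g = "\<lambda>s. (mat 1 + s *\<^sub>R A) ** K s"
  have "smooth_on UNIV (\<lambda>s. mat 1 + s *\<^sub>R A)"
    by (rule smooth_on_affine[OF bounded_linear_scaleR_left])
  then have "smooth_on UNIV ?g" using smK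
    by (rule smooth_on_bilinear[OF bounded_bilinear_matrix_mult]) simp
  moreover have "?g s \<in> unitary_group" for s
  proof -
    let ?P = "mat 1 + s *\<^sub>R A" and ?M = "mat 1 - s *\<^sub>R A"
    have ct: "conj_transpose ?P = ?M" "conj_transpose ?M = ?P"
      using skew[of s] by (simp_all add: linear_add[OF bounded_linear.linear[OF bounded_linear_conj_transpose]]
          linear_diff[OF bounded_linear.linear[OF bounded_linear_conj_transpose]] conj_transpose_mat_1)
    \<comment> \<open>Taking adjoints exchanges numerator and denominator; since they commute, each
      can be moved next to the inverse that cancels it.\<close>
    have comm: "?M ** ?P = ?P ** ?M"
      by (simp add: matrix_diff_left matrix_add_left matrix_diff_right matrix_add_right)
    have KP: "conj_transpose (K s) ** ?P = mat 1"
      using arg_cong[OF K2[of s], of conj_transpose] by (simp add: conj_transpose_mult ct conj_transpose_mat_1)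
    have "conj_transpose (?g s) ** ?g s = conj_transpose (K s) ** (?M ** ?P) ** K s"
      by (simp add: conj_transpose_mult ct matrix_mul_assoc)
    also have "\<dots> = (conj_transpose (K s) ** ?P) ** (?M ** K s)"
      unfolding comm by (simp add: matrix_mul_assoc)
    also have "\<dots> = mat 1" by (simp add: KP K2)
    finally show ?thesis by (simp add: unitary_group_def)
  qed
  moreover have K0: "K 0 = mat 1" using K1[of 0] by simp
  moreover have "(?g has_vector_derivative B) (at 0)"
  proof -
    have "((\<lambda>s. mat 1 + s *\<^sub>R A) has_vector_derivative A) (at 0)"
      by (auto intro!: derivative_eq_intros)
    from bounded_bilinear.has_vector_derivative[OF bounded_bilinear_matrix_mult this DK[of 0]]
    have "(?g has_vector_derivative A + A) (at 0)" by (simp add: K0)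
    then show ?thesis by (simp add: A_def flip: scaleR_left_distrib)
  qed
  ultimately show ?thesis using that[of ?g] by auto
qed

subsection \<open>Vertical tangent vectors\<close>

context frame_bundle
begin

text \<open>Orthonormality of the frame in a trivialization: with \<open>M\<close> the matrix of the
  frame and \<open>G\<close> the Gram matrix of the metric, the adjoint of \<open>M\<close> times
  \<open>G\<close> times \<open>M\<close> is 1. The entry of \<open>G\<close> at \<open>l\<close>,
  \<open>k\<close> pairs the basis vectors in the order \<open>k\<close>, \<open>l\<close> because
  the metric is linear in its first argument.\<close>

lemma gram_identity:
  assumes ch: "(D, \<phi>) \<in> AM" and tr: "(U, \<tau>) \<in> Triv E" and p: "p \<in> frames_over D U"
  shows "conj_transpose (snd (frame_coords \<phi> \<tau> p)) **
    (\<chi> l k. Metric E (fst p) (inv_into (Fibre E (fst p)) (\<tau> (fst p)) (axis k 1))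
       (inv_into (Fibre E (fst p)) (\<tau> (fst p)) (axis l 1))) ** snd (frame_coords \<phi> \<tau> p) = mat 1"
proof -
  let ?x = "fst p" and ?M = "snd (frame_coords \<phi> \<tau> p)"
  let ?e = "\<lambda>k. inv_into (Fibre E ?x) (\<tau> ?x) (axis k 1)"
  note pP = frames_over_points[OF p]
  have xU: "?x \<in> U" using p unfolding frames_over_def by blast
  have x: "?x \<in> points AM" using frame_base[OF pP] .
  note bij = trivialization_bij[OF ch tr xU]
  have e: "?e k \<in> Fibre E ?x" "\<tau> ?x (?e k) = axis k 1" for k
    using bij unfolding bij_betw_def by (simp_all add: inv_into_into f_inv_into_f)
  have f: "snd p j = (\<Sum>k\<in>UNIV. Scale E (?M $ k $ j) (?e k))" for j
  proof (rule inj_onD[OF bij_betw_imp_inj_on[OF bij]])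
    have "\<tau> ?x (\<Sum>k\<in>UNIV. Scale E (?M $ k $ j) (?e k)) = (\<Sum>k\<in>UNIV. ?M $ k $ j *s axis k 1)"
      using trivialization_sum[OF ch tr xU, of UNIV ?e "\<lambda>k. ?M $ k $ j"] e by simp
    also have "\<dots> = \<tau> ?x (snd p j)"
      by (simp add: vec_eq_iff axis_def frame_coords_def if_distrib cong: if_cong)
    finally show "\<tau> ?x (snd p j) = \<tau> ?x (\<Sum>k\<in>UNIV. Scale E (?M $ k $ j) (?e k))" ..
    show "snd p j \<in> Fibre E ?x" by (rule frame_Fibre[OF pP])
    show "(\<Sum>k\<in>UNIV. Scale E (?M $ k $ j) (?e k)) \<in> Fibre E ?x" by (rule Fibre_sum[OF x e(1)])
  qed
  have "Metric E ?x (snd p j) (snd p i)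
      = (\<Sum>k\<in>UNIV. ?M $ k $ j * (\<Sum>l\<in>UNIV. cnj (?M $ l $ i) * Metric E ?x (?e k) (?e l)))" for i j
  proof -
    have "Metric E ?x (\<Sum>k\<in>UNIV. Scale E (?M $ k $ j) (?e k)) (snd p i)
        = (\<Sum>k\<in>UNIV. ?M $ k $ j * Metric E ?x (?e k) (snd p i))"
      by (rule Metric_sum_left[OF x _ e(1) frame_Fibre[OF pP]]) simp
    moreover have "Metric E ?x (?e k) (\<Sum>l\<in>UNIV. Scale E (?M $ l $ i) (?e l))
        = (\<Sum>l\<in>UNIV. cnj (?M $ l $ i) * Metric E ?x (?e k) (?e l))" for k
      by (rule Metric_sum_right[OF x _ e(1) e(1)]) simp
    ultimately show ?thesis unfolding f[symmetric] by simp
  qed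
  note expand = this
  have entries: "(\<Sum>k\<in>UNIV. (\<Sum>l\<in>UNIV. cnj (?M $ l $ i) * Metric E ?x (?e k) (?e l)) * ?M $ k $ j)
      = (if i = j then 1 else 0)" for i j
  proof -
    have "(\<Sum>k\<in>UNIV. (\<Sum>l\<in>UNIV. cnj (?M $ l $ i) * Metric E ?x (?e k) (?e l)) * ?M $ k $ j)
        = Metric E ?x (snd p j) (snd p i)"
      unfolding expand by (intro sum.cong refl mult.commute)
    then show ?thesis using frame_orthonormal[OF pP, of j i] by auto
  qed
  have "(conj_transpose ?M ** (\<chi> l k. Metric E ?x (?e k) (?e l)) ** ?M) $ i $ j = mat 1 $ i $ j" for i j
  proof -
    have "(conj_transpose ?M ** (\<chi> l k. Metric E ?x (?e k) (?e l)) ** ?M) $ i $ j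
      = (\<Sum>k\<in>UNIV. (\<Sum>l\<in>UNIV. cnj (?M $ l $ i) * Metric E ?x (?e k) (?e l)) * ?M $ k $ j)"
      by (simp only: matrix_matrix_mult_def conj_transpose_def vec_lambda_beta)
    also have "\<dots> = mat 1 $ i $ j" unfolding entries mat_def by simp
    finally show ?thesis .
  qed
  then show ?thesis by (intro iffD2[OF vec_eq_iff] allI)
qed

text \<open>Zero velocity in the base leaves only a matrix derivative \<open>M'\<close> in frame
  coordinates. Differentiating the Gram identity shows that the inverse of \<open>M\<close> times
  \<open>M'\<close> is skew-Hermitian, and translating \<open>p 0\<close> along any unitary curve
  with this velocity at the identity has the same derivative in frame coordinates.\<close>

lemma vertical_velocity:
  assumes p: "smooth_into AP UNIV p" and vel: "velocity AM (\<lambda>s::real. fst (p s)) 0 = (\<lambda>\<kappa>. 0)"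
  obtains B where "B \<in> unitary_lie_algebra"
    "\<forall>g. smooth_on UNIV g \<and> range g \<subseteq> unitary_group \<and> g 0 = mat 1 \<and> (g has_vector_derivative B) (at 0) \<longrightarrow>
      velocity AP p 0 = velocity AP (\<lambda>s. frame_act E (p 0) (g s)) 0"
proof -
  obtain D \<phi> U \<tau> where ch: "(D, \<phi>) \<in> AM" and tr: "(U, \<tau>) \<in> Triv E" and p0: "p 0 \<in> frames_over D U"
    using local_trivialization[OF smooth_into_points[OF p UNIV_I]] .
  let ?N = "frames_over D U" and ?\<Psi> = "frame_coords \<phi> \<tau>"
  let ?T = "{s\<in>UNIV. p s \<in> ?N}"
  note op = smooth_frame_coords(1)[OF ch tr p] and sm = smooth_frame_coords(2)[OF ch tr p]
  have 0: "0 \<in> ?T" using p0 by simp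
  have D\<Psi>: "((\<lambda>s. ?\<Psi> (p s)) has_vector_derivative fderiv (\<lambda>s. ?\<Psi> (p s)) 0 1) (at 0)"
  proof -
    have D: "((\<lambda>s. ?\<Psi> (p s)) has_derivative fderiv (\<lambda>s. ?\<Psi> (p s)) 0) (at 0)"
      by (rule smooth_on_has_derivative[OF sm 0])
    show ?thesis by (rule has_derivative_has_vector_derivative[OF D])
  qed
  define M' where "M' = snd (fderiv (\<lambda>s. ?\<Psi> (p s)) 0 1)"
  have Dx: "((\<lambda>s. \<phi> (fst (p s))) has_vector_derivative fst (fderiv (\<lambda>s. ?\<Psi> (p s)) 0 1)) (at 0)"
    using bounded_linear.has_vector_derivative[OF bounded_linear_fst D\<Psi>] by (simp add: frame_coords_def)
  have "vector_derivative (\<lambda>s. \<phi> (fst (p s))) (at 0) = 0"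
    using fun_cong[OF vel, of "(D, \<phi>)"] ch p0 unfolding velocity_def frames_over_def by (simp add: o_def)
  then have x'0: "fst (fderiv (\<lambda>s. ?\<Psi> (p s)) 0 1) = 0"
    using vector_derivative_at[OF Dx] by simp
  have D\<Psi>0: "fderiv (\<lambda>s. ?\<Psi> (p s)) 0 1 = (0, M')"
    using x'0 by (simp add: M'_def prod_eq_iff)
  let ?M = "\<lambda>s. snd (?\<Psi> (p s))"
  have DM: "(?M has_vector_derivative M') (at 0)"
    using bounded_linear.has_vector_derivative[OF bounded_linear_snd D\<Psi>] by (simp add: M'_def)
  let ?h = "\<lambda>l k x. Metric E x (inv_into (Fibre E x) (\<tau> x) (axis k 1)) (inv_into (Fibre E x) (\<tau> x) (axis l 1))"
  let ?G = "\<lambda>s. (\<chi> l k. ?h l k (fst (p s))) :: 'n mat"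
  \<comment> \<open>The base point is stationary to first order, hence so are the metric
    coefficients along it.\<close>
  have "((\<lambda>s. ?h l k (fst (p s))) has_vector_derivative 0) (at 0)" for l k
  proof -
    have "smooth_from AM U (?h l k)" using bundle_axioms(4) tr by blast
    then have "smooth_on (snd (D, \<phi>) ` (fst (D, \<phi>) \<inter> U)) (?h l k \<circ> chart_inv (D, \<phi>))"
      using ch unfolding smooth_from_def by blast
    then have smh: "smooth_on (\<phi> ` (D \<inter> U)) (\<lambda>x. ?h l k (chart_inv (D, \<phi>) x))" by (simp add: o_def)
    let ?f = "\<lambda>x. ?h l k (chart_inv (D, \<phi>) x)"
    have "\<phi> (fst (p 0)) \<in> \<phi> ` (D \<inter> U)" using p0 unfolding frames_over_def by blast
    from smooth_on_has_derivative[OF smh this]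
    have Df: "(?f has_derivative fderiv ?f (\<phi> (fst (p 0)))) (at (\<phi> (fst (p 0))))" .
    have "((\<lambda>s. ?f (\<phi> (fst (p s)))) has_derivative (\<lambda>r. fderiv ?f (\<phi> (fst (p 0))) (r *\<^sub>R 0))) (at 0)"
      using diff_chain_at[OF Dx[unfolded x'0 has_vector_derivative_def] Df] by (simp add: o_def)
    moreover have "fderiv ?f (\<phi> (fst (p 0))) 0 = 0"
      using has_derivative_linear[OF Df] linear_0 by blast
    ultimately have "((\<lambda>s. ?f (\<phi> (fst (p s)))) has_vector_derivative 0) (at 0)"
      by (simp add: has_vector_derivative_def)
    moreover have "?f (\<phi> (fst (p s))) = ?h l k (fst (p s))" if "s \<in> ?T" for s
    proof -
      have "fst (p s) \<in> D" using that unfolding frames_over_def by blast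
      then show ?thesis using chart_inv_left[OF AM ch, of "fst (p s)"] by simp
    qed
    ultimately show ?thesis by (rule has_vector_derivative_transform_within_open[OF _ op 0])
  qed
  then have "(?G has_vector_derivative (\<chi> l k. 0)) (at 0)" by (rule has_vector_derivative_matrix)
  moreover have "(\<chi> l k. 0) = (0 :: 'n mat)" by (simp add: vec_eq_iff)
  ultimately have DG: "(?G has_vector_derivative 0) (at 0)" by simp
  have gram: "conj_transpose (?M s) ** ?G s ** ?M s = mat 1" if "s \<in> ?T" for s
    by (rule gram_identity[OF ch tr]) (use that in blast)
  \<comment> \<open>Differentiating the constant Gram expression at 0 leaves the two terms in which
    a frame matrix is differentiated.\<close>
  have "((\<lambda>s. conj_transpose (?M s) ** ?G s ** ?M s) has_vector_derivative
     conj_transpose (?M 0) ** ?G 0 ** M' + (conj_transpose (?M 0) ** 0 + conj_transpose M' ** ?G 0) ** ?M 0) (at 0)"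
    by (intro bounded_bilinear.has_vector_derivative[OF bounded_bilinear_matrix_mult] DM DG
        bounded_linear.has_vector_derivative[OF bounded_linear_conj_transpose])
  moreover have "((\<lambda>s. conj_transpose (?M s) ** ?G s ** ?M s) has_vector_derivative 0) (at 0)"
    by (rule has_vector_derivative_transform_within_open[OF has_vector_derivative_const op 0]) (simp add: gram)
  ultimately have "conj_transpose (?M 0) ** ?G 0 ** M' + (conj_transpose (?M 0) ** 0 + conj_transpose M' ** ?G 0) ** ?M 0 = 0"
    by (rule vector_derivative_unique_at)
  then have eq: "conj_transpose (?M 0) ** ?G 0 ** M' + conj_transpose M' ** (?G 0 ** ?M 0) = 0"
    by (simp add: matrix_mul_assoc)
  let ?I = "conj_transpose (?M 0) ** ?G 0"
  have IM: "?I ** ?M 0 = mat 1" using gram[OF 0] .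
  then have MI: "?M 0 ** ?I = mat 1" using matrix_left_right_inverse by blast
  \<comment> \<open>By the Gram identity \<open>?I\<close> inverts \<open>?M 0\<close>, so
    \<open>B\<close> is the logarithmic derivative of the frame matrix.\<close>
  define B where "B = ?I ** M'"
  have "?M 0 ** B = (?M 0 ** ?I) ** M'" unfolding B_def by (rule matrix_mul_assoc)
  then have MB: "?M 0 ** B = M'" by (simp only: MI matrix_mul_lid)
  \<comment> \<open>Both sides are right inverses of the adjoint of \<open>?M 0\<close>. This
    identifies the second summand in \<open>eq\<close> as the adjoint of \<open>B\<close>.\<close>
  have "conj_transpose ?I = ?G 0 ** ?M 0"
  proof (rule matrix_right_inverse_unique[of "conj_transpose (?M 0)"])
    show "conj_transpose (?M 0) ** conj_transpose ?I = mat 1"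
      unfolding conj_transpose_mult[symmetric] IM by (rule conj_transpose_mat_1)
    show "conj_transpose (?M 0) ** (?G 0 ** ?M 0) = mat 1" using IM by (simp add: matrix_mul_assoc)
  qed
  then have "conj_transpose B = conj_transpose M' ** (?G 0 ** ?M 0)"
    by (simp add: B_def conj_transpose_mult)
  then have "B + conj_transpose B = 0" using eq unfolding B_def by simp
  then have "conj_transpose B = - B" by (simp add: add_eq_0_iff)
  then have Bu: "B \<in> unitary_lie_algebra" by (simp add: unitary_lie_algebra_def)
  moreover have "velocity AP p 0 = velocity AP (\<lambda>s. frame_act E (p 0) (g s)) 0"
    if g: "smooth_on UNIV g" "range g \<subseteq> unitary_group" "g 0 = mat 1" "(g has_vector_derivative B) (at 0)" for g
  proof -
    let ?q = "\<lambda>s. frame_act E (p 0) (g s)"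
    have const: "smooth_into AP (UNIV :: real set) (\<lambda>s. p 0)"
      using smooth_into_compose[OF AP p coordinates_Basis smooth_on_const[of UNIV 0]] by simp
    have q: "smooth_into AP UNIV ?q" by (rule smooth_into_act[OF const g(1,2)]) simp
    have q\<Psi>: "(\<lambda>s. ?\<Psi> (?q s)) = (\<lambda>s. (fst (?\<Psi> (p 0)), ?M 0 ** g s))"
      using frame_coords_act[OF ch tr p0] by auto
    have "((\<lambda>s. ?M 0 ** g s) has_vector_derivative ?M 0 ** B) (at 0)"
      using bounded_bilinear.has_vector_derivative[OF bounded_bilinear_matrix_mult has_vector_derivative_const g(4)]
      by simp
    then have "((\<lambda>s. ?\<Psi> (?q s)) has_vector_derivative (0, M')) (at 0)"
      unfolding q\<Psi> MB by (intro has_vector_derivative_Pair has_vector_derivative_const)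
    then have "fderiv (\<lambda>s. ?\<Psi> (?q s)) 0 = (\<lambda>r. r *\<^sub>R (0, M'))"
      unfolding has_vector_derivative_def by (rule frechet_derivative_eqI)
    then have "partial_velocity AP p 0 1 = partial_velocity AP ?q 0 1"
      by (intro partial_velocity_frame_coords_eq[OF ch tr p q UNIV_I p0])
        (simp_all add: g(3) frame_act_one D\<Psi>0)
    then show ?thesis unfolding partial_velocity_curve[symmetric] by simp
  qed
  ultimately show ?thesis using that by blast
qed

end

section \<open>Connections and their curvature\<close>

text \<open>The family is affine in a chart, with the two coordinate vectors as its directions. It
  makes identities proved along families available for arbitrary pairs of tangent vectors.\<close>

lemma tangent_vectors_of_family:
  fixes A :: "('x, 'e::real_normed_vector) chart set"
  assumes A: "smooth_manifold A" and p: "p \<in> points A" and v: "v \<in> tangent_space A p" and w: "w \<in> tangent_space A p"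
  obtains S c where "open S" "(0, 0) \<in> S" "smooth_into A S (c :: real \<times> real \<Rightarrow> 'x)" "c (0, 0) = p"
    "partial_velocity A c (0, 0) (1, 0) = v" "partial_velocity A c (0, 0) (0, 1) = w"
proof -
  obtain B :: "'e set" and co where co: "coordinates B co" using smooth_manifold_coordinates[OF A] .
  obtain \<kappa> where \<kappa>: "\<kappa> \<in> A" "p \<in> fst \<kappa>" using pointsE[OF p] .
  let ?L = "\<lambda>z :: real \<times> real. fst z *\<^sub>R v \<kappa> + snd z *\<^sub>R w \<kappa>"
  let ?h = "\<lambda>z. snd \<kappa> p + ?L z"
  have L: "bounded_linear ?L"
    by (intro bounded_linear_add bounded_linear_scaleR_const bounded_linear_fst bounded_linear_snd)
  have h: "smooth_on UNIV ?h" by (rule smooth_on_affine[OF L])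
  define S where "S = ?h -` (snd \<kappa> ` fst \<kappa>)"
  define c where "c = (\<lambda>z. chart_inv \<kappa> (?h z))"
  have S: "open S"
    unfolding S_def by (rule open_vimage[OF open_chart_image[OF A \<kappa>(1)] smooth_on_continuous[OF h]])
  have 0: "(0, 0) \<in> S" using \<kappa>(2) by (simp add: S_def)
  have c: "smooth_into A S c" unfolding c_def
    by (rule smooth_into_compose[OF A smooth_into_chart_inv[OF A \<kappa>(1)] co smooth_on_subset[OF h] _ S])
      (auto simp: S_def)
  have c0: "c (0, 0) = p" using chart_inv_left[OF A \<kappa>] by (simp add: c_def)
  have chart: "snd \<kappa> (c z) = ?h z" if "z \<in> S" for z
  proof -
    have "?h z \<in> snd \<kappa> ` fst \<kappa>" using that by (simp add: S_def)
    then obtain x where x: "?h z = snd \<kappa> x" "x \<in> fst \<kappa>" by (rule imageE)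
    show ?thesis unfolding c_def x(1) chart_inv_left[OF A \<kappa>(1) x(2)] ..
  qed
  have "(?h has_derivative ?L) (at (0, 0))"
    by (rule has_derivative_eq_rhs[OF has_derivative_add[OF has_derivative_const bounded_linear_imp_has_derivative[OF L]]]) simp
  then have "((\<lambda>z. snd \<kappa> (c z)) has_derivative ?L) (at (0, 0))"
    by (rule has_derivative_transform_within_open[OF _ S 0]) (simp add: chart)
  then have D: "fderiv (\<lambda>z. snd \<kappa> (c z)) (0, 0) = ?L" by (rule frechet_derivative_eqI)
  have c0\<kappa>: "c (0, 0) \<in> fst \<kappa>" using c0 \<kappa>(2) by simp
  have vw: "v = coord_vec A \<kappa> p (v \<kappa>)" "w = coord_vec A \<kappa> p (w \<kappa>)"
    using v w \<kappa> unfolding tangent_space_def by blast+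
  have "partial_velocity A c (0, 0) (1, 0) = v" "partial_velocity A c (0, 0) (0, 1) = w"
    unfolding partial_velocity_eq_coord_vec[OF A c 0 \<kappa>(1) c0\<kappa>] D c0 using vw by simp_all
  then show ?thesis using that[OF S 0 c c0] by blast
qed

locale frame_connection = frame_bundle AM E AP
  for AM :: "('m, 'e::real_normed_vector) chart set"
    and E :: "('m, 'v::ab_group_add, 'n::finite) vbundle"
    and AP :: "(('m, 'v, 'n) frame, 'p::real_normed_vector) chart set" +
  fixes \<omega> :: "('m, 'v, 'n) frame \<Rightarrow> (('m, 'v, 'n) frame, 'p) tvec \<Rightarrow> 'n mat"
  assumes connection: "connection_form E AP \<omega>"
begin

lemma one_form: "smooth_one_form AP \<omega>"
  using connection unfolding connection_form_def by blast

lemma connection_fundamental: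
  assumes "p \<in> points AP" "smooth_on UNIV g" "range g \<subseteq> unitary_group" "g 0 = mat 1"
    and "(g has_vector_derivative B) (at 0)"
  shows "\<omega> p (velocity AP (\<lambda>t::real. frame_act E p (g t)) 0) = B"
proof -
  have "\<omega> p (velocity AP (\<lambda>t::real. frame_act E p (g t)) 0) = vector_derivative g (at 0)"
    using connection assms(1-4) unfolding connection_form_def by blast
  then show ?thesis using vector_derivative_at[OF assms(5)] by simp
qed

lemma connection_Ad:
  assumes "p \<in> points AP" "v \<in> tangent_space AP p" "g \<in> unitary_group"
  shows "\<omega> (frame_act E p g) (tangent_map AP AP (\<lambda>q. frame_act E q g) p v) = conj_transpose g ** \<omega> p v ** g"
proof -
  have "\<omega> (frame_act E p g) (tangent_map AP AP (\<lambda>q. frame_act E q g) p v) = matrix_inv g ** \<omega> p v ** g"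
    using connection assms unfolding connection_form_def by blast
  then show ?thesis by (simp only: matrix_inv_unitary[OF assms(3)])
qed

section \<open>Equivariance of the connection and of its curvature\<close>

lemma smooth_into_act_const:
  assumes "smooth_into AP S c" "open S" "g \<in> unitary_group"
  shows "smooth_into AP S (\<lambda>z. frame_act E (c z) g)"
  by (rule smooth_into_act[OF assms(1) smooth_on_const _ assms(2)]) (use assms(3) in auto)

text \<open>The chain rule in the chart chosen by \<open>tangent_map\<close> replaces the
  differential of a translation by the velocity of the translated family, where the choice is
  gone.\<close>

lemma tangent_map_act:
  assumes c: "smooth_into AP S c" and S: "open S" and z: "z \<in> S" and g: "g \<in> unitary_group"
  shows "tangent_map AP AP (\<lambda>q. frame_act E q g) (c z) (partial_velocity AP c z e)
    = partial_velocity AP (\<lambda>z. frame_act E (c z) g) z e"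
proof
  fix \<kappa>'
  let ?R = "\<lambda>q. frame_act E q g"
  note Rc = smooth_into_act_const[OF c S g]
  show "tangent_map AP AP ?R (c z) (partial_velocity AP c z e) \<kappa>' = partial_velocity AP (\<lambda>z. ?R (c z)) z e \<kappa>'"
  proof (cases "\<kappa>' \<in> AP \<and> ?R (c z) \<in> fst \<kappa>'")
    case False
    then show ?thesis by (auto simp: tangent_map_def partial_velocity_def velocity_def)
  next
    case True
    then have \<kappa>': "\<kappa>' \<in> AP" "?R (c z) \<in> fst \<kappa>'" by auto
    define \<kappa> where "\<kappa> = chart_at AP (c z)"
    note \<kappa> = chart_at_props[OF smooth_into_points[OF c z], folded \<kappa>_def]
    let ?C = "\<lambda>z. snd \<kappa> (c z)"
    let ?h = "\<lambda>x. ?R (chart_inv \<kappa> x)"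
    have h: "smooth_into AP (snd \<kappa> ` fst \<kappa>) ?h"
      by (rule smooth_into_act_const[OF smooth_into_chart_inv[OF AP \<kappa>(1)] open_chart_image[OF AP \<kappa>(1)] g])
    have x: "?C z \<in> {x \<in> snd \<kappa> ` fst \<kappa>. ?h x \<in> fst \<kappa>'}"
      using \<kappa> \<kappa>' chart_inv_left[OF AP \<kappa>] by simp
    have zU: "z \<in> {y\<in>S. c y \<in> fst \<kappa>}" using z \<kappa>(2) by simp
    have "((\<lambda>y. snd \<kappa>' (?h (?C y))) has_derivative
        (\<lambda>e. fderiv (\<lambda>x. snd \<kappa>' (?h x)) (?C z) (fderiv ?C z e))) (at z)"
      using diff_chain_at[OF smooth_on_has_derivative[OF smooth_into_chart[OF c \<kappa>(1)] zU]
          smooth_on_has_derivative[OF smooth_into_chart[OF h \<kappa>'(1)] x]] unfolding o_def .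
    then have "((\<lambda>y. snd \<kappa>' (?R (c y))) has_derivative
        (\<lambda>e. fderiv (\<lambda>x. snd \<kappa>' (?h x)) (?C z) (fderiv ?C z e))) (at z)"
      by (rule has_derivative_transform_within_open[OF _ smooth_into_open[OF c \<kappa>(1)] zU])
        (simp add: chart_inv_left[OF AP \<kappa>(1)])
    from frechet_derivative_eqI[OF this]
    have "partial_velocity AP (\<lambda>z. ?R (c z)) z e \<kappa>'
        = fderiv (\<lambda>x. snd \<kappa>' (?h x)) (?C z) (fderiv ?C z e)"
      using partial_velocity_chart[OF AP Rc z \<kappa>', of e] by simp
    then show ?thesis
      using \<kappa>' partial_velocity_chart[OF AP c z \<kappa>, of e]
      unfolding tangent_map_def \<kappa>_def[symmetric] by (simp add: o_def)
  qed
qed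

text \<open>The equivariance axiom along a family: it holds at every parameter and can therefore be
  differentiated.\<close>

lemma connection_act:
  assumes c: "smooth_into AP S c" and S: "open S" and z: "z \<in> S" and g: "g \<in> unitary_group"
  shows "\<omega> (frame_act E (c z) g) (partial_velocity AP (\<lambda>z. frame_act E (c z) g) z e)
    = conj_transpose g ** \<omega> (c z) (partial_velocity AP c z e) ** g"
  using connection_Ad[OF smooth_into_points[OF c z] partial_velocity_tangent[OF AP c z] g]
  unfolding tangent_map_act[OF c S z g] .

lemma bounded_linear_conjugate: "bounded_linear (\<lambda>X. conj_transpose g ** X ** g)" for g :: "'n mat"
  by (intro bounded_linear_compose[OF bounded_bilinear.bounded_linear_left[OF bounded_bilinear_matrix_mult]]
      bounded_bilinear.bounded_linear_right[OF bounded_bilinear_matrix_mult])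

text \<open>Conjugation is a fixed linear map, so it passes through the partial derivatives that
  express the exterior derivative along a family; in the commutator the inner factors of
  \<open>g\<close> and its adjoint cancel.\<close>

lemma curvature_act:
  assumes p: "p \<in> points AP" and v: "v \<in> tangent_space AP p" and w: "w \<in> tangent_space AP p"
    and g: "g \<in> unitary_group"
  shows "curvature AP \<omega> (frame_act E p g) (tangent_map AP AP (\<lambda>q. frame_act E q g) p v)
      (tangent_map AP AP (\<lambda>q. frame_act E q g) p w) = conj_transpose g ** curvature AP \<omega> p v w ** g"
proof -
  obtain S c where S: "open S" and 0: "(0, 0) \<in> S" and c: "smooth_into AP S (c :: real \<times> real \<Rightarrow> _)" "c (0, 0) = p"
    "partial_velocity AP c (0, 0) (1, 0) = v" "partial_velocity AP c (0, 0) (0, 1) = w"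
    using tangent_vectors_of_family[OF AP p v w] .
  let ?Rc = "\<lambda>z. frame_act E (c z) g"
  let ?Ad = "\<lambda>X. conj_transpose g ** X ** g"
  note Rc = smooth_into_act_const[OF c(1) S g]
  have D: "fderiv (form_along AP \<omega> ?Rc e) (0, 0) d
      = ?Ad (fderiv (form_along AP \<omega> c e) (0, 0) d)" for d e
  proof -
    have "((\<lambda>z. ?Ad (\<omega> (c z) (partial_velocity AP c z e))) has_derivative
        (\<lambda>d. ?Ad (fderiv (form_along AP \<omega> c e) (0, 0) d))) (at (0, 0))"
      by (rule bounded_linear.has_derivative[OF bounded_linear_conjugate
            smooth_on_has_derivative[OF one_form_along_smooth[OF AP one_form c(1)] 0]])
    then have "((form_along AP \<omega> ?Rc e) has_derivative
        (\<lambda>d. ?Ad (fderiv (form_along AP \<omega> c e) (0, 0) d))) (at (0, 0))"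
      by (rule has_derivative_transform_within_open[OF _ S 0]) (simp only: connection_act[OF c(1) S _ g])
    from frechet_derivative_eqI[OF this] show ?thesis by (rule fun_cong)
  qed
  have gg: "g ** conj_transpose g = mat 1" by (rule unitary_right[OF g])
  have Ad_mult: "?Ad X ** ?Ad Y = ?Ad (X ** Y)" for X Y
  proof -
    have "?Ad X ** ?Ad Y = conj_transpose g ** X ** (g ** conj_transpose g) ** Y ** g"
      by (simp only: matrix_mul_assoc)
    then show ?thesis by (simp only: gg matrix_mul_rid matrix_mul_assoc)
  qed
  note lin = bounded_linear.linear[OF bounded_linear_conjugate[of g]]
  have "tangent_map AP AP (\<lambda>q. frame_act E q g) p v = partial_velocity AP ?Rc (0, 0) (1, 0)"
    "tangent_map AP AP (\<lambda>q. frame_act E q g) p w = partial_velocity AP ?Rc (0, 0) (0, 1)"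
    using tangent_map_act[OF c(1) S 0 g] unfolding c(2) c(3,4)[symmetric] by simp_all
  moreover have "curvature AP \<omega> (?Rc (0, 0)) (partial_velocity AP ?Rc (0, 0) (1, 0)) (partial_velocity AP ?Rc (0, 0) (0, 1))
    = ?Ad (curvature AP \<omega> (c (0, 0)) (partial_velocity AP c (0, 0) (1, 0)) (partial_velocity AP c (0, 0) (0, 1)))"
    unfolding curvature_def ext_deriv_pullback[OF AP one_form Rc 0] ext_deriv_pullback[OF AP one_form c(1) 0]
      D connection_act[OF c(1) S 0 g] Ad_mult
    by (simp only: linear_add[OF lin] linear_diff[OF lin])
  ultimately show ?thesis unfolding c(2) c(3) c(4) by simp
qed

text \<open>For the two-parameter family \<open>c(s, t) = \<gamma>(t) g(s)\<close> one has \<open>\<omega>(\<partial>\<^sub>s c) = g'(0)\<close> along \<open>s = 0\<close> and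
  \<open>\<omega>(\<partial>\<^sub>t c) = g(s)\<^sup>* \<omega>(\<gamma>'(0)) g(s)\<close> along \<open>t = 0\<close>, so \<open>d\<omega>\<close> cancels the commutator.\<close>

lemma curvature_vertical:
  assumes \<gamma>: "smooth_into AP UNIV \<gamma>" and B: "B \<in> unitary_lie_algebra"
    and g: "smooth_on UNIV g" "range g \<subseteq> unitary_group" "g 0 = mat 1" "(g has_vector_derivative B) (at 0)"
  shows "curvature AP \<omega> (\<gamma> 0) (velocity AP (\<lambda>s::real. frame_act E (\<gamma> 0) (g s)) 0) (velocity AP \<gamma> 0) = 0"
proof -
  let ?c = "\<lambda>z :: real \<times> real. frame_act E (\<gamma> (snd z)) (g (fst z))"
  have \<gamma>2: "smooth_into AP UNIV (\<lambda>z :: real \<times> real. \<gamma> (snd z))"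
    by (rule smooth_into_compose[OF AP \<gamma> coordinates_Basis smooth_on_bounded_linear[OF bounded_linear_snd]]) auto
  have g2: "smooth_on UNIV (\<lambda>z :: real \<times> real. g (fst z))"
    by (rule smooth_on_compose[OF coordinates_Basis g(1) smooth_on_bounded_linear[OF bounded_linear_fst]]) auto
  have c: "smooth_into AP UNIV ?c"
    by (rule smooth_into_act[OF \<gamma>2 g2]) (use g(2) in auto)
  have pP: "\<gamma> t \<in> points AP" for t by (rule smooth_into_points[OF \<gamma> UNIV_I])
  \<comment> \<open>The exterior derivative differentiates the \<open>s\<close>-component in
    \<open>t\<close> and the \<open>t\<close>-component in \<open>s\<close>, so the values on the
    two axes determine it.\<close>
  have vs: "partial_velocity AP ?c (0, t) (1, 0) = velocity AP (\<lambda>s. frame_act E (\<gamma> t) (g s)) 0" for t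
    by (simp add: partial_velocity_def)
  have vt: "partial_velocity AP ?c (s, 0) (0, 1) = partial_velocity AP (\<lambda>t. frame_act E (\<gamma> t) (g s)) 0 1" for s
    by (simp add: partial_velocity_def)
  let ?W = "\<omega> (\<gamma> 0) (velocity AP \<gamma> 0)"
  have v0: "velocity AP \<gamma> 0 = partial_velocity AP \<gamma> 0 1" by (simp add: partial_velocity_def)
  let ?\<omega>s = "\<lambda>z. \<omega> (?c z) (partial_velocity AP ?c z (1, 0))"
  let ?\<omega>t = "\<lambda>z. \<omega> (?c z) (partial_velocity AP ?c z (0, 1))"
  have c0: "?c (0, t) = \<gamma> t" for t by (simp add: g(3) frame_act_one)
  have \<omega>s: "?\<omega>s (0, t) = B" for t
    unfolding vs c0 by (rule connection_fundamental[OF pP g])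
  have gu: "g s \<in> unitary_group" for s using g(2) by blast
  have \<omega>t: "?\<omega>t (s, 0) = conj_transpose (g s) ** ?W ** g s" for s
    using connection_act[OF \<gamma> open_UNIV UNIV_I gu, of 0 s 1] unfolding vt v0 by simp
  have diff: "((form_along AP \<omega> ?c e) has_derivative
      fderiv (form_along AP \<omega> ?c e) (0, 0)) (at (0, 0))" for e
    by (rule smooth_on_has_derivative[OF one_form_along_smooth[OF AP one_form c] UNIV_I])
  have ds: "fderiv ?\<omega>s (0, 0) (0, 1) = 0"
  proof -
    have "((\<lambda>t. (0 :: real, t)) has_derivative (\<lambda>t. (0, t))) (at (0 :: real))"
      by (intro has_derivative_Pair has_derivative_const has_derivative_ident)
    from diff_chain_at[OF this diff[of "(1, 0)"]]
    have "((\<lambda>t. ?\<omega>s (0, t)) has_derivative (\<lambda>t. fderiv ?\<omega>s (0, 0) (0, t))) (at 0)"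
      unfolding o_def .
    then have "((\<lambda>t :: real. B) has_vector_derivative fderiv ?\<omega>s (0, 0) (0, 1)) (at 0)"
      unfolding \<omega>s by (rule has_derivative_has_vector_derivative)
    then show ?thesis by (rule vector_derivative_unique_at) (rule has_vector_derivative_const)
  qed
  have dt: "fderiv ?\<omega>t (0, 0) (1, 0) = ?W ** B - B ** ?W"
  proof -
    have "((\<lambda>s. (s, 0 :: real)) has_derivative (\<lambda>s. (s, 0))) (at (0 :: real))"
      by (intro has_derivative_Pair has_derivative_const has_derivative_ident)
    from diff_chain_at[OF this diff[of "(0, 1)"]]
    have "((\<lambda>s. ?\<omega>t (s, 0)) has_derivative (\<lambda>s. fderiv ?\<omega>t (0, 0) (s, 0))) (at 0)"
      unfolding o_def .
    then have 1: "((\<lambda>s. conj_transpose (g s) ** ?W ** g s) has_vector_derivative fderiv ?\<omega>t (0, 0) (1, 0)) (at 0)"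
      unfolding \<omega>t by (rule has_derivative_has_vector_derivative)
    have 2: "((\<lambda>s. conj_transpose (g s) ** ?W ** g s) has_vector_derivative
        conj_transpose (g 0) ** ?W ** B + (conj_transpose (g 0) ** 0 + conj_transpose B ** ?W) ** g 0) (at 0)"
      by (intro bounded_bilinear.has_vector_derivative[OF bounded_bilinear_matrix_mult] g(4)
          bounded_linear.has_vector_derivative[OF bounded_linear_conj_transpose] has_vector_derivative_const)
    have "conj_transpose B = - B" using B by (simp add: unitary_lie_algebra_def)
    then have "conj_transpose (g 0) ** ?W ** B + (conj_transpose (g 0) ** 0 + conj_transpose B ** ?W) ** g 0
        = ?W ** B - B ** ?W"
      by (simp add: g(3) conj_transpose_mat_1 matrix_minus_left)
    then show ?thesis using vector_derivative_unique_at[OF 1 2] by simp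
  qed
  have "curvature AP \<omega> (?c (0, 0)) (partial_velocity AP ?c (0, 0) (1, 0)) (partial_velocity AP ?c (0, 0) (0, 1)) = 0"
    unfolding curvature_def ext_deriv_pullback[OF AP one_form c UNIV_I] ds dt \<omega>s \<omega>t
    by (simp add: g(3) conj_transpose_mat_1)
  then show ?thesis unfolding vs vt c0 v0 by (simp add: g(3) frame_act_one)
qed

text \<open>A vertical velocity is replaced by that of an orbit of a unitary curve, supplied by the
  Cayley transform; the curve \<gamma> only has to represent the other tangent vector.\<close>

lemma curvature_vertical_velocity:
  assumes p: "smooth_into AP UNIV p" and vel: "velocity AM (\<lambda>s::real. fst (p s)) 0 = (\<lambda>\<kappa>. 0)"
    and \<gamma>: "smooth_into AP UNIV \<gamma>" and eq: "\<gamma> 0 = p 0"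
  shows "curvature AP \<omega> (p 0) (velocity AP p 0) (velocity AP \<gamma> 0) = 0"
proof -
  obtain B where B: "B \<in> unitary_lie_algebra"
    "\<forall>g. smooth_on UNIV g \<and> range g \<subseteq> unitary_group \<and> g 0 = mat 1 \<and> (g has_vector_derivative B) (at 0) \<longrightarrow>
      velocity AP p 0 = velocity AP (\<lambda>s. frame_act E (p 0) (g s)) 0"
    using vertical_velocity[OF p vel] .
  obtain g where g: "smooth_on UNIV g" "range g \<subseteq> unitary_group" "g 0 = mat 1" "(g has_vector_derivative B) (at (0::real))"
    using unitary_curve_exists[OF B(1)] .
  have "velocity AP p 0 = velocity AP (\<lambda>s. frame_act E (p 0) (g s)) 0" using B(2) g by blast
  then show ?thesis using curvature_vertical[OF \<gamma> B(1) g] eq by simp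
qed

text \<open>The translated curve is the diagonal of the family p(s) a(t). Its first partial velocity
  is a translate and contributes the conjugate; the second is a fundamental vector and contributes
  the logarithmic derivative of \<open>a\<close>.\<close>

lemma connection_product:
  assumes p: "smooth_into AP UNIV p" and a: "smooth_on UNIV a" "range a \<subseteq> unitary_group"
    and a': "(a has_vector_derivative a') (at \<theta>)"
  shows "\<omega> (frame_act E (p \<theta>) (a \<theta>)) (velocity AP (\<lambda>t::real. frame_act E (p (\<theta> + t)) (a (\<theta> + t))) 0)
    = conj_transpose (a \<theta>) ** \<omega> (p \<theta>) (velocity AP (\<lambda>t. p (\<theta> + t)) 0) ** a \<theta> + conj_transpose (a \<theta>) ** a'"
proof -
  let ?c = "\<lambda>z :: real \<times> real. frame_act E (p (fst z)) (a (snd z))"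
  have p2: "smooth_into AP UNIV (\<lambda>z :: real \<times> real. p (fst z))"
    by (rule smooth_into_compose[OF AP p coordinates_Basis smooth_on_bounded_linear[OF bounded_linear_fst]]) auto
  have a2: "smooth_on UNIV (\<lambda>z :: real \<times> real. a (snd z))"
    by (rule smooth_on_compose[OF coordinates_Basis a(1) smooth_on_bounded_linear[OF bounded_linear_snd]]) auto
  have c: "smooth_into AP UNIV ?c"
    by (rule smooth_into_act[OF p2 a2]) (use a(2) in auto)
  have pP: "p t \<in> points AP" for t by (rule smooth_into_points[OF p UNIV_I])
  have au: "a t \<in> unitary_group" for t using a(2) by blast
  have diag: "velocity AP (\<lambda>t. frame_act E (p (\<theta> + t)) (a (\<theta> + t))) 0 = partial_velocity AP ?c (\<theta>, \<theta>) ((1, 0) + (0, 1))"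
    by (simp add: partial_velocity_def)
  have "partial_velocity AP ?c (\<theta>, \<theta>) (1, 0) = partial_velocity AP (\<lambda>z. frame_act E (p z) (a \<theta>)) \<theta> 1"
    by (simp add: partial_velocity_def)
  then have 1: "\<omega> (?c (\<theta>, \<theta>)) (partial_velocity AP ?c (\<theta>, \<theta>) (1, 0))
      = conj_transpose (a \<theta>) ** \<omega> (p \<theta>) (velocity AP (\<lambda>t. p (\<theta> + t)) 0) ** a \<theta>"
    using connection_act[OF p open_UNIV UNIV_I au, of \<theta> \<theta> 1] by (simp add: partial_velocity_def)
  \<comment> \<open>Recentred to start at the identity, so that translating
    \<open>p \<theta>\<close> by a(\<theta> + t) amounts to acting by \<open>?g t\<close> on the
    frame already translated by \<open>a \<theta>\<close>.\<close>
  let ?g = "\<lambda>t. conj_transpose (a \<theta>) ** a (\<theta> + t)"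
  have blc: "bounded_linear (\<lambda>X :: 'n mat. conj_transpose (a \<theta>) ** X)"
    by (rule bounded_bilinear.bounded_linear_right[OF bounded_bilinear_matrix_mult])
  have "smooth_on UNIV (\<lambda>t. a (\<theta> + t))"
    by (rule smooth_on_compose[OF coordinates_Basis a(1) smooth_on_affine[OF bounded_linear_ident]]) auto
  then have g1: "smooth_on UNIV ?g" by (rule smooth_on_bounded_linear_comp[OF blc]) simp
  have g2: "range ?g \<subseteq> unitary_group" using unitary_mult[OF unitary_conj_transpose[OF au] au] by blast
  have g3: "?g 0 = mat 1" using unitary_left[OF au] by simp
  have "((\<lambda>t. a (\<theta> + t)) has_vector_derivative a') (at 0)"
  proof -
    have "((\<lambda>t. \<theta> + t) has_derivative (\<lambda>t. t)) (at 0)" by (auto intro!: derivative_eq_intros)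
    from diff_chain_at[OF this, of a] a' show ?thesis by (simp add: has_vector_derivative_def o_def)
  qed
  then have g4: "(?g has_vector_derivative conj_transpose (a \<theta>) ** a') (at 0)"
    by (rule bounded_linear.has_vector_derivative[OF blc])
  have "frame_act E (frame_act E (p \<theta>) (a \<theta>)) (?g t) = frame_act E (p \<theta>) (a (\<theta> + t))" for t
    unfolding frame_act_assoc by (simp add: matrix_mul_assoc unitary_right[OF au])
  then have "partial_velocity AP ?c (\<theta>, \<theta>) (0, 1) = velocity AP (\<lambda>t. frame_act E (frame_act E (p \<theta>) (a \<theta>)) (?g t)) 0"
    by (simp add: partial_velocity_def)
  then have 2: "\<omega> (?c (\<theta>, \<theta>)) (partial_velocity AP ?c (\<theta>, \<theta>) (0, 1)) = conj_transpose (a \<theta>) ** a'"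
    using connection_fundamental[OF frame_act_points[OF pP au] g1 g2 g3 g4] by simp
  show ?thesis
    using linear_add[OF one_form_partial_velocity_linear[OF AP one_form c UNIV_I, of "(\<theta>, \<theta>)"], of "(1, 0)" "(0, 1)"]
    unfolding diag 1 2 by simp
qed

end

section \<open>Loop spaces\<close>

lemma nth_derivative_0: "nth_derivative 0 f = f"
  by (simp add: nth_derivative_def)

lemma nth_derivative_Suc: "nth_derivative (Suc i) f t = vector_derivative (nth_derivative i f) (at t)"
  by (simp add: nth_derivative_def)

text \<open>The iterated derivatives along slices are restrictions of iterated partial derivatives,
  hence jointly continuous in the curve parameter and the loop parameter.\<close>

lemma nth_derivative_smooth:
  fixes F :: "real \<times> real \<Rightarrow> 'e::real_normed_vector"
  assumes "open S" "smooth_on S F"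
  shows "\<exists>G. smooth_on S G \<and> (\<forall>s t. (s, t) \<in> S \<longrightarrow> nth_derivative i (\<lambda>t. F (s, t)) t = G (s, t))"
proof (induction i)
  case 0
  then show ?case using assms(2) by (auto simp: nth_derivative_0)
next
  case (Suc i)
  then obtain G where G: "smooth_on S G" "\<forall>s t. (s, t) \<in> S \<longrightarrow> nth_derivative i (\<lambda>t. F (s, t)) t = G (s, t)"
    by blast
  let ?G = "\<lambda>z. fderiv G z (0, 1)"
  have "nth_derivative (Suc i) (\<lambda>t. F (s, t)) t = ?G (s, t)" if st: "(s, t) \<in> S" for s t
  proof -
    have "((\<lambda>t. (s, t)) has_derivative (\<lambda>r. (0, r))) (at t)"
      by (intro has_derivative_Pair has_derivative_const has_derivative_ident)
    from diff_chain_at[OF this smooth_on_has_derivative[OF G(1) st]]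
    have "((\<lambda>t. G (s, t)) has_derivative (\<lambda>r. fderiv G (s, t) (0, r))) (at t)"
      unfolding o_def .
    then have D: "((\<lambda>t. G (s, t)) has_vector_derivative ?G (s, t)) (at t)"
      by (rule has_derivative_has_vector_derivative)
    have op: "open {t. (s, t) \<in> S}"
      using open_vimage[OF assms(1), of "\<lambda>t. (s, t)"] by (simp add: vimage_def continuous_on_Pair)
    have "(nth_derivative i (\<lambda>t. F (s, t)) has_vector_derivative ?G (s, t)) (at t)"
      by (rule has_vector_derivative_transform_within_open[OF D op]) (use st G(2) in auto)
    then show ?thesis unfolding nth_derivative_Suc by (rule vector_derivative_at)
  qed
  then show ?case using smooth_on_deriv[OF G(1)] by blast
qed

lemma loop_curves_smooth: "c \<in> loop_curves A \<Longrightarrow> smooth_into A UNIV (\<lambda>z. c (fst z) (snd z))"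
  unfolding loop_curves_def by (simp add: case_prod_beta')

lemma loop_curves_loops: "c \<in> loop_curves A \<Longrightarrow> c s \<in> loops A"
  unfolding loop_curves_def by blast

lemma loop_smooth: "\<gamma> \<in> loops A \<Longrightarrow> smooth_into A UNIV \<gamma>"
  unfolding loops_def by blast

lemma smooth_into_loop_evaluation:
  assumes A: "smooth_manifold A" and c: "c \<in> loop_curves A"
  shows "smooth_into A UNIV (\<lambda>s. c s \<theta>)"
proof -
  have "smooth_on UNIV (\<lambda>s :: real. (s, \<theta>))"
    by (intro smooth_on_Pair smooth_on_const smooth_on_bounded_linear bounded_linear_ident) auto
  from smooth_into_compose[OF A loop_curves_smooth[OF c] coordinates_Basis this]
  show ?thesis by simp
qed

text \<open>The conditions at one loop parameter define an open set \<open>Q\<close> of pairs, by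
  joint smoothness; since the loop parameters run over a compact interval, the tube lemma turns this
  into openness in \<open>s\<close>.\<close>

lemma loop_curves_open_basic:
  assumes A: "smooth_manifold A" and c: "c \<in> loop_curves A" and \<gamma>: "\<gamma> \<in> loops A" and \<kappa>: "(D, \<phi>) \<in> A"
  shows "open {s. c s ` {a..b} \<subseteq> D \<and> (\<forall>i\<le>k. \<forall>t\<in>{a..b}.
          dist (nth_derivative i (\<phi> \<circ> c s) t) (nth_derivative i (\<phi> \<circ> \<gamma>) t) < \<epsilon>) \<and> \<gamma> ` {a..b} \<subseteq> D}"
    (is "open ?T")
proof -
  have \<gamma>2: "smooth_into A UNIV (\<lambda>z :: real \<times> real. \<gamma> (snd z))"
    by (rule smooth_into_compose[OF A loop_smooth[OF \<gamma>] coordinates_Basis smooth_on_bounded_linear[OF bounded_linear_snd]]) auto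
  let ?Oc = "{z\<in>UNIV. c (fst z) (snd z) \<in> fst (D, \<phi>)}"
  let ?Og = "{z\<in>UNIV :: (real \<times> real) set. \<gamma> (snd z) \<in> fst (D, \<phi>)}"
  let ?F = "\<lambda>z. snd (D, \<phi>) (c (fst z) (snd z))"
  let ?G = "\<lambda>z :: real \<times> real. snd (D, \<phi>) (\<gamma> (snd z))"
  note oc = smooth_into_open[OF loop_curves_smooth[OF c] \<kappa>] and sc = smooth_into_chart[OF loop_curves_smooth[OF c] \<kappa>]
  note og = smooth_into_open[OF \<gamma>2 \<kappa>] and sg = smooth_into_chart[OF \<gamma>2 \<kappa>]
  have "\<exists>H. \<forall>i. smooth_on ?Oc (H i) \<and> (\<forall>s t. (s, t) \<in> ?Oc \<longrightarrow> nth_derivative i (\<lambda>t. ?F (s, t)) t = H i (s, t))"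
    by (rule choice, rule allI, rule nth_derivative_smooth[OF oc sc])
  then obtain H where H: "\<forall>i. smooth_on ?Oc (H i) \<and> (\<forall>s t. (s, t) \<in> ?Oc \<longrightarrow> nth_derivative i (\<lambda>t. ?F (s, t)) t = H i (s, t))" ..
  have "\<exists>K. \<forall>i. smooth_on ?Og (K i) \<and> (\<forall>s t. (s, t) \<in> ?Og \<longrightarrow> nth_derivative i (\<lambda>t. ?G (s, t)) t = K i (s, t))"
    by (rule choice, rule allI, rule nth_derivative_smooth[OF og sg])
  then obtain K where K: "\<forall>i. smooth_on ?Og (K i) \<and> (\<forall>s t. (s, t) \<in> ?Og \<longrightarrow> nth_derivative i (\<lambda>t. ?G (s, t)) t = K i (s, t))" ..
  have H1: "smooth_on ?Oc (H i)" and K1: "smooth_on ?Og (K i)" for i using H K by blast+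
  have H2: "nth_derivative i (\<lambda>t. ?F (s, t)) t = H i (s, t)" if "(s, t) \<in> ?Oc" for i s t
    using H that by blast
  have K2: "nth_derivative i (\<lambda>t. ?G (s, t)) t = K i (s, t)" if "(s, t) \<in> ?Og" for i s t
    using K that by blast
  let ?O = "?Oc \<inter> ?Og"
  have oO: "open ?O" using oc og by blast
  define Q where "Q = (\<Inter>i\<in>{..k}. ?O \<inter> (\<lambda>z. dist (H i z) (K i z)) -` {..<\<epsilon>})"
  have "open Q" unfolding Q_def
  proof (rule open_INT)
    show "\<forall>i\<in>{..k}. open (?O \<inter> (\<lambda>z. dist (H i z) (K i z)) -` {..<\<epsilon>})"
    proof
      fix i
      have "continuous_on ?O (\<lambda>z. dist (H i z) (K i z))"
        by (intro continuous_on_dist continuous_on_subset[OF smooth_on_continuous[OF H1]]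
            continuous_on_subset[OF smooth_on_continuous[OF K1]]) auto
      then show "open (?O \<inter> (\<lambda>z. dist (H i z) (K i z)) -` {..<\<epsilon>})"
        by (rule continuous_open_preimage[OF _ oO]) simp
    qed
  qed simp
  have T: "s \<in> ?T \<longleftrightarrow> {s} \<times> {a..b} \<subseteq> Q" for s
  proof -
    have 1: "\<phi> \<circ> c s = (\<lambda>t. ?F (s, t))" "\<phi> \<circ> \<gamma> = (\<lambda>t. ?G (s, t))" by (simp_all add: fun_eq_iff)
    have "(s, t) \<in> Q \<longleftrightarrow> c s t \<in> D \<and> \<gamma> t \<in> D \<and> (\<forall>i\<le>k. dist (nth_derivative i (\<phi> \<circ> c s) t) (nth_derivative i (\<phi> \<circ> \<gamma>) t) < \<epsilon>)" for t
    proof (cases "c s t \<in> D \<and> \<gamma> t \<in> D")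
      case True
      then have "(s, t) \<in> ?Oc" "(s, t) \<in> ?Og" by auto
      then show ?thesis unfolding 1 H2[OF \<open>(s, t) \<in> ?Oc\<close>] K2[OF \<open>(s, t) \<in> ?Og\<close>] Q_def using True by auto
    next
      case False
      then show ?thesis unfolding Q_def by auto
    qed
    moreover have "{s} \<times> {a..b} \<subseteq> Q \<longleftrightarrow> (\<forall>t\<in>{a..b}. (s, t) \<in> Q)" by blast
    ultimately show ?thesis unfolding mem_Collect_eq image_subset_iff by blast
  qed
  show ?thesis
  proof (rule topological_space_class.openI)
    fix s assume "s \<in> ?T"
    then have "{s} \<times> {a..b} \<subseteq> Q" using T by blast
    from Elementary_Topology.tube_lemma[OF compact_Icc \<open>open Q\<close> this]
    obtain X where X: "s \<in> X" "open X" "X \<times> {a..b} \<subseteq> Q" by blast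
    have "X \<subseteq> ?T"
    proof
      fix y assume "y \<in> X"
      then have "{y} \<times> {a..b} \<subseteq> Q" using X(3) by blast
      then show "y \<in> ?T" using T by blast
    qed
    then show "\<exists>X. open X \<and> s \<in> X \<and> X \<subseteq> ?T" using X by blast
  qed
qed

text \<open>Smooth curves are continuous for the loop topology. This makes the parameter sets over
  bundle charts open, as the calculus of \<open>smooth_on\<close> requires.\<close>

lemma loop_curves_open:
  assumes A: "smooth_manifold A" and c: "c \<in> loop_curves A" and V: "openin (loop_topology A) V"
  shows "open {s. c s \<in> V}"
  using V unfolding loop_topology_def openin_topology_generated_by_iff
proof (induction rule: generate_topology_on.induct)
  case Empty
  then show ?case by simp
next
  case (Int a b)
  have "{s. c s \<in> a \<inter> b} = {s. c s \<in> a} \<inter> {s. c s \<in> b}" by auto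
  then show ?case using Int by auto
next
  case (UN K)
  have "{s. c s \<in> \<Union>K} = (\<Union>k\<in>K. {s. c s \<in> k})" by auto
  then show ?case using UN by auto
next
  case (Basis U)
  then obtain \<gamma> D \<phi> a b k \<epsilon> where U: "U = {\<eta> \<in> loops A. \<eta> ` {a..b} \<subseteq> D \<and> (\<forall>i\<le>k. \<forall>t\<in>{a..b}.
          dist (nth_derivative i (\<phi> \<circ> \<eta>) t) (nth_derivative i (\<phi> \<circ> \<gamma>) t) < \<epsilon>)}"
    and \<gamma>: "\<gamma> \<in> loops A" and \<kappa>: "(D, \<phi>) \<in> A" and D: "\<gamma> ` {a..b} \<subseteq> D"
    by blast
  have "{s. c s \<in> U} = {s. c s ` {a..b} \<subseteq> D \<and> (\<forall>i\<le>k. \<forall>t\<in>{a..b}.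
          dist (nth_derivative i (\<phi> \<circ> c s) t) (nth_derivative i (\<phi> \<circ> \<gamma>) t) < \<epsilon>) \<and> \<gamma> ` {a..b} \<subseteq> D}"
    using D loop_curves_loops[OF c] unfolding U by auto
  then show ?case using loop_curves_open_basic[OF A c \<gamma> \<kappa>] by simp
qed

lemma openin_loop_basic:
  assumes "\<gamma> \<in> loops A" "(D, \<phi>) \<in> A" "a \<le> b" "\<gamma> ` {a..b} \<subseteq> D" "\<epsilon> > 0"
  shows "openin (loop_topology A) {\<eta> \<in> loops A. \<eta> ` {a..b} \<subseteq> D \<and> (\<forall>i\<le>k. \<forall>t\<in>{a..b}.
          dist (nth_derivative i (\<phi> \<circ> \<eta>) t) (nth_derivative i (\<phi> \<circ> \<gamma>) t) < \<epsilon>)}"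
  unfolding loop_topology_def by (rule topology_generated_by_Basis) (use assms in blast)

lemma topspace_loop_topology: "topspace (loop_topology A) \<subseteq> loops A"
  unfolding loop_topology_def topology_generated_by_topspace by blast

lemma openin_loop_evaluation:
  assumes \<kappa>: "\<kappa> \<in> A"
  shows "openin (loop_topology A) {\<gamma> \<in> loops A. \<gamma> \<theta> \<in> fst \<kappa>}"
proof (subst openin_subopen, intro ballI)
  fix \<gamma> assume "\<gamma> \<in> {\<gamma> \<in> loops A. \<gamma> \<theta> \<in> fst \<kappa>}"
  then have \<gamma>: "\<gamma> \<in> loops A" "\<gamma> \<theta> \<in> fst \<kappa>" by auto
  \<comment> \<open>A one-point interval and order 0 reduce a basic neighbourhood to a condition on
    the value at \<theta>; the radius 1 is arbitrary.\<close>
  let ?U = "{\<eta> \<in> loops A. \<eta> ` {\<theta>..\<theta>} \<subseteq> fst \<kappa> \<and> (\<forall>i\<le>0. \<forall>t\<in>{\<theta>..\<theta>}.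
          dist (nth_derivative i (snd \<kappa> \<circ> \<eta>) t) (nth_derivative i (snd \<kappa> \<circ> \<gamma>) t) < 1)}"
  have "openin (loop_topology A) ?U"
    by (rule openin_loop_basic) (use \<gamma> \<kappa> in auto)
  moreover have "\<gamma> \<in> ?U" "?U \<subseteq> {\<gamma> \<in> loops A. \<gamma> \<theta> \<in> fst \<kappa>}" using \<gamma> by auto
  ultimately show "\<exists>T. openin (loop_topology A) T \<and> \<gamma> \<in> T \<and> T \<subseteq> {\<gamma> \<in> loops A. \<gamma> \<theta> \<in> fst \<kappa>}" by blast
qed

section \<open>The loop group and its identity component\<close>

lemma loop_group0_subset: "loop_group0 \<subseteq> topspace loop_group_topology"
  unfolding loop_group0_def by (rule connected_component_of_subset_topspace)

lemma topspace_loop_group: "topspace loop_group_topology \<subseteq> loop_group"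
  unfolding loop_group_topology_def by simp

lemma loop_group_unitary: "a \<in> loop_group \<Longrightarrow> a \<theta> \<in> unitary_group"
  unfolding loop_group_def by blast

lemma loop_group_loops: "a \<in> loop_group \<Longrightarrow> a \<in> loops flat_atlas"
  unfolding loop_group_def by blast

lemma loop_group_periodic: "a \<in> loop_group \<Longrightarrow> a (\<theta> + 2 * pi) = a \<theta>"
  unfolding loop_group_def loops_def by blast

lemma loop_group_smooth: "a \<in> loop_group \<Longrightarrow> smooth_on UNIV a"
  unfolding loop_group_def loops_def smooth_into_def flat_atlas_def by simp

lemma loop_group0_loop_group: "a \<in> loop_group0 \<Longrightarrow> a \<in> loop_group"
  using loop_group0_subset topspace_loop_group by blast

section \<open>The total space of the reduced bundle\<close>

locale reduced_bundle =
  fixes AM :: "('m, 'e::real_normed_vector) chart set"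
    and B :: "('q, 'm, 'n::finite) loop_bundle"
  assumes AM: "smooth_manifold AM" and principal: "principal_loop_bundle AM B"
begin

lemmas principal_axioms =
  principal[unfolded principal_loop_bundle_def, THEN conjunct1]
  principal[unfolded principal_loop_bundle_def, THEN conjunct2, THEN conjunct1]
  principal[unfolded principal_loop_bundle_def, THEN conjunct2, THEN conjunct2, THEN conjunct1]
  principal[unfolded principal_loop_bundle_def, THEN conjunct2, THEN conjunct2, THEN conjunct2]

lemma Act_Total: "q \<in> Total B \<Longrightarrow> a \<in> loop_group0 \<Longrightarrow> Act B q a \<in> Total B"
  and Proj_Act: "q \<in> Total B \<Longrightarrow> a \<in> loop_group0 \<Longrightarrow> Proj B (Act B q a) = Proj B q"
  using principal_axioms(2) by blast+

lemma BCharts_open: "(V, g) \<in> BCharts B \<Longrightarrow> openin (loop_topology AM) V"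
  and BCharts_bij: "(V, g) \<in> BCharts B \<Longrightarrow> bij_betw (\<lambda>q. (Proj B q, g q)) (over B V) (V \<times> loop_group0)"
  and BCharts_Act: "(V, g) \<in> BCharts B \<Longrightarrow> q \<in> over B V \<Longrightarrow> a \<in> loop_group0 \<Longrightarrow> g (Act B q a) = (\<lambda>\<theta>. g q \<theta> ** a \<theta>)"
  using principal_axioms(4) by blast+

text \<open>As for manifolds, the predicate must first be shown to be a topology; bundle charts are
  injective on the part over their domain, so images respect intersections.\<close>

lemma openin_bundle_topology:
  "openin (bundle_topology AM B) W \<longleftrightarrow> W \<subseteq> Total B \<and> (\<forall>(V, g)\<in>BCharts B.
     openin (prod_topology (loop_topology AM) (subtopology loop_group_topology loop_group0))
       ((\<lambda>q. (Proj B q, g q)) ` (W \<inter> over B V)))"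
proof -
  let ?P = "prod_topology (loop_topology AM) (subtopology (loop_group_topology :: (real \<Rightarrow> 'n mat) topology) loop_group0)"
  let ?L = "\<lambda>W. W \<subseteq> Total B \<and> (\<forall>(V, g)\<in>BCharts B. openin ?P ((\<lambda>q. (Proj B q, g q)) ` (W \<inter> over B V)))"
  have int: "openin ?P ((\<lambda>q. (Proj B q, g q)) ` (S \<inter> T \<inter> over B V))"
    if vg: "(V, g) \<in> BCharts B" and o: "openin ?P ((\<lambda>q. (Proj B q, g q)) ` (S \<inter> over B V))"
      "openin ?P ((\<lambda>q. (Proj B q, g q)) ` (T \<inter> over B V))" for S T V g
  proof -
    have inj: "inj_on (\<lambda>q. (Proj B q, g q)) (over B V)" using BCharts_bij[OF vg] by (rule bij_betw_imp_inj_on)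
    have "(\<lambda>q. (Proj B q, g q)) ` ((S \<inter> over B V) \<inter> (T \<inter> over B V))
      = (\<lambda>q. (Proj B q, g q)) ` (S \<inter> over B V) \<inter> (\<lambda>q. (Proj B q, g q)) ` (T \<inter> over B V)"
      by (rule inj_on_image_Int[OF inj]) auto
    moreover have "(S \<inter> over B V) \<inter> (T \<inter> over B V) = S \<inter> T \<inter> over B V" by blast
    ultimately show ?thesis using openin_Int[OF o] by simp
  qed
  have un: "openin ?P ((\<lambda>q. (Proj B q, g q)) ` (\<Union>K \<inter> over B V))"
    if "\<forall>W\<in>K. openin ?P ((\<lambda>q. (Proj B q, g q)) ` (W \<inter> over B V))" for K V g
  proof -
    have "(\<lambda>q. (Proj B q, g q)) ` (\<Union>K \<inter> over B V) = (\<Union>W\<in>K. (\<lambda>q. (Proj B q, g q)) ` (W \<inter> over B V))" by auto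
    moreover have "openin ?P (\<Union>W\<in>K. (\<lambda>q. (Proj B q, g q)) ` (W \<inter> over B V))"
      by (rule openin_Union) (use that in blast)
    ultimately show ?thesis by simp
  qed
  have L_Int: "?L (S \<inter> T)" if S: "?L S" and T: "?L T" for S T
  proof (intro conjI ballI, use S in blast, clarify)
    fix V g assume vg: "(V, g) \<in> BCharts B"
    show "openin ?P ((\<lambda>q. (Proj B q, g q)) ` (S \<inter> T \<inter> over B V))"
      by (rule int[OF vg]) (use S T vg in fast)+
  qed
  have L_Union: "?L (\<Union>K)" if K: "\<forall>W\<in>K. ?L W" for K
  proof (intro conjI ballI, use K in blast, clarify)
    fix V g assume vg: "(V, g) \<in> BCharts B"
    show "openin ?P ((\<lambda>q. (Proj B q, g q)) ` (\<Union>K \<inter> over B V))"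
      by (rule un) (use K vg in fast)
  qed
  have "istopology ?L"
    unfolding istopology_def using L_Int L_Union by simp
  then show ?thesis unfolding bundle_topology_def by (simp add: topology_inverse')
qed

lemma topspace_bundle_topology: "topspace (bundle_topology AM B) = Total B"
proof
  show "topspace (bundle_topology AM B) \<subseteq> Total B"
    using openin_bundle_topology openin_topspace by blast
  have "openin (bundle_topology AM B) (Total B)"
    unfolding openin_bundle_topology
  proof (intro conjI subset_refl ballI, clarify)
    fix V g assume vg: "(V, g) \<in> BCharts B"
    have TV: "Total B \<inter> over B V = over B V" by (auto simp: over_def)
    have img: "(\<lambda>q. (Proj B q, g q)) ` (Total B \<inter> over B V) = V \<times> loop_group0"
      unfolding TV by (rule bij_betw_imp_surj_on[OF BCharts_bij[OF vg]])
    have eq: "topspace loop_group_topology \<inter> loop_group0 = (loop_group0 :: (real \<Rightarrow> 'n mat) set)"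
      by (rule Int_absorb1[OF loop_group0_subset])
    have "openin (subtopology loop_group_topology loop_group0) (loop_group0 :: (real \<Rightarrow> 'n mat) set)"
      by (rule openin_topspace[of "subtopology loop_group_topology (loop_group0 :: (real \<Rightarrow> 'n mat) set)",
            unfolded topspace_subtopology eq])
    then show "openin (prod_topology (loop_topology AM) (subtopology loop_group_topology loop_group0))
       ((\<lambda>q. (Proj B q, g q)) ` (Total B \<inter> over B V))"
      unfolding img openin_prod_Times_iff using BCharts_open[OF vg] by blast
  qed
  then show "Total B \<subseteq> topspace (bundle_topology AM B)" by (rule openin_subset)
qed

section \<open>Smooth curves and tangent vectors of the total space\<close>

lemma bundle_curves_Total: "c \<in> bundle_curves AM B \<Longrightarrow> c s \<in> Total B"
  unfolding bundle_curves_def by blast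

lemma bundle_curves_Proj: "c \<in> bundle_curves AM B \<Longrightarrow> Proj B \<circ> c \<in> loop_curves AM"
  unfolding bundle_curves_def by blast

text \<open>Translation leaves the base curve alone and multiplies the fibre coordinate by
  \<open>a\<close> on the right, so the translated curve again represents a tangent vector.\<close>

lemma bundle_curves_Act:
  assumes c: "c \<in> bundle_curves AM B" and a: "a \<in> loop_group0"
  shows "(\<lambda>q. Act B q a) \<circ> c \<in> bundle_curves AM B"
proof -
  have cT: "c s \<in> Total B" for s by (rule bundle_curves_Total[OF c])
  have "Proj B \<circ> ((\<lambda>q. Act B q a) \<circ> c) = Proj B \<circ> c" by (simp add: fun_eq_iff Proj_Act[OF cT a])
  moreover have "smooth_on ({s. Act B (c s) a \<in> over B V} \<times> UNIV) (\<lambda>(s, \<theta>). g (Act B (c s) a) \<theta>)"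
    if vg: "(V, g) \<in> BCharts B" for V g
  proof -
    have eq: "{s. Act B (c s) a \<in> over B V} = {s. c s \<in> over B V}"
      using cT Act_Total[OF cT a] Proj_Act[OF cT a] by (simp add: over_def)
    have "{s. c s \<in> over B V} = {s. (Proj B \<circ> c) s \<in> V}" using cT by (simp add: over_def)
    then have "open {s. c s \<in> over B V}"
      using loop_curves_open[OF AM bundle_curves_Proj[OF c] BCharts_open[OF vg]] by simp
    then have op: "open ({s. c s \<in> over B V} \<times> (UNIV :: real set))" by (intro open_Times) auto
    have "smooth_on ({s. c s \<in> over B V} \<times> UNIV) (\<lambda>(s, \<theta>). g (c s) \<theta>)"
      using c vg unfolding bundle_curves_def by blast
    moreover have "smooth_on ({s. c s \<in> over B V} \<times> UNIV) (\<lambda>z. a (snd z))"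
      by (rule smooth_on_compose[OF coordinates_Basis loop_group_smooth[OF loop_group0_loop_group[OF a]]
            smooth_on_bounded_linear[OF bounded_linear_snd] _ op]) auto
    ultimately have "smooth_on ({s. c s \<in> over B V} \<times> UNIV) (\<lambda>z. (case z of (s, \<theta>) \<Rightarrow> g (c s) \<theta>) ** a (snd z))"
      by (rule smooth_on_bilinear[OF bounded_bilinear_matrix_mult _ _ op])
    then show ?thesis unfolding eq
      by (rule smooth_on_cong[OF op]) (auto simp: BCharts_Act[OF vg _ a])
  qed
  ultimately show ?thesis
    using c Act_Total[OF cT a] unfolding bundle_curves_def by auto
qed

lemma curve_class_self: "c \<in> bundle_curves AM B \<Longrightarrow> c \<in> curve_class AM B c"
  unfolding curve_class_def by blast

text \<open>Differentials are computed from an unspecified member of the class; it is a smooth curve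
  through the right point because the class contains the curve that generates it.\<close>

lemma bundle_tangent_representative:
  assumes "v \<in> bundle_tangent AM B q"
  obtains c where "c \<in> bundle_curves AM B" "c 0 = q" "c = (SOME c. c \<in> v)"
proof -
  obtain c' where c': "c' \<in> bundle_curves AM B" "c' 0 = q" "v = curve_class AM B c'"
    using assms unfolding bundle_tangent_def by blast
  have "(SOME c. c \<in> v) \<in> v" using curve_class_self[OF c'(1)] c'(3) by (metis someI)
  then have "(SOME c. c \<in> v) \<in> bundle_curves AM B" "(SOME c. c \<in> v) 0 = q"
    using c' unfolding curve_class_def by auto
  then show ?thesis using that by blast
qed

lemma embedding_continuous_map:
  assumes "smooth_embedding AM B AP j"
  shows "continuous_map (bundle_topology AM B) (loop_topology AP) j"
  using assms unfolding smooth_embedding_def embedding_map_def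
  by (blast dest: homeomorphic_imp_continuous_map continuous_map_into_fulltopology)

text \<open>The coordinates of \<open>q \<mapsto> j q \<theta>\<close> are locally defined smooth functions on the total space, so they
  see only the class of a curve.\<close>

lemma curve_class_loop_velocity:
  fixes AP :: "('y, 'p::real_normed_vector) chart set"
  assumes AP: "smooth_manifold AP" and j: "smooth_embedding AM B AP j"
    and c: "c \<in> bundle_curves AM B" and c': "c' \<in> curve_class AM B c"
  shows "loop_velocity AP (j \<circ> c') = loop_velocity AP (j \<circ> c)"
proof (intro ext)
  fix \<theta> \<kappa>
  have c'B: "c' \<in> bundle_curves AM B" and c0: "c' 0 = c 0" using c' unfolding curve_class_def by auto
  have c'W: "\<forall>W f. c 0 \<in> W \<and> smooth_function_on AM B W f \<longrightarrow>
        vector_derivative (f \<circ> c') (at 0) = vector_derivative (f \<circ> c) (at 0)"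
    using c' unfolding curve_class_def by simp
  have jc: "j \<circ> d \<in> loop_curves AP" if "d \<in> bundle_curves AM B" for d
    using j that unfolding smooth_embedding_def by blast
  have ev: "smooth_into AP UNIV (\<lambda>s. j (d s) \<theta>)" if "d \<in> bundle_curves AM B" for d
    using smooth_into_loop_evaluation[OF AP jc[OF that]] by simp
  show "loop_velocity AP (j \<circ> c') \<theta> \<kappa> = loop_velocity AP (j \<circ> c) \<theta> \<kappa>"
  proof (cases "\<kappa> \<in> AP \<and> j (c 0) \<theta> \<in> fst \<kappa>")
    case False
    then show ?thesis by (auto simp: loop_velocity_def velocity_def c0)
  next
    case True
    then have \<kappa>: "\<kappa> \<in> AP" "j (c 0) \<theta> \<in> fst \<kappa>" by auto
    obtain C :: "'p set" and co where co: "coordinates C co" using smooth_manifold_coordinates[OF AP] .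
    let ?W = "{q \<in> topspace (bundle_topology AM B). j q \<in> {\<gamma> \<in> loops AP. \<gamma> \<theta> \<in> fst \<kappa>}}"
    have opW: "openin (bundle_topology AM B) ?W"
      by (rule openin_continuous_map_preimage[OF embedding_continuous_map[OF j] openin_loop_evaluation[OF \<kappa>(1)]])
    have inW: "d s \<in> ?W \<longleftrightarrow> j (d s) \<theta> \<in> fst \<kappa>" if "d \<in> bundle_curves AM B" for d s
      using bundle_curves_Total[OF that] loop_curves_loops[OF jc[OF that], of s]
      by (simp add: topspace_bundle_topology)
    have bl: "bounded_linear (co b)" if "b \<in> C" for b using co that coordinates_def by blast
    \<comment> \<open>Test functions are real-valued, so each chart coordinate of
      \<open>j q \<theta>\<close> is tested separately; their domain is open because
      \<open>j\<close> is continuous and evaluation at \<theta> pulls charts back to open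
      sets.\<close>
    have sf: "smooth_function_on AM B ?W (\<lambda>q. co b (snd \<kappa> (j q \<theta>)))" if b: "b \<in> C" for b
      unfolding smooth_function_on_def
    proof (intro conjI opW ballI)
      fix d assume d: "d \<in> bundle_curves AM B"
      have eq: "{s. d s \<in> ?W} = {s\<in>UNIV. j (d s) \<theta> \<in> fst \<kappa>}" using inW[OF d] by blast
      show "smooth_on {s. d s \<in> ?W} ((\<lambda>q. co b (snd \<kappa> (j q \<theta>))) \<circ> d)"
        unfolding eq o_def
        by (rule smooth_on_bounded_linear_comp[OF bl[OF b] smooth_into_chart[OF ev[OF d] \<kappa>(1)] smooth_into_open[OF ev[OF d] \<kappa>(1)]])
    qed
    have vd: "vector_derivative ((\<lambda>q. co b (snd \<kappa> (j q \<theta>))) \<circ> d) (at 0)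
        = co b (vector_derivative (\<lambda>s. snd \<kappa> (j (d s) \<theta>)) (at 0))"
      if b: "b \<in> C" and d: "d \<in> bundle_curves AM B" and d0: "d 0 = c 0" for b d
    proof -
      have "(\<lambda>s. snd \<kappa> (j (d s) \<theta>)) differentiable (at 0)"
        by (rule smooth_on_differentiable[OF smooth_into_chart[OF ev[OF d] \<kappa>(1)]]) (simp add: d0 \<kappa>(2))
      then have "((\<lambda>s. snd \<kappa> (j (d s) \<theta>)) has_vector_derivative vector_derivative (\<lambda>s. snd \<kappa> (j (d s) \<theta>)) (at 0)) (at 0)"
        using vector_derivative_works by blast
      from bounded_linear.has_vector_derivative[OF bl[OF b] this]
      show ?thesis unfolding o_def by (rule vector_derivative_at)
    qed
    have "co b (vector_derivative (\<lambda>s. snd \<kappa> (j (c' s) \<theta>)) (at 0)) = co b (vector_derivative (\<lambda>s. snd \<kappa> (j (c s) \<theta>)) (at 0))"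
      if b: "b \<in> C" for b
    proof -
      have c0W: "c 0 \<in> ?W" by (rule iffD2[OF inW[OF c] \<kappa>(2)])
      have "vector_derivative ((\<lambda>q. co b (snd \<kappa> (j q \<theta>))) \<circ> c') (at 0)
          = vector_derivative ((\<lambda>q. co b (snd \<kappa> (j q \<theta>))) \<circ> c) (at 0)"
        by (rule c'W[THEN spec, THEN spec, THEN mp, OF conjI[OF c0W sf[OF b]]])
      then show ?thesis unfolding vd[OF b c'B c0] vd[OF b c refl] .
    qed
    then have "(\<Sum>b\<in>C. co b (vector_derivative (\<lambda>s. snd \<kappa> (j (c' s) \<theta>)) (at 0)) *\<^sub>R b)
       = (\<Sum>b\<in>C. co b (vector_derivative (\<lambda>s. snd \<kappa> (j (c s) \<theta>)) (at 0)) *\<^sub>R b)" by simp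
    moreover have "(\<Sum>b\<in>C. co b w *\<^sub>R b) = w" for w using co unfolding coordinates_def by metis
    ultimately have "vector_derivative (\<lambda>s. snd \<kappa> (j (c' s) \<theta>)) (at 0) = vector_derivative (\<lambda>s. snd \<kappa> (j (c s) \<theta>)) (at 0)"
      by simp
    then show ?thesis using \<kappa> by (simp add: loop_velocity_def velocity_def c0 o_def)
  qed
qed

text \<open>The member chosen from the translated class may differ from the translate of the member
  chosen from \<open>v\<close>; both have the same velocity under \<open>j\<close>.\<close>

lemma differential_Act:
  fixes AP :: "('y, 'p::real_normed_vector) chart set"
  assumes AP: "smooth_manifold AP" and j: "smooth_embedding AM B AP j"
    and a: "a \<in> loop_group0" and v: "v \<in> bundle_tangent AM B q"
  shows "differential_to_loops AP j (bundle_differential AM B (\<lambda>q. Act B q a) v)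
    = loop_velocity AP (\<lambda>s. j (Act B ((SOME c. c \<in> v) s) a))"
proof -
  obtain c where c: "c \<in> bundle_curves AM B" "c 0 = q" "c = (SOME c. c \<in> v)"
    using bundle_tangent_representative[OF v] .
  note ac = bundle_curves_Act[OF c(1) a]
  have "(SOME d. d \<in> curve_class AM B ((\<lambda>q. Act B q a) \<circ> c)) \<in> curve_class AM B ((\<lambda>q. Act B q a) \<circ> c)"
    by (rule someI[where P = "\<lambda>d. d \<in> curve_class AM B ((\<lambda>q. Act B q a) \<circ> c)", OF curve_class_self[OF ac]])
  from curve_class_loop_velocity[OF AP j ac this] show ?thesis
    unfolding differential_to_loops_def bundle_differential_def c(3)[symmetric] by (simp add: o_def)
qed

end

section \<open>The winding number of the determinant\<close>

text \<open>In the Leibniz formula at the identity matrix only the identity permutation survives one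
  differentiation: any other permutation moves at least two indices, so a vanishing off-diagonal
  factor always remains.\<close>

lemma det_has_vector_derivative_at_one:
  fixes b :: "real \<Rightarrow> ('n::finite) mat"
  assumes b: "(b has_vector_derivative b') (at t)" and b1: "b t = mat 1"
  shows "((\<lambda>s. det (b s)) has_vector_derivative trace b') (at t)"
proof -
  let ?P = "{p :: 'n \<Rightarrow> 'n. p permutes UNIV}"
  have entry: "((\<lambda>s. b s $ i $ k) has_derivative (\<lambda>r. r *\<^sub>R (b' $ i $ k))) (at t)" for i k
    using bounded_linear.has_vector_derivative[OF bounded_linear_compose[OF bounded_linear_vec_nth bounded_linear_vec_nth] b]
    by (simp add: has_vector_derivative_def)
  let ?D = "\<lambda>p r. \<Sum>i\<in>UNIV. (r *\<^sub>R (b' $ i $ p i)) * (\<Prod>k\<in>UNIV - {i}. b t $ k $ p k)"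
  have D: "((\<lambda>s. det (b s)) has_derivative (\<lambda>r. \<Sum>p\<in>?P. of_int (sign p) * ?D p r)) (at t)"
    unfolding det_def
    by (intro has_derivative_sum has_derivative_mult_right has_derivative_prod entry)
  have zero: "(\<Prod>k\<in>UNIV - {i}. b t $ k $ p k) = 0" if p: "p permutes UNIV" "p \<noteq> id" for p :: "'n \<Rightarrow> 'n" and i
  proof -
    obtain k where k: "p k \<noteq> k" using p(2) by (auto simp: fun_eq_iff)
    \<comment> \<open>If the moved index found is the differentiated one, its image is a second
      moved index.\<close>
    have "\<exists>l. l \<noteq> i \<and> p l \<noteq> l"
    proof (cases "k = i")
      case True
      have "p (p k) \<noteq> p k" using k permutes_inj[OF p(1)] by (auto dest: injD)
      then show ?thesis using k True by auto
    qed (use k in auto)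
    then obtain l where "l \<noteq> i" "p l \<noteq> l" by blast
    then show ?thesis by (intro prod_zero) (auto intro!: bexI[of _ l] simp: b1 mat_def)
  qed
  have one: "(\<Prod>k\<in>UNIV - {i}. b t $ k $ id k) = 1" for i
    by (rule prod.neutral) (simp add: b1 mat_def)
  have "(\<Sum>p\<in>?P. of_int (sign p) * ?D p 1) = (\<Sum>p\<in>{id}. of_int (sign p) * ?D p 1)"
  proof (rule sum.mono_neutral_right)
    show "finite ?P" by (rule finite_permutations) simp
    show "{id} \<subseteq> ?P" by (simp add: permutes_id)
    show "\<forall>p\<in>?P - {id}. of_int (sign p) * ?D p 1 = 0"
    proof
      fix p assume "p \<in> ?P - {id}"
      then have p: "p permutes UNIV" "p \<noteq> id" by auto
      have "?D p 1 = 0" unfolding zero[OF p] by simp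
      then show "of_int (sign p) * ?D p 1 = 0" by simp
    qed
  qed
  also have "\<dots> = trace b'"
    unfolding trace_def by (simp add: one[unfolded id_apply] sign_id)
  finally show ?thesis using has_derivative_has_vector_derivative[OF D] by simp
qed

text \<open>Multiplying by the adjoint of \<open>a t\<close> moves the point of differentiation to
  the identity; the determinant is multiplicative.\<close>

lemma det_has_vector_derivative:
  fixes a :: "real \<Rightarrow> ('n::finite) mat"
  assumes a: "(a has_vector_derivative a') (at t)" and u: "a t \<in> unitary_group"
  shows "((\<lambda>s. det (a s)) has_vector_derivative det (a t) * trace (conj_transpose (a t) ** a')) (at t)"
proof -
  let ?b = "\<lambda>s. conj_transpose (a t) ** a s"
  have "(?b has_vector_derivative conj_transpose (a t) ** a') (at t)"
    by (rule bounded_linear.has_vector_derivative[OF bounded_bilinear.bounded_linear_right[OF bounded_bilinear_matrix_mult] a])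
  from det_has_vector_derivative_at_one[OF this unitary_left[OF u]]
  have "((\<lambda>s. det (a t) * det (?b s)) has_vector_derivative det (a t) * trace (conj_transpose (a t) ** a')) (at t)"
    by (rule has_vector_derivative_mult_right)
  moreover have "det (a t) * det (?b s) = det (a s)" for s
  proof -
    have "a t ** ?b s = a s" by (simp only: matrix_mul_assoc unitary_right[OF u] matrix_mul_lid)
    then show ?thesis using det_mul[of "a t" "?b s"] by simp
  qed
  ultimately show ?thesis by simp
qed

definition winding_integral :: "(real \<Rightarrow> ('n::finite) mat) \<Rightarrow> complex" where
  "winding_integral a = integral {0..2 * pi} (\<lambda>t. trace (conj_transpose (a t) ** vector_derivative a (at t)))"

lemma smooth_curve_vector_derivative:
  assumes "smooth_on UNIV (a :: real \<Rightarrow> 'k::real_normed_vector)"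
  shows "(a has_vector_derivative vector_derivative a (at t)) (at t)"
    and "smooth_on UNIV (\<lambda>t. vector_derivative a (at t))"
proof -
  have v: "vector_derivative a (at t) = fderiv a t 1"
    and d: "(a has_vector_derivative fderiv a t 1) (at t)" for t
    using has_derivative_has_vector_derivative[OF smooth_on_has_derivative[OF assms UNIV_I]] vector_derivative_at by blast+
  show "(a has_vector_derivative vector_derivative a (at t)) (at t)" unfolding v by (rule d)
  show "smooth_on UNIV (\<lambda>t. vector_derivative a (at t))" unfolding v by (rule smooth_on_deriv[OF assms])
qed

lemma bounded_bilinear_trace_pairing:
  "bounded_bilinear (\<lambda>X Y :: ('n::finite) mat. trace (conj_transpose X ** Y))"
proof -
  interpret M: bounded_bilinear "(**) :: 'n mat \<Rightarrow> 'n mat \<Rightarrow> 'n mat" by (rule bounded_bilinear_matrix_mult)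
  have "bounded_linear (\<lambda>Y :: 'n mat. trace (conj_transpose X ** Y))" for X
    by (rule bounded_linear_compose[OF bounded_linear_trace M.bounded_linear_right])
  moreover have "bounded_linear (\<lambda>X :: 'n mat. trace (conj_transpose X ** Y))" for Y
    by (rule bounded_linear_compose[OF bounded_linear_trace
          bounded_linear_compose[OF M.bounded_linear_left bounded_linear_conj_transpose]])
  ultimately have "bilinear (\<lambda>X Y :: 'n mat. trace (conj_transpose X ** Y))"
    unfolding bilinear_def using bounded_linear.linear by blast
  then show ?thesis by (simp add: bilinear_conv_bounded_bilinear)
qed

lemma smooth_winding_integrand:
  assumes "smooth_on UNIV a"
  shows "smooth_on UNIV (\<lambda>t :: real. trace (conj_transpose (a t) ** vector_derivative a (at t)))"
  by (rule smooth_on_bilinear[OF bounded_bilinear_trace_pairing assms smooth_curve_vector_derivative(2)[OF assms]]) simp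

text \<open>By Jacobi's formula the integrand is the logarithmic derivative of \<open>det a\<close>.\<close>

lemma winding_integral_quantized:
  assumes a: "a \<in> loop_group"
  shows "winding_integral a \<in> range (\<lambda>n :: int. \<i> * of_int (2 * n) * of_real pi)"
proof -
  note sm = loop_group_smooth[OF a]
  let ?f = "\<lambda>t. trace (conj_transpose (a t) ** vector_derivative a (at t))"
  let ?S = "{0..2 * pi}"
  have contf: "continuous_on ?S ?f"
    using smooth_on_continuous[OF smooth_winding_integrand[OF sm]] continuous_on_subset by blast
  let ?F = "\<lambda>t. integral {0..t} ?f"
  have dF: "(?F has_vector_derivative ?f t) (at t within ?S)" if "t \<in> ?S" for t
    by (rule integral_has_vector_derivative[OF contf that])
  \<comment> \<open>The product of \<open>exp (- ?F t)\<close> and \<open>det (a t)\<close> has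
    derivative 0. This compares the integral with the determinant without choosing a branch of its
    logarithm; periodicity then makes the exponential of the full integral equal to 1.\<close>
  have dE: "((\<lambda>t. exp (- ?F t)) has_vector_derivative (- ?f t * exp (- ?F t))) (at t within ?S)" if "t \<in> ?S" for t
  proof -
    have "((\<lambda>t. - ?F t) has_vector_derivative - ?f t) (at t within ?S)"
      by (rule has_vector_derivative_minus[OF dF[OF that]])
    from field_vector_diff_chain_within[OF this DERIV_subset[OF DERIV_exp subset_UNIV]]
    show ?thesis by (simp add: o_def)
  qed
  have dd: "((\<lambda>t. det (a t)) has_vector_derivative det (a t) * ?f t) (at t within ?S)" for t
    by (rule has_vector_derivative_at_within[OF det_has_vector_derivative[OF
          smooth_curve_vector_derivative(1)[OF sm] loop_group_unitary[OF a]]])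
  have "((\<lambda>t. exp (- ?F t) * det (a t)) has_vector_derivative 0) (at t within ?S)" if "t \<in> ?S" for t
    using has_vector_derivative_mult[OF dE[OF that] dd[of t]] by (simp add: algebra_simps)
  then obtain k where k: "\<And>t. t \<in> ?S \<Longrightarrow> exp (- ?F t) * det (a t) = k"
    using has_vector_derivative_zero_constant[OF convex_real_interval(5)] by blast
  have "det (conj_transpose (a 0)) * det (a 0) = 1"
    using unitary_left[OF loop_group_unitary[OF a], of 0] det_mul[of "conj_transpose (a 0)" "a 0"] by (simp add: det_I)
  then have d0: "det (a 0) \<noteq> 0" by auto
  have "exp (- ?F (2 * pi)) * det (a (2 * pi)) = exp (- ?F 0) * det (a 0)"
    using k[of 0] k[of "2 * pi"] by simp
  moreover have "a (2 * pi) = a 0" using loop_group_periodic[OF a, of 0] by simp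
  ultimately have "exp (- ?F (2 * pi)) = 1" using d0 by simp
  then have "exp (winding_integral a) = 1" by (simp add: winding_integral_def exp_minus)
  then obtain n :: int where "Re (winding_integral a) = 0" "Im (winding_integral a) = of_int (2 * n) * pi"
    using exp_eq_1 by blast
  then have "winding_integral a = \<i> * of_int (2 * n) * of_real pi" by (simp add: complex_eq_iff)
  then show ?thesis by blast
qed

section \<open>Continuity of the winding integral and its vanishing on the identity
  component\<close>

text \<open>The integrand is bilinear in the loop and its derivative, so a small change of both,
  uniformly on the period, changes the integral little.\<close>

lemma winding_integral_dist:
  fixes a :: "real \<Rightarrow> ('n::finite) mat"
  assumes a: "smooth_on UNIV a" and e: "e > 0"
  shows "\<exists>\<delta>>0. \<forall>b. smooth_on UNIV b \<and> (\<forall>t\<in>{0..2 * pi}. dist (b t) (a t) < \<delta> \<and>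
      dist (vector_derivative b (at t)) (vector_derivative a (at t)) < \<delta>) \<longrightarrow>
      dist (winding_integral b) (winding_integral a) < e"
proof -
  let ?S = "{0..2 * pi}"
  let ?\<beta> = "\<lambda>X Y :: 'n mat. trace (conj_transpose X ** Y)"
  let ?a' = "\<lambda>t. vector_derivative a (at t)"
  interpret \<beta>: bounded_bilinear ?\<beta> by (rule bounded_bilinear_trace_pairing)
  obtain K where K: "K > 0" "\<And>X Y. norm (?\<beta> X Y) \<le> norm X * norm Y * K" using \<beta>.pos_bounded by blast
  have "bounded (a ` ?S)" "bounded (?a' ` ?S)"
    using smooth_on_continuous[OF a] smooth_on_continuous[OF smooth_curve_vector_derivative(2)[OF a]]
    by (auto intro!: compact_imp_bounded compact_continuous_image intro: continuous_on_subset)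
  then obtain R1 R2 where "\<forall>x\<in>a ` ?S. norm x \<le> R1" "\<forall>x\<in>?a' ` ?S. norm x \<le> R2"
    unfolding bounded_iff by blast
  then have R': "norm (a t) \<le> R1" "norm (?a' t) \<le> R2" if "t \<in> ?S" for t using that by auto
  define R where "R = max 0 (max R1 R2)"
  have R: "norm (a t) \<le> R" "norm (?a' t) \<le> R" if "t \<in> ?S" for t using R'[OF that] by (auto simp: R_def)
  have R0: "R \<ge> 0" by (simp add: R_def)
  \<comment> \<open>Once \<delta> is at most 1, the derivative of \<open>b\<close> is bounded by
    \<open>R + 1\<close>. The two differences then contribute \<delta> (R + 1) K and \<delta> R K,
    and the interval has length 2 pi.\<close>
  let ?C = "(2 * R + 1) * K * (2 * pi)"
  have C: "?C > 0" using R0 K(1) by (intro mult_pos_pos) auto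
  define \<delta> where "\<delta> = min 1 (e / (2 * ?C))"
  have \<delta>: "\<delta> > 0" "\<delta> \<le> 1" using e C by (auto simp: \<delta>_def)
  have \<delta>C: "\<delta> * ?C < e"
  proof -
    have "\<delta> * ?C \<le> e / (2 * ?C) * ?C" by (rule mult_right_mono) (use C in \<open>auto simp: \<delta>_def\<close>)
    also have "\<dots> = e / 2" using C by (simp add: field_simps)
    finally show ?thesis using e by simp
  qed
  have "dist (winding_integral b) (winding_integral a) < e"
    if b: "smooth_on UNIV b" and near: "\<forall>t\<in>?S. dist (b t) (a t) < \<delta> \<and> dist (vector_derivative b (at t)) (?a' t) < \<delta>" for b
  proof -
    let ?b' = "\<lambda>t. vector_derivative b (at t)"
    have ca: "continuous_on ?S (\<lambda>t. ?\<beta> (a t) (?a' t))" and cb: "continuous_on ?S (\<lambda>t. ?\<beta> (b t) (?b' t))"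
      using smooth_on_continuous[OF smooth_winding_integrand[OF a]] smooth_on_continuous[OF smooth_winding_integrand[OF b]]
      by (auto intro: continuous_on_subset)
    have bd: "norm (?\<beta> (b t) (?b' t) - ?\<beta> (a t) (?a' t)) \<le> \<delta> * (2 * R + 1) * K" if t: "t \<in> ?S" for t
    proof -
      have n1: "norm (b t - a t) \<le> \<delta>" and n2: "norm (?b' t - ?a' t) \<le> \<delta>"
        using near t by (auto simp: dist_norm intro: less_imp_le)
      have n3: "norm (?b' t) \<le> R + 1"
        using norm_triangle_sub[of "?b' t" "?a' t"] n2 R(2)[OF t] \<delta>(2) by linarith
      have "?\<beta> (b t) (?b' t) - ?\<beta> (a t) (?a' t) = ?\<beta> (b t - a t) (?b' t) + ?\<beta> (a t) (?b' t - ?a' t)"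
        unfolding \<beta>.diff_left \<beta>.diff_right by simp
      also have "norm \<dots> \<le> norm (b t - a t) * norm (?b' t) * K + norm (a t) * norm (?b' t - ?a' t) * K"
        by (rule norm_triangle_le[OF add_mono[OF K(2) K(2)]])
      also have "\<dots> \<le> \<delta> * (R + 1) * K + R * \<delta> * K"
        using n1 n2 n3 R(1)[OF t] R0 K(1) \<delta> by (intro add_mono mult_right_mono mult_mono) auto
      also have "\<dots> = \<delta> * (2 * R + 1) * K" by (simp add: algebra_simps)
      finally show ?thesis .
    qed
    have "winding_integral b - winding_integral a = integral ?S (\<lambda>t. ?\<beta> (b t) (?b' t) - ?\<beta> (a t) (?a' t))"
      unfolding winding_integral_def
      by (rule integral_diff[symmetric]) (auto intro: integrable_continuous_interval ca cb)
    also have "norm \<dots> \<le> \<delta> * (2 * R + 1) * K * (2 * pi - 0)"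
      by (rule integral_bound) (use bd ca cb in \<open>auto intro: continuous_on_diff\<close>)
    also have "\<dots> < e" using \<delta>C by (simp add: mult.assoc)
    finally show ?thesis by (simp add: dist_norm)
  qed
  then show ?thesis using \<delta>(1) by blast
qed

text \<open>Only the loop and its first derivative enter, so a basic neighbourhood of order 1 over a
  full period in the single chart of \<open>flat_atlas\<close> is enough.\<close>

lemma continuous_map_winding_integral:
  "continuous_map loop_group_topology euclidean (winding_integral :: (real \<Rightarrow> ('n::finite) mat) \<Rightarrow> complex)"
  unfolding continuous_map_def
proof (intro conjI allI impI)
  fix T :: "complex set" assume T: "openin euclidean T"
  let ?X = "loop_group_topology :: (real \<Rightarrow> 'n mat) topology"
  show "openin ?X {a \<in> topspace ?X. winding_integral a \<in> T}"
  proof (subst openin_subopen, intro ballI)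
    fix a assume a: "a \<in> {a \<in> topspace ?X. winding_integral a \<in> T}"
    then have aX: "a \<in> topspace ?X" and aG: "a \<in> loop_group" using topspace_loop_group by auto
    have "open T" by (rule iffD2[OF open_openin T])
    then obtain e where e: "e > 0" "ball (winding_integral a) e \<subseteq> T"
      using a open_contains_ball by blast
    from winding_integral_dist[OF loop_group_smooth[OF aG] e(1)]
    obtain \<delta> where \<delta>: "\<delta> > 0" and near: "\<forall>b. smooth_on UNIV b \<and> (\<forall>t\<in>{0..2 * pi}. dist (b t) (a t) < \<delta> \<and>
      dist (vector_derivative b (at t)) (vector_derivative a (at t)) < \<delta>) \<longrightarrow>
      dist (winding_integral b) (winding_integral a) < e" by blast
    let ?U = "{\<eta> \<in> loops flat_atlas. \<eta> ` {0..2 * pi} \<subseteq> UNIV \<and> (\<forall>i\<le>1. \<forall>t\<in>{0..2 * pi}.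
          dist (nth_derivative i (id \<circ> \<eta>) t) (nth_derivative i (id \<circ> a) t) < \<delta>)}"
    have "openin (loop_topology flat_atlas) ?U"
      by (rule openin_loop_basic) (use loop_group_loops[OF aG] \<delta> in \<open>auto simp: flat_atlas_def\<close>)
    then have op: "openin ?X (?U \<inter> loop_group)"
      unfolding loop_group_topology_def by (rule openin_subtopology_Int)
    have "a \<in> ?U \<inter> loop_group" using loop_group_loops[OF aG] aG \<delta> by simp
    moreover have "?U \<inter> loop_group \<subseteq> {a \<in> topspace ?X. winding_integral a \<in> T}"
    proof
      fix b assume b: "b \<in> ?U \<inter> loop_group"
      have d: "dist (nth_derivative i b t) (nth_derivative i a t) < \<delta>" if "i \<le> 1" "t \<in> {0..2 * pi}" for i t
        using b that by simp
      have bG: "b \<in> loop_group" using b by blast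
      have "dist (b t) (a t) < \<delta> \<and> dist (vector_derivative b (at t)) (vector_derivative a (at t)) < \<delta>"
        if "t \<in> {0..2 * pi}" for t
        using d[of 0, OF _ that] d[of "Suc 0", OF _ that] by (simp add: nth_derivative_0 nth_derivative_Suc)
      then have "dist (winding_integral b) (winding_integral a) < e"
        using near[THEN spec, THEN mp, of b] loop_group_smooth[OF bG] by blast
      then have "winding_integral b \<in> ball (winding_integral a) e" by (simp add: dist_commute)
      then have "winding_integral b \<in> T" using e(2) by (rule set_rev_mp)
      moreover have "b \<in> topspace ?X" using b openin_subset[OF op] by blast
      ultimately show "b \<in> {a \<in> topspace ?X. winding_integral a \<in> T}" by simp
    qed
    ultimately show "\<exists>U. openin ?X U \<and> a \<in> U \<and> U \<subseteq> {a \<in> topspace ?X. winding_integral a \<in> T}"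
      using op by blast
  qed
qed auto

lemma winding_integral_loop_group0:
  fixes a :: "real \<Rightarrow> ('n::finite) mat"
  assumes a: "a \<in> loop_group0"
  shows "winding_integral a = 0"
proof -
  let ?I = "winding_integral ` (loop_group0 :: (real \<Rightarrow> 'n mat) set)"
  have "connectedin loop_group_topology (loop_group0 :: (real \<Rightarrow> 'n mat) set)"
    unfolding loop_group0_def by (rule connectedin_connected_component_of)
  then have conn: "connected ?I"
    using connectedin_continuous_map_image[OF continuous_map_winding_integral] connectedin_iff_connected by blast
  have "?I \<subseteq> range (\<lambda>n :: int. \<i> * of_int (2 * n) * of_real pi)"
    using winding_integral_quantized[OF loop_group0_loop_group] by blast
  \<comment> \<open>Countability does the work of discreteness: a connected set with two distinct
    points is uncountable.\<close>
  then have count: "countable ?I" by (rule countable_subset) simp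
  \<comment> \<open>The component contains \<open>a\<close>, so it is nonempty, and this forces its
    base point, the constant loop, to belong to it.\<close>
  have "connected_component_of loop_group_topology (\<lambda>_. mat 1) a"
    using a unfolding loop_group0_def by simp
  then have one: "(\<lambda>_. mat 1) \<in> (loop_group0 :: (real \<Rightarrow> 'n mat) set)"
    unfolding loop_group0_def by (simp add: connected_component_of_refl connected_component_in_topspace)
  have "winding_integral (\<lambda>_. mat 1 :: 'n mat) = 0"
    by (simp add: winding_integral_def trace_def)
  then have "0 \<in> ?I" using one by (metis imageI)
  moreover have "winding_integral a \<in> ?I" using a by blast
  ultimately show ?thesis using connected_uncountable[OF conn, of "winding_integral a" 0] count by argo
qed

section \<open>The equivariant curvature form\<close>

lemma loop_trace_zero: "loop_trace (\<lambda>\<theta>. 0 :: ('n::finite) mat) = 0"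
  by (simp add: loop_trace_def trace_def)

lemma loop_trace_cong:
  assumes "\<And>\<theta>. trace (A \<theta>) = trace (A' \<theta>)" shows "loop_trace A = loop_trace A'"
  unfolding loop_trace_def by (simp add: assms)

text \<open>Mapping a polynomial acts on every coefficient, including those beyond the degree,
  because trace and pullback send the zero form to the zero form.\<close>

lemma coeff_eq_pullback_trace:
  fixes F :: "'q \<Rightarrow> 'x" and dF :: "'s \<Rightarrow> 't" and \<alpha> :: "('x, 't, real \<Rightarrow> ('n::finite) mat) form poly"
  shows "poly.coeff (eq_pullback F dF (eq_trace \<alpha>)) k = (\<lambda>q vs. loop_trace (poly.coeff \<alpha> k (F q) (map dF vs)))"
proof -
  have 1: "(\<lambda>x ts. loop_trace ((0 :: ('x, 't, real \<Rightarrow> 'n mat) form) x ts)) = 0"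
    using loop_trace_zero by (simp add: zero_fun_def fun_eq_iff)
  have 2: "(\<lambda>q vs. (0 :: ('x, 't, complex) form) (F q) (map dF vs)) = 0"
    by (simp add: zero_fun_def)
  show ?thesis unfolding eq_pullback_def eq_trace_def
    by (subst coeff_map_poly, rule 2, subst coeff_map_poly, rule 1) (rule refl)
qed

lemma coeff_equivariant_curvature:
  "poly.coeff (equivariant_curvature AP \<omega>) k =
     (if k = 0 then two_form (loop_curvature (curvature AP \<omega>))
      else if k = 1 then - zero_form (\<lambda>\<gamma>. loop_connection \<omega> \<gamma> (rotation_field AP \<gamma>)) else 0)"
  by (auto simp: equivariant_curvature_def coeff_pCons split: nat.split)

text \<open>Invariance and horizontality are asserted for lists of every length; lists that are not
  pairs keep their length under \<open>map\<close> and receive the value 0.\<close>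

lemma two_form_not_pair: "\<nexists>v w. ts = [v, w] \<Longrightarrow> two_form f x (map g ts) = 0"
  by (auto simp: two_form_def split: list.split)

section \<open>The two coefficients on the reduced bundle\<close>

locale reduced_frame_connection = frame_connection AM E AP \<omega>
  for AM :: "('m, 'e::real_normed_vector) chart set"
    and E :: "('m, 'v::ab_group_add, 'n::finite) vbundle"
    and AP :: "(('m, 'v, 'n) frame, 'p::real_normed_vector) chart set"
    and \<omega> :: "('m, 'v, 'n) frame \<Rightarrow> (('m, 'v, 'n) frame, 'p) tvec \<Rightarrow> 'n mat" +
  fixes B :: "('q, 'm, 'n) loop_bundle"
    and j :: "'q \<Rightarrow> real \<Rightarrow> ('m, 'v, 'n) frame"
  assumes reduction: "loop_frame_reduction AM E AP B j"
begin

sublocale reduced_bundle AM B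
  using AM reduction unfolding loop_frame_reduction_def by unfold_locales blast+

lemma embedding: "smooth_embedding AM B AP j"
  using reduction unfolding loop_frame_reduction_def by blast

lemma Proj_eq: "q \<in> Total B \<Longrightarrow> Proj B q = (\<lambda>\<theta>. fst (j q \<theta>))"
  and j_Act: "q \<in> Total B \<Longrightarrow> a \<in> loop_group0 \<Longrightarrow> j (Act B q a) = (\<lambda>\<theta>. frame_act E (j q \<theta>) (a \<theta>))"
  using reduction unfolding loop_frame_reduction_def by blast+

text \<open>Continuity of \<open>j\<close> places its values in the space underlying the loop
  topology, and that space consists of loops.\<close>

lemma j_smooth:
  assumes q: "q \<in> Total B" shows "smooth_into AP UNIV (j q)"
proof -
  have "j q \<in> topspace (loop_topology AP)"
    using continuous_map_image_subset_topspace[OF embedding_continuous_map[OF embedding]] q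
    unfolding topspace_bundle_topology by blast
  then show ?thesis using topspace_loop_topology loop_smooth by blast
qed

abbreviation "dj \<equiv> differential_to_loops AP j"
abbreviation "dAct a \<equiv> bundle_differential AM B (\<lambda>q. Act B q a)"

abbreviation representative :: "(real \<Rightarrow> 'q) set \<Rightarrow> real \<Rightarrow> 'q" where
  "representative v \<equiv> SOME c. c \<in> v"

lemma tangent_curve:
  assumes v: "v \<in> bundle_tangent AM B q"
  shows "representative v s \<in> Total B" "smooth_into AP UNIV (\<lambda>s. j (representative v s) \<theta>)"
    "representative v 0 = q"
    "dj v = (\<lambda>\<theta>. velocity AP (\<lambda>s. j (representative v s) \<theta>) 0)"
proof -
  obtain c where c: "c \<in> bundle_curves AM B" "c 0 = q" "c = representative v"
    using bundle_tangent_representative[OF v] .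
  have jc: "j \<circ> c \<in> loop_curves AP" using embedding c(1) unfolding smooth_embedding_def by blast
  show "representative v s \<in> Total B" "representative v 0 = q"
    using bundle_curves_Total[OF c(1)] c(2) unfolding c(3) by simp_all
  show "smooth_into AP UNIV (\<lambda>s. j (representative v s) \<theta>)"
    using smooth_into_loop_evaluation[OF AP jc] unfolding c(3) by simp
  show "dj v = (\<lambda>\<theta>. velocity AP (\<lambda>s. j (representative v s) \<theta>) 0)"
    unfolding differential_to_loops_def by (simp add: loop_velocity_def)
qed

text \<open>Since \<open>j\<close> intertwines the actions, at each \<theta> the image of a
  translated curve is the image curve translated by the single unitary matrix
  \<open>a \<theta>\<close>.\<close>

lemma differential_j_Act:
  assumes v: "v \<in> bundle_tangent AM B q" and a: "a \<in> loop_group0"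
  shows "dj v \<theta> \<in> tangent_space AP (j q \<theta>)"
    and "dj (dAct a v) \<theta>
      = tangent_map AP AP (\<lambda>p. frame_act E p (a \<theta>)) (j q \<theta>) (dj v \<theta>)"
proof -
  let ?c = "representative v"
  note c = tangent_curve[OF v]
  have vel: "velocity AP (\<lambda>s. j (?c s) \<theta>) 0 = partial_velocity AP (\<lambda>s. j (?c s) \<theta>) 0 1"
    by (simp add: partial_velocity_def)
  show "dj v \<theta> \<in> tangent_space AP (j q \<theta>)"
    using partial_velocity_tangent[OF AP c(2) UNIV_I, of \<theta> 0 1] unfolding c(3,4) vel by simp
  have "dj (dAct a v) \<theta>
      = partial_velocity AP (\<lambda>s. frame_act E (j (?c s) \<theta>) (a \<theta>)) 0 1"
    unfolding differential_Act[OF AP embedding a v] loop_velocity_def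
    by (simp add: j_Act[OF c(1) a] partial_velocity_def)
  also have "\<dots> = tangent_map AP AP (\<lambda>p. frame_act E p (a \<theta>)) (j (?c 0) \<theta>) (partial_velocity AP (\<lambda>s. j (?c s) \<theta>) 0 1)"
    by (rule tangent_map_act[OF c(2) open_UNIV UNIV_I loop_group_unitary[OF loop_group0_loop_group[OF a]], symmetric])
  finally show "dj (dAct a v) \<theta>
      = tangent_map AP AP (\<lambda>p. frame_act E p (a \<theta>)) (j q \<theta>) (dj v \<theta>)"
    unfolding c(3,4) vel .
qed

lemma curvature_trace_invariant:
  assumes q: "q \<in> Total B" and a: "a \<in> loop_group0"
    and v: "v \<in> bundle_tangent AM B q" and w: "w \<in> bundle_tangent AM B q"
  shows "loop_trace (loop_curvature (curvature AP \<omega>) (j (Act B q a))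
      (dj (dAct a v))
      (dj (dAct a w)))
    = loop_trace (loop_curvature (curvature AP \<omega>) (j q) (dj v) (dj w))"
proof (rule loop_trace_cong)
  fix \<theta>
  have u: "a \<theta> \<in> unitary_group" by (rule loop_group_unitary[OF loop_group0_loop_group[OF a]])
  have p: "j q \<theta> \<in> points AP" by (rule smooth_into_points[OF j_smooth[OF q] UNIV_I])
  show "trace (loop_curvature (curvature AP \<omega>) (j (Act B q a))
      (dj (dAct a v))
      (dj (dAct a w)) \<theta>)
    = trace (loop_curvature (curvature AP \<omega>) (j q) (dj v) (dj w) \<theta>)"
    unfolding loop_curvature_def j_Act[OF q a] differential_j_Act(2)[OF v a] differential_j_Act(2)[OF w a]
      curvature_act[OF p differential_j_Act(1)[OF v a] differential_j_Act(1)[OF w a] u]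
    by (rule trace_conj_unitary[OF u])
qed

text \<open>The projection factors through \<open>j\<close>, so a vertical vector is, at every
  \<theta>, the velocity of a curve of frames with stationary base point.\<close>

lemma curvature_trace_horizontal:
  assumes v: "v \<in> vertical_vectors AM B q" and w: "w \<in> bundle_tangent AM B q"
  shows "loop_trace (loop_curvature (curvature AP \<omega>) (j q) (dj v) (dj w)) = 0"
proof -
  have vT: "v \<in> bundle_tangent AM B q" and v0: "differential_to_loops AM (Proj B) v = (\<lambda>\<theta> \<kappa>. 0)"
    using v unfolding vertical_vectors_def by auto
  let ?c = "representative v" and ?d = "representative w"
  note c = tangent_curve[OF vT] and d = tangent_curve[OF w]
  have vel: "velocity AM (\<lambda>s. fst (j (?c s) \<theta>)) 0 = (\<lambda>\<kappa>. 0)" for \<theta>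
    using fun_cong[OF v0, of \<theta>] unfolding differential_to_loops_def
    by (simp add: loop_velocity_def Proj_eq[OF c(1)])
  have "curvature AP \<omega> (j q \<theta>) (velocity AP (\<lambda>s. j (?c s) \<theta>) 0) (velocity AP (\<lambda>s. j (?d s) \<theta>) 0) = 0" for \<theta>
    using curvature_vertical_velocity[OF c(2) vel d(2), of \<theta>] c(3) d(3) by simp
  then show ?thesis unfolding loop_curvature_def c(4) d(4) by (simp add: loop_trace_zero)
qed

lemma connection_trace_invariant:
  assumes q: "q \<in> Total B" and a: "a \<in> loop_group0"
  shows "loop_trace (loop_connection \<omega> (j (Act B q a)) (rotation_field AP (j (Act B q a))))
    = loop_trace (loop_connection \<omega> (j q) (rotation_field AP (j q)))"
proof -
  have aG: "a \<in> loop_group" by (rule loop_group0_loop_group[OF a])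
  note sm = loop_group_smooth[OF aG] and u = loop_group_unitary[OF aG] and js = j_smooth[OF q]
  let ?f = "\<lambda>\<theta>. trace (loop_connection \<omega> (j q) (rotation_field AP (j q)) \<theta>)"
  let ?g = "\<lambda>\<theta>. trace (conj_transpose (a \<theta>) ** vector_derivative a (at \<theta>))"
  have rot: "rotation_field AP \<gamma> \<theta> = velocity AP (\<lambda>t. \<gamma> (\<theta> + t)) 0" for \<gamma> \<theta>
    by (simp add: rotation_field_def loop_velocity_def rotate_loop_def)
  have eq: "trace (loop_connection \<omega> (j (Act B q a)) (rotation_field AP (j (Act B q a))) \<theta>) = ?f \<theta> + ?g \<theta>" for \<theta>
  proof -
    have "range a \<subseteq> unitary_group" using u by blast
    from connection_product[OF js sm this smooth_curve_vector_derivative(1)[OF sm], of \<theta>]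
    have "loop_connection \<omega> (j (Act B q a)) (rotation_field AP (j (Act B q a))) \<theta>
      = conj_transpose (a \<theta>) ** loop_connection \<omega> (j q) (rotation_field AP (j q)) \<theta> ** a \<theta>
        + conj_transpose (a \<theta>) ** vector_derivative a (at \<theta>)"
      unfolding loop_connection_def j_Act[OF q a] rot .
    then show ?thesis by (simp add: trace_add trace_conj_unitary[OF u])
  qed
  \<comment> \<open>Smoothness of both summands gives their integrability, without which the
    integral could not be split.\<close>
  have "smooth_on UNIV (\<lambda>\<theta>. \<omega> (j q \<theta>) (partial_velocity AP (j q) \<theta> 1))"
    by (rule one_form_along_smooth[OF AP one_form js])
  then have "smooth_on UNIV ?f"
    using smooth_on_bounded_linear_comp[OF bounded_linear_trace _ open_UNIV]
    unfolding loop_connection_def rot partial_velocity_curve[symmetric] by blast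
  then have "?f integrable_on {0..2 * pi}"
    by (intro integrable_continuous_interval continuous_on_subset[OF smooth_on_continuous]) auto
  moreover have "?g integrable_on {0..2 * pi}"
    by (intro integrable_continuous_interval continuous_on_subset[OF smooth_on_continuous[OF smooth_winding_integrand[OF sm]]]) auto
  ultimately have "integral {0..2 * pi} (\<lambda>\<theta>. ?f \<theta> + ?g \<theta>) = integral {0..2 * pi} ?f + integral {0..2 * pi} ?g"
    by (rule integral_add)
  \<comment> \<open>Here it matters that \<open>a\<close> lies in the identity component: a loop
    whose determinant winds would leave a nonzero multiple of 2 pi \<i>.\<close>
  moreover have "integral {0..2 * pi} ?g = 0"
    using winding_integral_loop_group0[OF a] by (simp add: winding_integral_def)
  ultimately show ?thesis unfolding loop_trace_def eq by simp
qed

lemma loop_trace_minus: "loop_trace (- X) = - loop_trace X" for X :: "real \<Rightarrow> 'n mat"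
proof -
  have "trace ((- X) \<theta>) = - trace (X \<theta>)" for \<theta> by (simp add: trace_def sum_negf)
  then show ?thesis by (simp add: loop_trace_def)
qed

lemma equivariant_curvature_basic:
  "basic AM B (eq_pullback j dj (eq_trace (equivariant_curvature AP \<omega>)))"
proof -
  let ?\<alpha> = "equivariant_curvature AP \<omega>"
  have inv: "loop_trace (poly.coeff ?\<alpha> k (j (Act B q a)) (map dj (map (dAct a) vs)))
      = loop_trace (poly.coeff ?\<alpha> k (j q) (map dj vs))"
    if q: "q \<in> Total B" and a: "a \<in> loop_group0" and vs: "vs \<in> lists (bundle_tangent AM B q)" for k q a vs
  proof -
    consider "k = 0" | "k = 1" | "k \<noteq> 0" "k \<noteq> 1" by blast
    then show ?thesis
    proof cases
      case 1
      show ?thesis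
      proof (cases "\<exists>v w. vs = [v, w]")
        case True
        then obtain v w where vw: "vs = [v, w]" by blast
        then have "v \<in> bundle_tangent AM B q" "w \<in> bundle_tangent AM B q" using vs by auto
        from curvature_trace_invariant[OF q a this] show ?thesis
          unfolding coeff_equivariant_curvature vw using 1 by (simp add: two_form_def)
      next
        case False
        then show ?thesis
          unfolding coeff_equivariant_curvature map_map using 1 by (simp add: two_form_not_pair)
      qed
    next
      case 2
      show ?thesis
      proof (cases vs)
        case Nil
        then show ?thesis
          unfolding coeff_equivariant_curvature using 2 connection_trace_invariant[OF q a]
          by (simp add: zero_form_def loop_trace_minus)
      next
        case (Cons v vs')
        then show ?thesis unfolding coeff_equivariant_curvature using 2 by (simp add: zero_form_def)
      qed
    next
      case 3
      then show ?thesis by (simp add: coeff_equivariant_curvature)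
    qed
  qed
  have hor: "loop_trace (poly.coeff ?\<alpha> k (j q) (map dj (v # vs))) = 0"
    if q: "q \<in> Total B" and v: "v \<in> vertical_vectors AM B q" and vs: "vs \<in> lists (bundle_tangent AM B q)" for k q v vs
  proof -
    have z: "loop_trace (0 :: real \<Rightarrow> 'n mat) = 0" using loop_trace_zero by (simp add: zero_fun_def)
    consider "k = 0" | "k = 1" | "k \<noteq> 0" "k \<noteq> 1" by blast
    then show ?thesis
    proof cases
      case 1
      show ?thesis
      proof (cases "\<exists>w. vs = [w]")
        case True
        then obtain w where w: "vs = [w]" by blast
        then have "w \<in> bundle_tangent AM B q" using vs by auto
        from curvature_trace_horizontal[OF v this] show ?thesis
          unfolding coeff_equivariant_curvature w using 1 by (simp add: two_form_def)
      next
        case False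
        then have "\<nexists>v' w. v # vs = [v', w]" by simp
        then show ?thesis
          unfolding coeff_equivariant_curvature using 1 by (simp only: two_form_not_pair z simp_thms if_True)
      qed
    next
      case 2
      \<comment> \<open>The coefficient of \<open>u\<close> lives in degree 0, while the argument
        list is nonempty.\<close>
      then show ?thesis unfolding coeff_equivariant_curvature using z by (simp add: zero_form_def)
    next
      case 3
      then show ?thesis using z by (simp add: coeff_equivariant_curvature)
    qed
  qed
  show ?thesis unfolding basic_def coeff_eq_pullback_trace using inv hor by blast
qed

end

theorem proposition4p14:
  fixes AM :: "('m, 'e::real_normed_vector) chart set"
    and E :: "('m, 'v::ab_group_add, 'n::finite) vbundle"
    and AP :: "(('m, 'v, 'n) frame, 'p::real_normed_vector) chart set"
    and \<omega> :: "('m, 'v, 'n) frame \<Rightarrow> (('m, 'v, 'n) frame, 'p) tvec \<Rightarrow> 'n mat"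
    and L0FrE :: "('q, 'm, 'n) loop_bundle"
    and j :: "'q \<Rightarrow> real \<Rightarrow> ('m, 'v, 'n) frame"
  assumes "smooth_manifold AM"
    and "hermitian_vector_bundle AM E"
    and "frame_bundle_atlas AM E AP"
    and "loop_frame_reduction AM E AP L0FrE j"
    and "connection_form E AP \<omega>"
  shows "basic AM L0FrE
    (eq_pullback j (differential_to_loops AP j) (eq_trace (equivariant_curvature AP \<omega>)))"
proof -
  interpret reduced_frame_connection AM E AP \<omega> L0FrE j
    using assms by unfold_locales
  show ?thesis by (rule equivariant_curvature_basic)
qed

end
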